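(* Let $B=(b_1,\ldots,b_n) \in \mathcal S(\mathbb C^n, \mathbb C)$ be such that $\log(1-BB^* ) \in L^1(\mathbb T)$. Let $A: \mathbb D \rightarrow \mathcal L(\mathbb C^n, \mathbb C^n)$ be an outer function satisfying $B(\zeta)^*B(\zeta) + A(\zeta)^*A(\zeta) = I$ for a.e. $\zeta \in \mathbb T$, and let $\varphi = BA^{-1}: \mathbb D \rightarrow \mathcal L(\mathbb C^n, \mathbb C)$. Then $T_{\varphi}$ is a densely defined operator in $H^2_{\mathbb C^n}$, and the domain of $T_\varphi^*$ is $H(B)$. Moreover, $T_\varphi^*f = -f^+$ for $f \in H(B)$, and consequently, $$\|f\|_{H(B)}^2 = \|f\|_{H^2}^2 + \|T_\varphi^*f\|_{H^2_{\mathbb C^n}}^2, \quad f \in H(B).$$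
   Context: $\mathbb D$ is the open unit disc and $\mathbb T$ the unit circle. The Schur class $\mathcal S(\mathbb C^n,\mathbb C)$ consists of holomorphic $B:\mathbb D\to\mathcal L(\mathbb C^n,\mathbb C)$ with $\sup_{z\in\mathbb D}\|B(z)\|\le 1$. $H(B)$ is the de Branges–Rovnyak space, i.e. the reproducing kernel Hilbert space with kernel $K_B(z,\lambda)=\frac{1-B(z)B(\lambda)^*}{1-z\overline{\lambda}}$, $z,\lambda\in\mathbb D$. $H^2_{\mathcal Y}$ is the $\mathcal Y$-valued Hardy space (and $H^2=H^2_{\mathbb C}$), viewed as a closed subspace of $L^2(\mathbb T,\mathcal Y)$ via boundary values, with orthogonal projection $P$. For a measurable $\psi:\mathbb T\to\mathcal L(\mathcal X,\mathcal Y)$, the (possibly unbounded) Toeplitz operator is $T_\psi f=P(\psi f)$ with domain $\mathcal D(T_\psi)=\{f\in H^2_{\mathcal X}:\psi f\in L^2(\mathbb T,\mathcal Y)\}$. Under the hypothesis $\log(1-BB^* )\in L^1(\mathbb T)$, a function $f\in H^2$ belongs to $H(B)$ if and only if there exists $f^+\in H^2_{\mathbb C^n}$ with $T_B^*f+T_A^*f^+=0$; this $f^+$ is unique and $\|f\|_{H(B)}^2=\|f\|_{H^2}^2+\|f^+\|_{H^2_{\mathbb C^n}}^2$ (known result, Aleman–Malman). Since $A$ is outer, $A(z)$ is invertible for $z\in\mathbb D$. *)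

theory Defs
  imports "HOL-Analysis.Analysis"
begin

text \<open>Unit disc is ball 0 1; the unit circle is parametrised by t in [0, 2 pi] via cis t,
 with normalised measure dt/(2 pi).  Operators C^n -> C are row vectors complex^'n,
 operators C^n -> C^n are matrices complex^'n^'n (A $ i $ j = entry in row i, column j).\<close>

definition bv :: "(complex \<Rightarrow> 'a::t2_space) \<Rightarrow> real \<Rightarrow> 'a" where
  "bv f t = Lim (at_left 1) (\<lambda>r::real. f (complex_of_real r * cis t))"

text \<open>Scalar Hardy space H^2 (functions on the disc; values outside the disc are irrelevant).\<close>
definition H2 :: "(complex \<Rightarrow> complex) set" where
  "H2 = {f. f holomorphic_on ball 0 1 \<and>
      (\<exists>M. \<forall>r. 0 \<le> r \<and> r < 1 \<longrightarrow>
          (LINT t:{0..2*pi}|lborel. (cmod (f (complex_of_real r * cis t)))\<^sup>2) \<le> M)}"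

definition H2v :: "(complex \<Rightarrow> complex^'n) set" where
  "H2v = {f. \<forall>i. (\<lambda>z. f z $ i) \<in> H2}"

definition H2_inner :: "(complex \<Rightarrow> complex) \<Rightarrow> (complex \<Rightarrow> complex) \<Rightarrow> complex" where
  "H2_inner f g = (LINT t:{0..2*pi}|lborel. bv f t * cnj (bv g t)) / complex_of_real (2*pi)"

definition H2_norm :: "(complex \<Rightarrow> complex) \<Rightarrow> real" where
  "H2_norm f = sqrt ((LINT t:{0..2*pi}|lborel. (cmod (bv f t))\<^sup>2) / (2*pi))"

definition H2v_inner :: "(complex \<Rightarrow> complex^'n) \<Rightarrow> (complex \<Rightarrow> complex^'n) \<Rightarrow> complex" where
  "H2v_inner f g = (\<Sum>i\<in>UNIV. H2_inner (\<lambda>z. f z $ i) (\<lambda>z. g z $ i))"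

definition H2v_norm :: "(complex \<Rightarrow> complex^'n) \<Rightarrow> real" where
  "H2v_norm f = sqrt (\<Sum>i\<in>UNIV. (H2_norm (\<lambda>z. f z $ i))\<^sup>2)"

definition L2T :: "(real \<Rightarrow> complex) \<Rightarrow> bool" where
  "L2T g \<longleftrightarrow> set_borel_measurable lborel {0..2*pi} g \<and>
      set_integrable lborel {0..2*pi} (\<lambda>t. (cmod (g t))\<^sup>2)"

text \<open>Orthogonal (Szego/Riesz) projection P of L^2(T) onto H^2, realised via the Cauchy integral.\<close>
definition szego :: "(real \<Rightarrow> complex) \<Rightarrow> complex \<Rightarrow> complex" where
  "szego g z = (LINT t:{0..2*pi}|lborel. g t / (1 - z * cnj (cis t))) / complex_of_real (2*pi)"

definition toep_row_dom :: "(real \<Rightarrow> complex^'n) \<Rightarrow> (complex \<Rightarrow> complex^'n) set" where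
  "toep_row_dom \<psi> = {f \<in> H2v. L2T (\<lambda>t. \<Sum>i\<in>UNIV. \<psi> t $ i * bv f t $ i)}"

definition toep_row :: "(real \<Rightarrow> complex^'n) \<Rightarrow> (complex \<Rightarrow> complex^'n) \<Rightarrow> complex \<Rightarrow> complex" where
  "toep_row \<psi> f = szego (\<lambda>t. \<Sum>i\<in>UNIV. \<psi> t $ i * bv f t $ i)"

definition toep_mat_dom :: "(real \<Rightarrow> complex^'n^'n) \<Rightarrow> (complex \<Rightarrow> complex^'n) set" where
  "toep_mat_dom \<Psi> = {f \<in> H2v. \<forall>j. L2T (\<lambda>t. (\<Psi> t *v bv f t) $ j)}"

definition toep_mat :: "(real \<Rightarrow> complex^'n^'n) \<Rightarrow> (complex \<Rightarrow> complex^'n) \<Rightarrow> complex \<Rightarrow> complex^'n" where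
  "toep_mat \<Psi> f = (\<lambda>z. \<chi> j. szego (\<lambda>t. (\<Psi> t *v bv f t) $ j) z)"

text \<open>Adjoints of (possibly unbounded) operators T with domain D:
  adj_row D T g h  means  g \<in> dom(T^*) and T^* g = h.\<close>
definition adj_row :: "(complex \<Rightarrow> complex^'n) set \<Rightarrow> ((complex \<Rightarrow> complex^'n) \<Rightarrow> complex \<Rightarrow> complex)
    \<Rightarrow> (complex \<Rightarrow> complex) \<Rightarrow> (complex \<Rightarrow> complex^'n) \<Rightarrow> bool" where
  "adj_row D T g h \<longleftrightarrow> g \<in> H2 \<and> h \<in> H2v \<and> (\<forall>f\<in>D. H2_inner (T f) g = H2v_inner f h)"

definition adj_mat :: "(complex \<Rightarrow> complex^'n) set \<Rightarrow> ((complex \<Rightarrow> complex^'n) \<Rightarrow> complex \<Rightarrow> complex^'n)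
    \<Rightarrow> (complex \<Rightarrow> complex^'n) \<Rightarrow> (complex \<Rightarrow> complex^'n) \<Rightarrow> bool" where
  "adj_mat D T g h \<longleftrightarrow> g \<in> H2v \<and> h \<in> H2v \<and> (\<forall>f\<in>D. H2v_inner (T f) g = H2v_inner f h)"

definition dense_in_H2v :: "(complex \<Rightarrow> complex^'n) set \<Rightarrow> bool" where
  "dense_in_H2v D \<longleftrightarrow> D \<subseteq> H2v \<and>
     (\<forall>g\<in>H2v. \<forall>e>0. \<exists>f\<in>D. H2v_norm (\<lambda>z. f z - g z) < e)"

definition schur_row :: "(complex \<Rightarrow> complex^'n) \<Rightarrow> bool" where
  "schur_row B \<longleftrightarrow> (\<forall>i. (\<lambda>z. B z $ i) holomorphic_on ball 0 1) \<and> (\<forall>z\<in>ball 0 1. norm (B z) \<le> 1)"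

text \<open>Outer function D -> L(C^n,C^n): bounded analytic with A H^2_{C^n} dense in H^2_{C^n}
  (density of A times vector polynomials).\<close>
definition outer_mat :: "(complex \<Rightarrow> complex^'n^'n) \<Rightarrow> bool" where
  "outer_mat A \<longleftrightarrow> (\<forall>i j. (\<lambda>z. A z $ i $ j) holomorphic_on ball 0 1) \<and>
     (\<exists>M. \<forall>z\<in>ball 0 1. norm (A z) \<le> M) \<and>
     dense_in_H2v {(\<lambda>z. A z *v (\<Sum>k\<le>N. (z ^ k) *s c k)) | N c. True}"

text \<open>de Branges-Rovnyak kernel and space H(B) (RKHS, via Aronszajn's criterion).\<close>
definition KB :: "(complex \<Rightarrow> complex^'n) \<Rightarrow> complex \<Rightarrow> complex \<Rightarrow> complex" where
  "KB B z w = (1 - (\<Sum>i\<in>UNIV. B z $ i * cnj (B w $ i))) / (1 - z * cnj w)"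

definition pos_kernel :: "(complex \<Rightarrow> complex \<Rightarrow> complex) \<Rightarrow> bool" where
  "pos_kernel K \<longleftrightarrow> (\<forall>F c. finite F \<and> F \<subseteq> ball 0 1 \<longrightarrow>
      (let s = (\<Sum>z\<in>F. \<Sum>w\<in>F. c z * cnj (c w) * K z w) in Im s = 0 \<and> 0 \<le> Re s))"

definition HB :: "(complex \<Rightarrow> complex^'n) \<Rightarrow> (complex \<Rightarrow> complex) set" where
  "HB B = {f. \<exists>c::real. pos_kernel (\<lambda>z w. complex_of_real (c\<^sup>2) * KB B z w - f z * cnj (f w))}"

definition HB_norm :: "(complex \<Rightarrow> complex^'n) \<Rightarrow> (complex \<Rightarrow> complex) \<Rightarrow> real" where
  "HB_norm B f = Inf {c::real. 0 \<le> c \<and>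
      pos_kernel (\<lambda>z w. complex_of_real (c\<^sup>2) * KB B z w - f z * cnj (f w))}"

definition is_fplus :: "(complex \<Rightarrow> complex^'n) \<Rightarrow> (complex \<Rightarrow> complex^'n^'n)
    \<Rightarrow> (complex \<Rightarrow> complex) \<Rightarrow> (complex \<Rightarrow> complex^'n) \<Rightarrow> bool" where
  "is_fplus B A f fp \<longleftrightarrow> fp \<in> H2v \<and>
     (\<exists>u v. adj_row (toep_row_dom (bv B)) (toep_row (bv B)) f u \<and>
            adj_mat (toep_mat_dom (bv A)) (toep_mat (bv A)) fp v \<and>
            (\<forall>z\<in>ball 0 1. u z + v z = 0))"

end

theory Submission
  imports Defs "HOL-Complex_Analysis.Cauchy_Integral_Formula" "HOL-Real_Asymp.Real_Asymp"
begin

text \<open>Write \<open>T\<close> for the Toeplitz operator. As \<open>(B; A)\<close> is isometric on the circle, \<open>w = A\<^sup>-\<^sup>1 f\<close> is square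
  integrable for \<open>f\<close> in the domain of \<open>T\<close>, and since \<open>A\<close> is outer, Smirnov's principle makes \<open>w\<close> an element
  of \<open>H\<^sup>2\<close>. So the domain is \<open>A H\<^sup>2\<close>, \<open>T\<close> maps \<open>A w\<close> to \<open>B w\<close>, and \<open>T* f = h\<close> means that \<open>(f, -h)\<close> is orthogonal
  to the range of the isometry \<open>w \<mapsto> (B w, A w)\<close>. Projecting the Szego kernels to that orthogonal complement
  yields vectors whose Gram kernel is \<open>K\<^sub>B\<close>; by the Riesz representation, \<open>c\<^sup>2 K\<^sub>B - f f*\<close> is positive iff
  \<open>T* f = h\<close> exists with \<open>\<parallel>f\<parallel>\<^sup>2 + \<parallel>h\<parallel>\<^sup>2 \<le> c\<^sup>2\<close>. Boundary values are radial limits; they exist almost everywhere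
  by the weak type estimate for the radial maximal function.\<close>

section \<open>Square integrable functions on the circle\<close>

text \<open>Outerness is given only as density of \<open>A\<close> times polynomials in the norm of
  H^2, which does not directly say anything about division by \<open>A\<close>. The bridge is
  scalar: when \<open>A Q\<close> is close to the identity in H^2, a zero-free multiplier
  \<open>h\<close>, the exponential of a Herglotz integral, makes \<open>h A Q\<close> bounded. Its
  determinant has the form \<open>q det A\<close> with \<open>q\<close> bounded holomorphic, is
  bounded independently of the approximation, and tends to 1 at each point of the disc. Multiplying
  the Cramer numerators of \<open>A^-1 f\<close> by \<open>q\<close> gives functions of H^2 that
  converge to \<open>A^-1 f\<close>. H^2 is handled through Taylor coefficients, that is, as l^2.
  Its link with \<open>bv\<close> is Fatou's theorem: \<open>bv\<close> has an arbitrary default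
  value at every angle without radial limit, so each boundary identity must first be known to
  concern genuine limits. Functions of H^2 matter only inside the disc; they are compared there, and
  uniqueness of \<open>T* f\<close> takes the form of an equality of norms.\<close>

definition sq_int :: "'a measure \<Rightarrow> ('a \<Rightarrow> complex) \<Rightarrow> bool" where
  "sq_int M f \<longleftrightarrow> f \<in> borel_measurable M \<and> integrable M (\<lambda>x. (cmod (f x))\<^sup>2)"

lemma sq_int_measurable: "sq_int M f \<Longrightarrow> f \<in> borel_measurable M"
  and sq_int_integrable_sq: "sq_int M f \<Longrightarrow> integrable M (\<lambda>x. (cmod (f x))\<^sup>2)"
  by (auto simp: sq_int_def)

lemma cmod_mult_le_squares: "cmod (a * b) \<le> (cmod a)\<^sup>2 + (cmod b)\<^sup>2"
proof -
  have "2 * (cmod a * cmod b) \<le> (cmod a)\<^sup>2 + (cmod b)\<^sup>2"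
    using sum_squares_bound[of "cmod a" "cmod b"] by simp
  moreover have "0 \<le> cmod a * cmod b"
    by simp
  ultimately show ?thesis
    unfolding norm_mult by linarith
qed

lemma sq_int_mult_integrable:
  assumes "sq_int M f" "sq_int M g"
  shows "integrable M (\<lambda>x. f x * g x)"
proof (rule Bochner_Integration.integrable_bound)
  show "integrable M (\<lambda>x. (cmod (f x))\<^sup>2 + (cmod (g x))\<^sup>2)"
    using assms by (auto simp: sq_int_def)
  show "(\<lambda>x. f x * g x) \<in> borel_measurable M"
    using assms by (auto simp: sq_int_def)
  show "AE x in M. norm (f x * g x) \<le> norm ((cmod (f x))\<^sup>2 + (cmod (g x))\<^sup>2)"
    using cmod_mult_le_squares by (intro AE_I2) (metis abs_of_nonneg add_nonneg_nonneg real_norm_def zero_le_power2)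
qed

lemma sq_int_cnj:
  assumes "sq_int M f" shows "sq_int M (\<lambda>x. cnj (f x))"
proof -
  have "cnj \<in> borel_measurable borel"
    by (intro borel_measurable_continuous_onI continuous_intros)
  then show ?thesis
    using assms by (auto simp: sq_int_def intro: measurable_compose)
qed

lemma sq_int_cnj_mult_integrable:
  "sq_int M f \<Longrightarrow> sq_int M g \<Longrightarrow> integrable M (\<lambda>x. f x * cnj (g x))"
  using sq_int_mult_integrable sq_int_cnj by blast

lemma sq_int_scale: "sq_int M f \<Longrightarrow> sq_int M (\<lambda>x. c * f x)"
  by (auto simp: sq_int_def norm_mult power_mult_distrib)

lemma sq_int_add:
  assumes "sq_int M f" "sq_int M g"
  shows "sq_int M (\<lambda>x. f x + g x)"
  unfolding sq_int_def
proof
  show "(\<lambda>x. f x + g x) \<in> borel_measurable M"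
    using assms by (auto simp: sq_int_def)
  show "integrable M (\<lambda>x. (cmod (f x + g x))\<^sup>2)"
  proof (rule Bochner_Integration.integrable_bound)
    show "integrable M (\<lambda>x. 2 * (cmod (f x))\<^sup>2 + 2 * (cmod (g x))\<^sup>2)"
      using assms by (auto simp: sq_int_def)
    show "(\<lambda>x. (cmod (f x + g x))\<^sup>2) \<in> borel_measurable M"
      using assms by (auto simp: sq_int_def)
    have "(cmod (a + b))\<^sup>2 \<le> 2 * (cmod a)\<^sup>2 + 2 * (cmod b)\<^sup>2" for a b
    proof -
      have "(cmod (a + b))\<^sup>2 \<le> (cmod a + cmod b)\<^sup>2"
        by (intro power_mono norm_triangle_ineq) auto
      also have "\<dots> \<le> 2 * (cmod a)\<^sup>2 + 2 * (cmod b)\<^sup>2"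
        using sum_squares_bound[of "cmod a" "cmod b"] by (simp add: power2_sum)
      finally show ?thesis .
    qed
    then show "AE x in M. norm ((cmod (f x + g x))\<^sup>2) \<le> norm (2 * (cmod (f x))\<^sup>2 + 2 * (cmod (g x))\<^sup>2)"
      by simp
  qed
qed

lemma sq_int_diff: "sq_int M f \<Longrightarrow> sq_int M g \<Longrightarrow> sq_int M (\<lambda>x. f x - g x)"
  using sq_int_add[of M f "\<lambda>x. (-1) * g x"] sq_int_scale[of M g "-1"] by simp

lemma sq_int_zero: "sq_int M (\<lambda>x. 0)"
  by (simp add: sq_int_def)

lemma sq_int_sum: "(\<And>i. i \<in> I \<Longrightarrow> sq_int M (f i)) \<Longrightarrow> sq_int M (\<lambda>x. \<Sum>i\<in>I. f i x)"
  by (induction I rule: infinite_finite_induct) (auto simp: sq_int_zero intro: sq_int_add)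

lemma sq_int_cong_AE:
  assumes "sq_int M f" "g \<in> borel_measurable M" "AE x in M. f x = g x"
  shows "sq_int M g"
proof -
  have "integrable M (\<lambda>x. (cmod (g x))\<^sup>2)"
  proof (rule integrable_cong_AE_imp)
    show "integrable M (\<lambda>x. (cmod (f x))\<^sup>2)"
      using assms(1) by (simp add: sq_int_def)
    show "(\<lambda>x. (cmod (g x))\<^sup>2) \<in> borel_measurable M"
      using assms(2) by measurable
    show "AE x in M. (cmod (f x))\<^sup>2 = (cmod (g x))\<^sup>2"
      using assms(3) by eventually_elim simp
  qed
  with assms(2) show ?thesis
    by (simp add: sq_int_def)
qed

text \<open>Source of the Cauchy-Schwarz inequalities below and of the error bound in the Riesz
  argument. No sign of \<open>b\<close> is assumed: for negative \<open>b\<close> the quadratic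
  would tend to minus infinity.\<close>

lemma discriminant_le:
  fixes a b c :: real
  assumes "\<And>s. 0 \<le> a - 2 * s * c + s\<^sup>2 * b"
  shows "c\<^sup>2 \<le> a * b"
proof (cases "b = 0")
  case True
  have "c = 0"
  proof (rule ccontr)
    assume "c \<noteq> 0"
    \<comment> \<open>With \<open>b = 0\<close> this choice of \<open>s\<close> makes the expression
      equal to -1.\<close>
    then show False
      using assms[of "(a + 1) / (2 * c)"] True by (simp add: field_simps)
  qed
  then show ?thesis
    using True by simp
next
  case False
  have "b \<ge> 0"
  proof (rule ccontr)
    assume "\<not> b \<ge> 0"
    then have "filterlim (\<lambda>s. a - 2 * s * c + s\<^sup>2 * b) at_bot at_top"
      by real_asymp
    then obtain s where "a - 2 * s * c + s\<^sup>2 * b \<le> -1"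
      unfolding filterlim_at_bot eventually_at_top_linorder by blast
    then show False
      using assms[of s] by linarith
  qed
  then have "b > 0"
    using False by simp
  \<comment> \<open>\<open>c / b\<close> is the minimiser of the quadratic.\<close>
  have "a - 2 * (c / b) * c + (c / b)\<^sup>2 * b = a - c\<^sup>2 / b"
    using \<open>b > 0\<close> by (simp add: field_simps power2_eq_square)
  then have "0 \<le> a - c\<^sup>2 / b"
    using assms[of "c / b"] by simp
  then show ?thesis
    using \<open>b > 0\<close> by (simp add: field_simps)
qed

text \<open>The quadratic is formed with the moduli of \<open>f\<close> and \<open>g\<close>, so no
  phase has to be chosen and the bilinear product serves as well as the sesquilinear one.\<close>

lemma L2_Cauchy_Schwarz:
  assumes f: "sq_int M f" and g: "sq_int M g"
  shows "(cmod (LINT x|M. f x * g x))\<^sup>2 \<le> (LINT x|M. (cmod (f x))\<^sup>2) * (LINT x|M. (cmod (g x))\<^sup>2)"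
proof -
  define c where "c = (LINT x|M. cmod (f x) * cmod (g x))"
  have i1: "integrable M (\<lambda>x. cmod (f x) * cmod (g x))"
    using integrable_norm[OF sq_int_mult_integrable[OF f g]] by (simp add: norm_mult)
  have "0 \<le> (LINT x|M. (cmod (f x))\<^sup>2) - 2 * s * c + s\<^sup>2 * (LINT x|M. (cmod (g x))\<^sup>2)" for s
  proof -
    have "0 \<le> (LINT x|M. (cmod (f x) - s * cmod (g x))\<^sup>2)"
      by simp
    also have "\<dots> = (LINT x|M. (cmod (f x))\<^sup>2 - 2 * s * (cmod (f x) * cmod (g x)) + s\<^sup>2 * (cmod (g x))\<^sup>2)"
      by (intro Bochner_Integration.integral_cong refl) (simp add: power2_diff power_mult_distrib)
    also have "\<dots> = (LINT x|M. (cmod (f x))\<^sup>2) - 2 * s * c + s\<^sup>2 * (LINT x|M. (cmod (g x))\<^sup>2)"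
      using i1 f g by (simp add: c_def sq_int_def)
    finally show ?thesis .
  qed
  then have *: "c\<^sup>2 \<le> (LINT x|M. (cmod (f x))\<^sup>2) * (LINT x|M. (cmod (g x))\<^sup>2)"
    by (rule discriminant_le)
  have "cmod (LINT x|M. f x * g x) \<le> c"
    using integral_norm_bound[of M "\<lambda>x. f x * g x"] by (simp add: c_def norm_mult)
  then have "(cmod (LINT x|M. f x * g x))\<^sup>2 \<le> c\<^sup>2"
    by (intro power_mono) auto
  with * show ?thesis
    by linarith
qed

text \<open>Turns the set integrals and the guards \<open>t \<in> {0..2*pi}\<close> of the
  definitions into integrals and almost everywhere statements over one finite measure. Its mass
  stays 2*pi, so that factor is divided out explicitly everywhere.\<close>

definition circ :: "real measure" where
  "circ = restrict_space lborel {0..2*pi}"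

lemma space_circ [simp]: "space circ = {0..2*pi}"
  by (simp add: circ_def space_restrict_space)

lemma set_LINT_circ:
  fixes f :: "real \<Rightarrow> 'a::{banach, second_countable_topology}"
  shows "(LINT t:{0..2*pi}|lborel. f t) = (LINT t|circ. f t)"
  by (simp add: circ_def integral_restrict_space set_lebesgue_integral_def)

lemma AE_circ_iff: "(AE t in circ. P t) \<longleftrightarrow> (AE t in lborel. t \<in> {0..2*pi} \<longrightarrow> P t)"
  unfolding circ_def by (rule AE_restrict_space_iff) simp

lemma finite_measure_circ: "finite_measure circ"
  by (rule finite_measureI) (simp add: circ_def emeasure_restrict_space space_restrict_space)

lemma measure_circ [simp]: "measure circ {0..2*pi} = 2 * pi"
  by (simp add: circ_def measure_restrict_space)

lemma L2T_iff: "L2T g \<longleftrightarrow> sq_int circ g"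
  by (simp add: L2T_def sq_int_def circ_def set_borel_measurable_def set_integrable_def
      borel_measurable_restrict_space_iff integrable_restrict_space)

lemma borel_imp_circ: "f \<in> borel_measurable borel \<Longrightarrow> f \<in> borel_measurable circ"
  unfolding circ_def by (rule measurable_restrict_space1) simp

lemma integrable_circ_bounded:
  fixes f :: "real \<Rightarrow> 'a::{banach, second_countable_topology}"
  assumes "f \<in> borel_measurable circ" "\<And>t. norm (f t) \<le> C"
  shows "integrable circ f"
  using assms finite_measure.integrable_const_bound[OF finite_measure_circ] by blast

lemma sq_int_circ_bounded:
  assumes "f \<in> borel_measurable circ" "\<And>t. norm (f t) \<le> C"
  shows "sq_int circ f"
proof -
  have "norm ((cmod (f t))\<^sup>2) \<le> C\<^sup>2" for t
    using assms(2)[of t] by (simp add: power_mono)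
  then have "integrable circ (\<lambda>t. (cmod (f t))\<^sup>2)"
    using assms(1) by (intro integrable_circ_bounded[where C = "C\<^sup>2"]) auto
  with assms(1) show ?thesis
    by (simp add: sq_int_def)
qed

lemma sq_int_circ_integrable:
  assumes "sq_int circ f" shows "integrable circ f"
  using sq_int_mult_integrable[OF assms sq_int_circ_bounded[of "\<lambda>_. 1" 1]] by simp

section \<open>Fourier coefficients on the circle and Bessel's inequality\<close>

lemma measurable_cnj_cis_power: "(\<lambda>t. cnj (cis t ^ n)) \<in> borel_measurable circ"
  by (intro borel_imp_circ borel_measurable_continuous_onI continuous_intros)

lemma measurable_cis_power: "(\<lambda>t. cis t ^ n) \<in> borel_measurable circ"
  by (intro borel_imp_circ borel_measurable_continuous_onI continuous_intros)

lemma sq_int_cis_power: "sq_int circ (\<lambda>t. cis t ^ n)"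
  by (rule sq_int_circ_bounded[of _ 1]) (auto simp: measurable_cis_power norm_power)

lemma integral_circ_cis:
  assumes "k \<noteq> 0"
  shows "(LINT t|circ. cis (of_int k * t)) = 0"
proof -
  have "(LINT t|circ. cis (of_int k * t)) = (LINT t|lborel. indicator {0..2*pi} t *\<^sub>R cis (of_int k * t))"
    by (simp add: circ_def integral_restrict_space)
  also have "\<dots> = cis (of_int k * (2*pi)) / (\<i> * of_int k) - cis (of_int k * 0) / (\<i> * of_int k)"
  proof (rule integral_FTC_Icc)
    show "((\<lambda>t. cis (of_int k * t) / (\<i> * of_int k)) has_vector_derivative cis (of_int k * t))
        (at t within {0..2*pi})" for t
      using assms unfolding cis_conv_exp
      by (auto intro!: derivative_eq_intros has_vector_derivative_real_field simp: field_simps)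
    show "continuous_on {0..2*pi} (\<lambda>t. cis (of_int k * t))"
      by (intro continuous_intros)
  qed auto
  also have "cis (of_int k * (2*pi)) = 1"
    using cis_multiple_2pi[of "of_int k"] by (simp add: mult.commute mult.left_commute)
  finally show ?thesis
    by simp
qed

lemma integral_circ_orthonormal:
  "(LINT t|circ. cis t ^ n * cnj (cis t ^ m)) = (if n = m then 2 * pi else 0)"
proof -
  have *: "cis t ^ n * cnj (cis t ^ m) = cis (of_int (int n - int m) * t)" for t
    by (simp add: Complex.DeMoivre cis_cnj cis_mult algebra_simps)
  show ?thesis
    unfolding * using integral_circ_cis[of "int n - int m"] by (auto simp: scaleR_conv_of_real)
qed

text \<open>Only indices \<open>n >= 0\<close> occur: the negative frequencies are exactly what
  \<open>szego\<close> discards.\<close>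

definition fc :: "(real \<Rightarrow> complex) \<Rightarrow> nat \<Rightarrow> complex" where
  "fc u n = (LINT t|circ. u t * cnj (cis t ^ n)) / (2 * pi)"

definition trigp :: "(nat \<Rightarrow> complex) \<Rightarrow> nat \<Rightarrow> real \<Rightarrow> complex" where
  "trigp c N t = (\<Sum>n<N. c n * cis t ^ n)"

lemma sq_int_trigp: "sq_int circ (trigp c N)"
  unfolding trigp_def [abs_def] by (intro sq_int_sum sq_int_scale sq_int_cis_power)

lemma integral_mult_cnj_trigp:
  assumes u: "sq_int circ u"
  shows "(LINT t|circ. u t * cnj (trigp c N t)) = 2 * pi * (\<Sum>n<N. cnj (c n) * fc u n)"
proof -
  have "(LINT t|circ. u t * cnj (trigp c N t)) = (LINT t|circ. (\<Sum>n<N. cnj (c n) * (u t * cnj (cis t ^ n))))"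
    by (intro Bochner_Integration.integral_cong refl) (simp add: trigp_def sum_distrib_left mult_ac)
  also have "\<dots> = (\<Sum>n<N. (LINT t|circ. cnj (c n) * (u t * cnj (cis t ^ n))))"
    by (intro Bochner_Integration.integral_sum integrable_mult_right
        sq_int_cnj_mult_integrable u sq_int_cis_power)
  also have "\<dots> = 2 * pi * (\<Sum>n<N. cnj (c n) * fc u n)"
    by (simp add: fc_def sum_distrib_left)
  finally show ?thesis .
qed

lemma fc_trigp: "fc (trigp c N) n = (if n < N then c n else 0)"
proof -
  have "(LINT t|circ. trigp c N t * cnj (cis t ^ n)) =
      (LINT t|circ. (\<Sum>m<N. c m * (cis t ^ m * cnj (cis t ^ n))))"
    by (simp only: trigp_def sum_distrib_right mult.assoc)
  also have "\<dots> = (\<Sum>m<N. (LINT t|circ. c m * (cis t ^ m * cnj (cis t ^ n))))"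
    by (intro Bochner_Integration.integral_sum integrable_mult_right
        sq_int_cnj_mult_integrable sq_int_cis_power)
  also have "\<dots> = (\<Sum>m<N. if m = n then c m * (2 * pi) else 0)"
    by (intro sum.cong refl, subst integral_mult_right_zero, subst integral_circ_orthonormal) auto
  also have "\<dots> = (if n < N then c n * (2 * pi) else 0)"
    by simp
  finally show ?thesis
    by (simp add: fc_def)
qed

lemma complex_Re_mult_cnj: "Re (z * cnj z) = (cmod z)\<^sup>2"
  by (simp add: complex_mult_cnj cmod_power2)

lemma L2_norm_diff:
  assumes f: "sq_int M f" and g: "sq_int M g"
  shows "(LINT x|M. (cmod (f x - g x))\<^sup>2) =
    (LINT x|M. (cmod (f x))\<^sup>2) + (LINT x|M. (cmod (g x))\<^sup>2) - 2 * Re (LINT x|M. f x * cnj (g x))"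
proof -
  have "(cmod (a - b))\<^sup>2 = (cmod a)\<^sup>2 + (cmod b)\<^sup>2 - 2 * Re (a * cnj b)" for a b
    by (simp add: cmod_power2 power2_diff)
  then have "(LINT x|M. (cmod (f x - g x))\<^sup>2) =
    (LINT x|M. (cmod (f x))\<^sup>2 + (cmod (g x))\<^sup>2 - 2 * Re (f x * cnj (g x)))"
    by simp
  also have "\<dots> = (LINT x|M. (cmod (f x))\<^sup>2) + (LINT x|M. (cmod (g x))\<^sup>2) - 2 * Re (LINT x|M. f x * cnj (g x))"
    using sq_int_cnj_mult_integrable[OF f g] f g
    by (subst Bochner_Integration.integral_diff) (auto simp: sq_int_def integral_Re simp del: times_complex.sel)
  finally show ?thesis .
qed

lemma cnj_mult_self: "cnj z * z = complex_of_real ((cmod z)\<^sup>2)"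
  by (simp only: complex_norm_square mult.commute)

lemma L2_norm_trigp: "(LINT t|circ. (cmod (trigp c N t))\<^sup>2) = 2 * pi * (\<Sum>n<N. (cmod (c n))\<^sup>2)"
proof -
  have "(LINT t|circ. (cmod (trigp c N t))\<^sup>2) = (LINT t|circ. Re (trigp c N t * cnj (trigp c N t)))"
    by (simp only: complex_Re_mult_cnj)
  also have "\<dots> = Re (LINT t|circ. trigp c N t * cnj (trigp c N t))"
    by (intro integral_Re sq_int_cnj_mult_integrable sq_int_trigp)
  also have "\<dots> = Re (2 * pi * (\<Sum>n<N. cnj (c n) * c n))"
    by (subst integral_mult_cnj_trigp[OF sq_int_trigp]) (simp add: fc_trigp)
  also have "\<dots> = 2 * pi * (\<Sum>n<N. (cmod (c n))\<^sup>2)"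
    by (simp only: cnj_mult_self of_real_sum [symmetric] of_real_mult [symmetric] Re_complex_of_real)
  finally show ?thesis .
qed

lemma L2_diff_trigp:
  assumes "sq_int circ u"
  shows "(LINT t|circ. (cmod (u t - trigp (fc u) N t))\<^sup>2) =
    (LINT t|circ. (cmod (u t))\<^sup>2) - 2 * pi * (\<Sum>n<N. (cmod (fc u n))\<^sup>2)"
proof -
  have "Re (LINT t|circ. u t * cnj (trigp (fc u) N t)) = 2 * pi * (\<Sum>n<N. (cmod (fc u n))\<^sup>2)"
    by (simp only: integral_mult_cnj_trigp[OF assms] cnj_mult_self of_real_sum [symmetric]
        of_real_mult [symmetric] Re_complex_of_real)
  then show ?thesis
    by (simp add: L2_norm_diff[OF assms sq_int_trigp] L2_norm_trigp)
qed

lemma Bessel: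
  assumes "sq_int circ u"
  shows "2 * pi * (\<Sum>n<N. (cmod (fc u n))\<^sup>2) \<le> (LINT t|circ. (cmod (u t))\<^sup>2)"
proof -
  have "0 \<le> (LINT t|circ. (cmod (u t - trigp (fc u) N t))\<^sup>2)"
    by simp
  then show ?thesis
    unfolding L2_diff_trigp[OF assms] by simp
qed

lemma summable_fc:
  assumes "sq_int circ u"
  shows "summable (\<lambda>n. (cmod (fc u n))\<^sup>2)"
proof (rule summableI_nonneg_bounded)
  show "(\<Sum>n<N. (cmod (fc u n))\<^sup>2) \<le> (LINT t|circ. (cmod (u t))\<^sup>2) / (2 * pi)" for N
    using Bessel[OF assms, of N] by (simp add: field_simps)
qed auto

text \<open>The partial sums are bounded by the sum of the \<open>cmod (c n)\<close>, so dominated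
  convergence carries coefficients and norms to the limit. It applies on every circle of radius
  \<open>r < 1\<close>, where a power series converges absolutely.\<close>

lemma abs_series_fc:
  assumes c: "summable (\<lambda>n. cmod (c n))" and g: "\<And>t. (\<lambda>n. c n * cis t ^ n) sums g t"
  shows "sq_int circ g" "fc g n = c n" "(\<lambda>n. (cmod (c n))\<^sup>2) sums ((LINT t|circ. (cmod (g t))\<^sup>2) / (2 * pi))"
proof -
  define C where "C = (\<Sum>n. cmod (c n))"
  have lim: "(\<lambda>N. trigp c N t) \<longlonglongrightarrow> g t" for t
    using g[of t] by (simp add: sums_def trigp_def)
  have bd: "cmod (trigp c N t) \<le> C" for N t
  proof -
    have "cmod (trigp c N t) \<le> (\<Sum>n<N. cmod (c n))"
      unfolding trigp_def by (rule order_trans[OF norm_sum]) (simp add: norm_mult norm_power)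
    also have "\<dots> \<le> C"
      unfolding C_def by (rule sum_le_suminf) (use c in auto)
    finally show ?thesis .
  qed
  have mt: "trigp c N \<in> borel_measurable circ" for N
    using sq_int_trigp sq_int_def by blast
  have mg: "g \<in> borel_measurable circ"
    by (rule borel_measurable_LIMSEQ_metric[OF mt]) (use lim in auto)
  have gC: "cmod (g t) \<le> C" for t
    by (rule LIMSEQ_le_const2[OF tendsto_norm[OF lim]]) (use bd in auto)
  show sg: "sq_int circ g"
    by (rule sq_int_circ_bounded[OF mg gC])
  have "(\<lambda>N. fc (trigp c N) n) \<longlonglongrightarrow> fc g n" for n
    unfolding fc_def
  proof (intro tendsto_divide tendsto_const, rule integral_dominated_convergence[where w = "\<lambda>_. C"])
    show "integrable circ (\<lambda>_. C)"
      by (rule finite_measure.integrable_const[OF finite_measure_circ])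
    show "AE t in circ. (\<lambda>i. trigp c i t * cnj (cis t ^ n)) \<longlonglongrightarrow> g t * cnj (cis t ^ n)"
      by (intro AE_I2 tendsto_mult lim tendsto_const)
    show "AE t in circ. norm (trigp c i t * cnj (cis t ^ n)) \<le> C" for i
      using bd by (simp add: norm_mult norm_power)
    show "(\<lambda>t. g t * cnj (cis t ^ n)) \<in> borel_measurable circ"
      using mg measurable_cnj_cis_power[of n] by measurable
    show "(\<lambda>t. trigp c i t * cnj (cis t ^ n)) \<in> borel_measurable circ" for i
      using mt measurable_cnj_cis_power[of n] by measurable
  qed auto
  moreover have "(\<lambda>N. fc (trigp c N) n) \<longlonglongrightarrow> c n" for n
    unfolding fc_trigp by (rule tendsto_eventually) (use eventually_gt_at_top[of n] in eventually_elim, auto)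
  ultimately show fcg: "fc g n = c n" for n
    using LIMSEQ_unique by blast
  have "(\<lambda>N. (LINT t|circ. (cmod (trigp c N t))\<^sup>2)) \<longlonglongrightarrow> (LINT t|circ. (cmod (g t))\<^sup>2)"
  proof (rule integral_dominated_convergence[where w = "\<lambda>_. C\<^sup>2"])
    show "integrable circ (\<lambda>_. C\<^sup>2)"
      by (rule finite_measure.integrable_const[OF finite_measure_circ])
    show "AE t in circ. (\<lambda>i. (cmod (trigp c i t))\<^sup>2) \<longlonglongrightarrow> (cmod (g t))\<^sup>2"
      by (intro AE_I2 tendsto_intros lim)
    show "AE t in circ. norm ((cmod (trigp c i t))\<^sup>2) \<le> C\<^sup>2" for i
      using bd by (simp add: power_mono)
    show "(\<lambda>t. (cmod (g t))\<^sup>2) \<in> borel_measurable circ"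
      using mg by measurable
    show "(\<lambda>t. (cmod (trigp c i t))\<^sup>2) \<in> borel_measurable circ" for i
      using mt by measurable
  qed
  then have "(\<lambda>N. 2 * pi * (\<Sum>n<N. (cmod (c n))\<^sup>2) / (2 * pi)) \<longlonglongrightarrow> (LINT t|circ. (cmod (g t))\<^sup>2) / (2 * pi)"
    unfolding L2_norm_trigp by (intro tendsto_divide tendsto_const) auto
  then show "(\<lambda>n. (cmod (c n))\<^sup>2) sums ((LINT t|circ. (cmod (g t))\<^sup>2) / (2 * pi))"
    by (simp add: sums_def)
qed

section \<open>Radial limits and Taylor coefficients\<close>

lemma bv_eqI:
  assumes "((\<lambda>r. f (complex_of_real r * cis t)) \<longlongrightarrow> l) (at_left 1)"
  shows "bv f t = l"
  unfolding bv_def by (rule tendsto_Lim[OF _ assms]) simp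

text \<open>\<open>bv f t\<close> is defined for every \<open>t\<close>; this predicate says that
  its value is a radial limit and not the default of \<open>Lim\<close>.\<close>

definition has_bv :: "(complex \<Rightarrow> 'a::t2_space) \<Rightarrow> real \<Rightarrow> bool" where
  "has_bv f t \<longleftrightarrow> ((\<lambda>r. f (complex_of_real r * cis t)) \<longlongrightarrow> bv f t) (at_left 1)"

lemma has_bv_iff: "has_bv f t \<longleftrightarrow> (\<exists>l. ((\<lambda>r. f (complex_of_real r * cis t)) \<longlongrightarrow> l) (at_left 1))"
  using bv_eqI unfolding has_bv_def by metis

lemma eventually_at_left_1: "eventually (\<lambda>r::real. 0 < r \<and> r < 1) (at_left 1)"
  using eventually_at_left_real[of 0 1] by (simp add: conj_commute)

lemma ray_in_ball [simp]: "0 \<le> r \<Longrightarrow> r < 1 \<Longrightarrow> cmod (complex_of_real r * cis t) < 1"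
  by (simp add: norm_mult)

text \<open>The second equation needs no existence of limits: both sides are the same
  \<open>Lim\<close>, hence the same default where there is none.\<close>

lemma has_bv_cong:
  assumes "\<And>z. z \<in> ball 0 1 \<Longrightarrow> f z = g z"
  shows "has_bv f t \<longleftrightarrow> has_bv g t" "bv f t = bv g t"
proof -
  have ev: "eventually (\<lambda>r. f (complex_of_real r * cis t) = g (complex_of_real r * cis t)) (at_left 1)"
    using eventually_at_left_1 by eventually_elim (auto intro: assms)
  show "bv f t = bv g t"
    unfolding bv_def t2_space_class.Lim_def using tendsto_cong[OF ev] by simp
  then show "has_bv f t \<longleftrightarrow> has_bv g t"
    unfolding has_bv_def using tendsto_cong[OF ev] by simp
qed

text \<open>The radial limit exists iff the Cauchy criterion holds along rational radii,
  which is a countable, hence Borel, condition on the angle.\<close>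

lemma bv_measurable:
  fixes f :: "complex \<Rightarrow> 'a::{banach,second_countable_topology}"
  assumes f: "continuous_on (ball 0 1) f"
  shows "bv f \<in> borel_measurable borel"
proof -
  define g where "g r t = f (complex_of_real r * cis t)" for r t
  define Q where "Q = \<rat> \<inter> {0::real..<1}"
  define d where "d n = 1 - 1 / (real n + 2)" for n
  have dQ: "d n \<in> Q" for n
    by (auto simp: d_def Q_def field_simps)
  have gm: "g r \<in> borel_measurable borel" if "0 \<le> r" "r < 1" for r
    unfolding g_def [abs_def]
    by (intro borel_measurable_continuous_onI continuous_on_compose2[OF f] continuous_intros)
      (use that in \<open>auto simp: ray_in_ball\<close>)
  define R where "R k n t \<longleftrightarrow> (\<forall>p\<in>Q. d n < p \<longrightarrow> (\<forall>q\<in>Q. d n < q \<longrightarrow>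
      dist (g p t) (g q t) \<le> 1 / (real k + 1)))" for k n :: nat and t
  have R_D: "dist (g p t) (g q t) \<le> 1 / (real k + 1)"
    if "R k n t" "p \<in> Q" "q \<in> Q" "d n < p" "d n < q" for k n p q t
    using that by (simp add: R_def)
  define S where "S t \<longleftrightarrow> (\<forall>k. \<exists>n. R k n t)" for t
  have d_lim: "d \<longlonglongrightarrow> 1"
    unfolding d_def by real_asymp
  have d_lim': "filterlim d (at_left 1) sequentially"
    unfolding d_def by real_asymp
  have Slim: "S t \<longleftrightarrow> has_bv f t" for t
  proof
    assume S: "S t"
    have ray: "continuous_on {0..<1} (\<lambda>r. g r t)"
      unfolding g_def by (intro continuous_on_compose2[OF f] continuous_intros) auto
    \<comment> \<open>Continuity along the ray extends the oscillation bound from rational radii to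
      all radii between \<open>d n\<close> and 1.\<close>
    have close: "dist (g r t) (g s t) \<le> 1 / (real k + 1)"
      if R: "R k n t" and r: "d n < r" "r < 1" and s: "d n < s" "s < 1" for k n r s
    proof -
      have d0: "0 \<le> d n" for n
        by (simp add: d_def field_simps)
      have seq: "\<exists>x. (\<forall>i. x i \<in> Q \<and> d n < x i) \<and> x \<longlonglongrightarrow> r" if r: "d n < r" "r < 1" for r
      proof -
        have "\<exists>q\<in>\<rat>. max (d n) (r - 1 / (real i + 1)) < q \<and> q < r" for i
          using r by (intro Rats_dense_in_real) auto
        then obtain x where x: "\<And>i. x i \<in> \<rat> \<and> max (d n) (r - 1 / (real i + 1)) < x i \<and> x i < r"
          by metis
        have "x \<longlonglongrightarrow> r"
        proof (rule tendsto_sandwich[of "\<lambda>i. r - 1 / (real i + 1)" _ _ "\<lambda>i. r"])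
          show "(\<lambda>i. r - 1 / (real i + 1)) \<longlonglongrightarrow> r" by real_asymp
        qed (use x in \<open>auto simp: less_imp_le\<close>)
        moreover have "x i \<in> Q \<and> d n < x i" for i
          using x[of i] d0[of n] r by (auto simp: Q_def)
        ultimately show ?thesis by blast
      qed
      have gl: "(\<lambda>i. g (x i) t) \<longlonglongrightarrow> g r t" if "\<And>i. x i \<in> Q" "x \<longlonglongrightarrow> r" "0 \<le> r" "r < 1" for x r
        by (rule continuous_on_tendsto_compose[OF ray that(2)]) (use that in \<open>auto simp: Q_def\<close>)
      obtain x where x: "\<And>i. x i \<in> Q" "\<And>i. d n < x i" "x \<longlonglongrightarrow> r" using seq[OF r] by blast
      obtain y where y: "\<And>i. y i \<in> Q" "\<And>i. d n < y i" "y \<longlonglongrightarrow> s" using seq[OF s] by blast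
      show ?thesis
      proof (rule LIMSEQ_le_const2[OF tendsto_dist[OF gl[OF x(1,3)] gl[OF y(1,3)]]])
        show "\<exists>N. \<forall>i\<ge>N. dist (g (x i) t) (g (y i) t) \<le> 1 / (real k + 1)"
          by (intro exI allI impI R_D[OF R] x y)
      qed (use r s d0[of n] in auto)
    qed
    have small: "\<exists>k. 1 / (real k + 1) < e" if "e > 0" for e :: real
      using reals_Archimedean[OF that] by (auto simp: divide_inverse add.commute)
    have "Cauchy (\<lambda>i. g (d i) t)"
    proof (rule metric_CauchyI)
      fix e :: real assume "e > 0"
      then obtain k where k: "1 / (real k + 1) < e" using small by blast
      obtain n where n: "R k n t" using S S_def by blast
      have "dist (g (d i) t) (g (d j) t) < e" if "i > n" "j > n" for i j
      proof -
        have "d n < d i" "d n < d j" "d i < 1" "d j < 1"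
          using that by (auto simp: d_def field_simps)
        then show ?thesis
          using close[OF n, of "d i" "d j"] k by simp
      qed
      then show "\<exists>M. \<forall>m\<ge>M. \<forall>n\<ge>M. dist (g (d m) t) (g (d n) t) < e"
        by (intro exI[of _ "Suc n"]) auto
    qed
    then obtain l where l: "(\<lambda>i. g (d i) t) \<longlonglongrightarrow> l"
      using Cauchy_convergent_iff convergent_def by blast
    have "((\<lambda>r. g r t) \<longlongrightarrow> l) (at_left 1)"
    proof (rule tendstoI)
      fix e :: real assume "e > 0"
      then obtain k where k: "1 / (real k + 1) < e" using small by blast
      obtain n where n: "R k n t" using S S_def by blast
      have "dn < 1" if "dn = d n" for dn using that by (simp add: d_def)
      then have "eventually (\<lambda>r. r \<in> {d n<..<1}) (at_left 1)"
        by (intro eventually_at_left_real) auto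
      then show "eventually (\<lambda>r. dist (g r t) l < e) (at_left 1)"
      proof eventually_elim
        case (elim r)
        have "(\<lambda>i. dist (g r t) (g (d i) t)) \<longlonglongrightarrow> dist (g r t) l"
          by (intro tendsto_intros l)
        moreover have "dist (g r t) (g (d i) t) \<le> 1 / (real k + 1)" if "i > n" for i
        proof -
          have "d n < d i" "d i < 1"
            using that by (auto simp: d_def field_simps)
          then show ?thesis
            using close[OF n, of r "d i"] elim by simp
        qed
        then have "\<exists>N. \<forall>i\<ge>N. dist (g r t) (g (d i) t) \<le> 1 / (real k + 1)"
          by (intro exI[of _ "Suc n"]) auto
        ultimately have "dist (g r t) l \<le> 1 / (real k + 1)"
          by (rule LIMSEQ_le_const2)
        then show ?case using k by simp
      qed
    qed
    then show "has_bv f t"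
      unfolding has_bv_iff g_def by blast
  next
    assume "has_bv f t"
    then have l: "((\<lambda>r. g r t) \<longlongrightarrow> bv f t) (at_left 1)"
      by (simp add: has_bv_def g_def)
    show "S t"
      unfolding S_def
    proof
      fix k
      define e where "e = 1 / (real k + 1)"
      have "eventually (\<lambda>r. dist (g r t) (bv f t) < e / 2) (at_left 1)"
        by (rule tendstoD[OF l]) (simp add: e_def)
      then obtain b where b: "b < 1" "\<And>r. b < r \<Longrightarrow> r < 1 \<Longrightarrow> dist (g r t) (bv f t) < e / 2"
        unfolding eventually_at_left_field by blast
      have "eventually (\<lambda>n. b < d n) sequentially"
        using d_lim b(1) by (rule order_tendstoD)
      then obtain n where n: "b < d n"
        using eventually_happens'[OF sequentially_bot] by blast
      have "dist (g p t) (g q t) \<le> e" if "p \<in> Q" "q \<in> Q" "d n < p" "d n < q" for p q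
      proof -
        have "dist (g p t) (bv f t) < e / 2" "dist (g q t) (bv f t) < e / 2"
          using b(2)[of p] b(2)[of q] that n by (auto simp: Q_def)
        then show ?thesis
          using dist_triangle2[of "g p t" "g q t" "bv f t"] by linarith
      qed
      then show "\<exists>n. R k n t"
        unfolding R_def e_def [symmetric] by (intro exI[of _ n] ballI impI) simp
    qed
  qed
  have Rm: "Measurable.pred borel (R k n)" for k n
  proof -
    have "R k n = (\<lambda>t. \<forall>p :: rat. of_rat p \<in> Q \<longrightarrow> d n < of_rat p \<longrightarrow> (\<forall>q :: rat. of_rat q \<in> Q \<longrightarrow> d n < of_rat q \<longrightarrow>
        dist (g (of_rat p) t) (g (of_rat q) t) \<le> 1 / (real k + 1)))"
    proof (rule ext)
      fix t
      have *: "(\<forall>p\<in>Q. P p) \<longleftrightarrow> (\<forall>p::rat. of_rat p \<in> Q \<longrightarrow> P (of_rat p))" for P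
      proof (intro iffI ballI allI impI)
        fix p assume *: "\<forall>p::rat. of_rat p \<in> Q \<longrightarrow> P (of_rat p)" and p: "p \<in> Q"
        then obtain x :: rat where "p = of_rat x"
          by (auto simp: Q_def elim: Rats_cases)
        with * p show "P p" by simp
      qed simp
      show "R k n t \<longleftrightarrow> (\<forall>p :: rat. of_rat p \<in> Q \<longrightarrow> d n < of_rat p \<longrightarrow> (\<forall>q :: rat. of_rat q \<in> Q \<longrightarrow> d n < of_rat q \<longrightarrow>
          dist (g (of_rat p) t) (g (of_rat q) t) \<le> 1 / (real k + 1)))"
        by (simp only: R_def *)
    qed
    moreover have "Measurable.pred borel \<dots>"
    proof (intro pred_intros_countable pred_intros_imp')
      fix p q :: rat assume "of_rat p \<in> Q" "of_rat q \<in> Q"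
      then have [measurable]: "g (of_rat p) \<in> borel_measurable borel" "g (of_rat q) \<in> borel_measurable borel"
        by (auto simp: Q_def intro!: gm)
      show "Measurable.pred borel (\<lambda>x. dist (g (of_rat p) x) (g (of_rat q) x) \<le> 1 / (real k + 1))"
        by measurable
    qed
    ultimately show ?thesis
      by (simp only:)
  qed
  note Rm [measurable]
  have Sm: "Measurable.pred borel S"
    unfolding S_def [abs_def] by measurable
  \<comment> \<open>Where no radial limit exists, \<open>Lim\<close> unfolds to
    \<open>THE l. False\<close>, a constant, so the exceptional angles do not spoil
    measurability.\<close>
  have bv_eq: "bv f t = (if S t then lim (\<lambda>i. g (d i) t) else (THE l. False))" for t
  proof (cases "S t")
    case True
    then have "((\<lambda>r. g r t) \<longlongrightarrow> bv f t) (at_left 1)"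
      unfolding Slim has_bv_def g_def .
    then have "(\<lambda>i. g (d i) t) \<longlonglongrightarrow> bv f t"
      using d_lim' by (rule filterlim_compose)
    then show ?thesis
      using True by (simp add: limI)
  next
    case False
    then have "\<not> ((\<lambda>r. f (complex_of_real r * cis t)) \<longlongrightarrow> l) (at_left 1)" for l
      unfolding Slim has_bv_iff by blast
    then show ?thesis
      using False by (simp add: bv_def t2_space_class.Lim_def)
  qed
  have [measurable]: "g (d i) \<in> borel_measurable borel" for i
    using gm dQ[of i] by (auto simp: Q_def)
  have "(\<lambda>t. if S t then lim (\<lambda>i. g (d i) t) else (THE l. False)) \<in> borel_measurable borel"
    by (intro measurable_If borel_measurable_lim_metric measurable_const) (use Sm in \<open>auto simp: pred_def\<close>)
  moreover have "bv f = (\<lambda>t. if S t then lim (\<lambda>i. g (d i) t) else (THE l. False))"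
    by (rule ext) (rule bv_eq)
  ultimately show ?thesis
    by simp
qed

section \<open>Taylor coefficients and the description of H^2 as l^2\<close>

definition tc :: "(complex \<Rightarrow> complex) \<Rightarrow> nat \<Rightarrow> complex" where
  "tc f n = (deriv ^^ n) f 0 / fact n"

lemma tc_sums:
  assumes "f holomorphic_on ball 0 1" "cmod z < 1"
  shows "(\<lambda>n. tc f n * z ^ n) sums f z"
  using holomorphic_power_series[OF assms(1), of z] assms(2) by (simp add: tc_def)

lemma abs_summable_inside:
  assumes "\<And>z. cmod z < 1 \<Longrightarrow> summable (\<lambda>n. c n * z ^ n)" "0 \<le> r" "r < 1"
  shows "summable (\<lambda>n. cmod (c n * complex_of_real r ^ n))"
proof -
  have "summable (\<lambda>n. c n * complex_of_real ((r + 1) / 2) ^ n)"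
    using assms by (intro assms(1)) (simp only: norm_of_real, simp)
  moreover have "norm (complex_of_real r) < norm (complex_of_real ((r + 1) / 2))"
    using assms by (simp only: norm_of_real, simp)
  ultimately show ?thesis
    by (rule powser_insidea)
qed

lemma circle_series:
  assumes f: "\<And>z. cmod z < 1 \<Longrightarrow> (\<lambda>n. c n * z ^ n) sums f z" and r: "0 \<le> r" "r < 1"
  shows "sq_int circ (\<lambda>t. f (complex_of_real r * cis t))"
    "fc (\<lambda>t. f (complex_of_real r * cis t)) n = c n * complex_of_real r ^ n"
    "(\<lambda>n. (cmod (c n))\<^sup>2 * r ^ (2 * n)) sums ((LINT t|circ. (cmod (f (complex_of_real r * cis t)))\<^sup>2) / (2 * pi))"
proof -
  have s: "summable (\<lambda>n. cmod (c n * complex_of_real r ^ n))"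
    using abs_summable_inside[of c r] f r by (auto simp: sums_iff)
  have g: "(\<lambda>n. c n * complex_of_real r ^ n * cis t ^ n) sums f (complex_of_real r * cis t)" for t
    using f[of "complex_of_real r * cis t"] r by (simp add: power_mult_distrib mult.assoc)
  show "sq_int circ (\<lambda>t. f (complex_of_real r * cis t))"
    by (rule abs_series_fc(1)[OF s g])
  show "fc (\<lambda>t. f (complex_of_real r * cis t)) n = c n * complex_of_real r ^ n"
    by (rule abs_series_fc(2)[OF s g])
  have "(cmod (c n * complex_of_real r ^ n))\<^sup>2 = (cmod (c n))\<^sup>2 * r ^ (2 * n)" for n
    using r by (simp add: norm_mult norm_power power_mult_distrib power_mult [symmetric] mult.commute)
  then show "(\<lambda>n. (cmod (c n))\<^sup>2 * r ^ (2 * n)) sums ((LINT t|circ. (cmod (f (complex_of_real r * cis t)))\<^sup>2) / (2 * pi))"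
    using abs_series_fc(3)[OF s g] by simp
qed

text \<open>Both expansions are read as Fourier series on the circle of radius 1/2, where they
  represent the same function.\<close>

lemma tc_eqI:
  assumes f: "\<And>z. cmod z < 1 \<Longrightarrow> (\<lambda>n. c n * z ^ n) sums f z"
  shows "f holomorphic_on ball 0 1" "tc f = c"
proof -
  show h: "f holomorphic_on ball 0 1"
    using power_series_holomorphic[of 0 1 c f] f by simp
  show "tc f = c"
  proof
    fix n
    have "c n * complex_of_real (1/2) ^ n = tc f n * complex_of_real (1/2) ^ n"
      using circle_series(2)[of c f "1/2" n] circle_series(2)[of "tc f" f "1/2" n] f tc_sums[OF h]
      by simp
    then show "tc f n = c n"
      by simp
  qed
qed

text \<open>Parseval on the circle of radius \<open>r\<close> gives the mean square as the sum of
  |a_n|^2 r^(2n). A uniform bound passes to each finite partial sum as \<open>r\<close> tends to 1;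
  conversely \<open>r <= 1\<close> gives the bound at once.\<close>

lemma H2_iff: "f \<in> H2 \<longleftrightarrow> f holomorphic_on ball 0 1 \<and> summable (\<lambda>n. (cmod (tc f n))\<^sup>2)"
proof (cases "f holomorphic_on ball 0 1")
  case True
  define I where "I r = (LINT t|circ. (cmod (f (complex_of_real r * cis t)))\<^sup>2)" for r
  have I: "(\<lambda>n. (cmod (tc f n))\<^sup>2 * r ^ (2 * n)) sums (I r / (2 * pi))" if "0 \<le> r" "r < 1" for r
    unfolding I_def by (rule circle_series(3)[OF tc_sums[OF True] that])
  have "f \<in> H2 \<longleftrightarrow> (\<exists>M. \<forall>r. 0 \<le> r \<and> r < 1 \<longrightarrow> I r \<le> M)"
    using True by (simp add: H2_def set_LINT_circ I_def)
  also have "\<dots> \<longleftrightarrow> summable (\<lambda>n. (cmod (tc f n))\<^sup>2)"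
  proof
    assume "\<exists>M. \<forall>r. 0 \<le> r \<and> r < 1 \<longrightarrow> I r \<le> M"
    then obtain M where M: "\<And>r. 0 \<le> r \<Longrightarrow> r < 1 \<Longrightarrow> I r \<le> M" by blast
    have "(\<Sum>n<N. (cmod (tc f n))\<^sup>2) \<le> M / (2 * pi)" for N
    proof (rule tendsto_upperbound)
      show "((\<lambda>r. \<Sum>n<N. (cmod (tc f n))\<^sup>2 * r ^ (2 * n)) \<longlongrightarrow> (\<Sum>n<N. (cmod (tc f n))\<^sup>2)) (at_left 1)"
        by (rule tendsto_eq_intros refl)+ simp
      show "\<forall>\<^sub>F r in at_left 1. (\<Sum>n<N. (cmod (tc f n))\<^sup>2 * r ^ (2 * n)) \<le> M / (2 * pi)"
        using eventually_at_left_1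
      proof eventually_elim
        case (elim r)
        have "(\<Sum>n<N. (cmod (tc f n))\<^sup>2 * r ^ (2 * n)) \<le> I r / (2 * pi)"
          using I[of r] elim by (auto simp: sums_iff intro!: sum_le_suminf [THEN order_trans])
        also have "\<dots> \<le> M / (2 * pi)"
          using M[of r] elim by (intro divide_right_mono) auto
        finally show ?case .
      qed
    qed simp
    then show "summable (\<lambda>n. (cmod (tc f n))\<^sup>2)"
      by (intro summableI_nonneg_bounded) auto
  next
    assume s: "summable (\<lambda>n. (cmod (tc f n))\<^sup>2)"
    have "I r \<le> 2 * pi * (\<Sum>n. (cmod (tc f n))\<^sup>2)" if "0 \<le> r" "r < 1" for r
    proof -
      have "I r / (2 * pi) \<le> (\<Sum>n. (cmod (tc f n))\<^sup>2)"
        using I[OF that] s that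
        by (intro sums_le[OF _ I[OF that] summable_sums[OF s]]) (simp add: mult_left_le power_le_one)
      then show ?thesis
        by (simp add: field_simps)
    qed
    then show "\<exists>M. \<forall>r. 0 \<le> r \<and> r < 1 \<longrightarrow> I r \<le> M" by blast
  qed
  finally show ?thesis
    using True by simp
qed (simp add: H2_def)

section \<open>The radial maximal function\<close>

text \<open>Passage to the gauge integral, in which the translations and reflections of continuous
  integrands below are carried out.\<close>

lemma circ_eq_integral:
  fixes k :: "real \<Rightarrow> real"
  assumes "continuous_on UNIV k"
  shows "(LINT s|circ. k s) = integral {0..2*pi} k"
proof -
  have "set_integrable lborel {0..2*pi} k"
    by (rule borel_integrable_atLeastAtMost', rule continuous_on_subset[OF assms]) simp
  from set_borel_integral_eq_integral(2)[OF this] show ?thesis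
    by (simp add: set_LINT_circ)
qed

lemma integral_shift_real:
  fixes q :: "real \<Rightarrow> real"
  shows "integral {a..b} (\<lambda>s. q (t + s)) = integral {t+a..t+b} q"
  using integral_shift_Icc_real[of a b q t] by (simp add: o_def add.commute)

lemma integral_reflect_shift_real:
  fixes q :: "real \<Rightarrow> real"
  shows "integral {a..b} (\<lambda>s. q (t - s)) = integral {t-b..t-a} q"
proof -
  have "integral {a..b} (\<lambda>s. q (t - s)) = integral {-b..-a} (\<lambda>s. q (t + s))"
    using Henstock_Kurzweil_Integration.integral_reflect_real[of "-a" "-b" "\<lambda>s. q (t + s)"] by simp
  then show ?thesis
    by (simp add: integral_shift_real)
qed

lemma integrable_cont:
  fixes q :: "real \<Rightarrow> real"
  shows "continuous_on UNIV q \<Longrightarrow> q integrable_on {a..b}"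
  by (rule integrable_continuous_real, erule continuous_on_subset) simp

lemma integral_symmetric:
  fixes q :: "real \<Rightarrow> real"
  assumes q: "continuous_on UNIV q" and h: "0 \<le> h"
  shows "integral {0..h} (\<lambda>s. q (t + s) + q (t - s)) = integral {t-h..t+h} q"
proof -
  have c: "continuous_on UNIV (\<lambda>s. q (t + s))" "continuous_on UNIV (\<lambda>s. q (t - s))"
    by (intro continuous_on_compose2[OF q] continuous_intros; simp)+
  have "integral {0..h} (\<lambda>s. q (t + s) + q (t - s)) =
      integral {0..h} (\<lambda>s. q (t + s)) + integral {0..h} (\<lambda>s. q (t - s))"
    using c by (intro Henstock_Kurzweil_Integration.integral_add integrable_cont)
  also have "\<dots> = integral {t..t+h} q + integral {t-h..t} q"
    by (simp add: integral_shift_real integral_reflect_shift_real)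
  also have "\<dots> = integral {t-h..t+h} q"
    using h Henstock_Kurzweil_Integration.integral_combine[of "t-h" t "t+h" q] integrable_cont[OF q] by simp
  finally show ?thesis .
qed

text \<open>The interval from -pi to 3*pi contains every window \<open>{t-h..t+h}\<close> with
  \<open>t\<close> in \<open>{0..2*pi}\<close> and \<open>h <= pi\<close>. The second equation folds
  a period about 0, which leaves the half period on which the Poisson kernel decreases.\<close>

lemma integral_period:
  fixes q :: "real \<Rightarrow> real"
  assumes q: "continuous_on UNIV q" and per: "\<And>s. q (s + 2*pi) = q s"
  shows "integral {-pi..3*pi} q = 2 * integral {0..2*pi} q"
    and "integral {0..2*pi} q = integral {0..pi} (\<lambda>s. q s + q (- s))"
proof -
  note I = integrable_cont[OF q]
  note comb = Henstock_Kurzweil_Integration.integral_combine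
  have per': "q (2 * pi + s) = q s" for s
    using per[of s] by (simp add: add.commute)
  have a: "integral {-pi..0} q = integral {pi..2*pi} q"
    using integral_shift_real[of "-pi" 0 q "2*pi"] by (simp add: per')
  have b: "integral {0..pi} q = integral {2*pi..3*pi} q"
    using integral_shift_real[of 0 pi q "2*pi"] by (simp add: per')
  have "integral {-pi..0} q + integral {0..2*pi} q = integral {-pi..2*pi} q"
    "integral {-pi..2*pi} q + integral {2*pi..3*pi} q = integral {-pi..3*pi} q"
    "integral {0..pi} q + integral {pi..2*pi} q = integral {0..2*pi} q"
    by (intro comb I; simp)+
  then show "integral {-pi..3*pi} q = 2 * integral {0..2*pi} q"
    using a b by simp
  have "integral {0..pi} (\<lambda>s. q (0 + s) + q (0 - s)) = integral {0-pi..0+pi} q"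
    by (rule integral_symmetric[OF q]) simp
  moreover have "integral {-pi..0} q + integral {0..pi} q = integral {-pi..pi} q"
    by (intro comb I; simp)
  moreover have "integral {0..pi} q + integral {pi..2*pi} q = integral {0..2*pi} q"
    by (intro comb I; simp)
  ultimately show "integral {0..2*pi} q = integral {0..pi} (\<lambda>s. q s + q (- s))"
    using a by simp
qed

text \<open>A radially decreasing weight is a superposition of box kernels; the integration by parts
  expressing this is hidden in the derivative of \<open>P h * (2 * h * M - \<integral>\<^sub>0\<^sup>h w)\<close>.\<close>

lemma decreasing_kernel_bound:
  fixes w P P' :: "real \<Rightarrow> real"
  assumes w: "continuous_on {0..a} w" and a: "0 \<le> a"
    and P: "\<And>s. s \<in> {0..a} \<Longrightarrow> (P has_real_derivative P' s) (at s within {0..a})"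
    and P': "\<And>s. s \<in> {0..a} \<Longrightarrow> P' s \<le> 0" and P0: "\<And>s. s \<in> {0..a} \<Longrightarrow> 0 \<le> P s"
    and M: "\<And>h. 0 < h \<Longrightarrow> h \<le> a \<Longrightarrow> integral {0..h} w \<le> 2 * h * M"
  shows "integral {0..a} (\<lambda>s. P s * w s) \<le> 2 * M * integral {0..a} P"
proof -
  define \<Phi> where "\<Phi> h = P h * (2 * h * M - integral {0..h} w)" for h
  define \<Phi>' where "\<Phi>' h = P' h * (2 * h * M - integral {0..h} w) + P h * (2 * M - w h)" for h
  have d: "(\<Phi> has_real_derivative \<Phi>' h) (at h within {0..a})" if "h \<in> {0..a}" for h
    unfolding \<Phi>_def [abs_def] \<Phi>'_def
    by (rule derivative_eq_intros P[OF that] integral_has_real_derivative[OF w that] refl)+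
      (simp add: algebra_simps)
  have I: "(\<Phi>' has_integral (\<Phi> a - \<Phi> 0)) {0..a}"
    using fundamental_theorem_of_calculus[OF a, of \<Phi> \<Phi>'] d
    by (simp add: has_real_derivative_iff_has_vector_derivative)
  have Pc: "continuous_on {0..a} P"
    by (rule continuous_on_eq_continuous_within[THEN iffD2], rule ballI, rule DERIV_continuous[OF P])
  have M': "integral {0..h} w \<le> 2 * h * M" if "h \<in> {0..a}" for h
    using M[of h] that by (cases "h = 0") auto
  have i1: "(\<lambda>s. P s * w s) integrable_on {0..a}" and i2: "P integrable_on {0..a}"
    by (intro integrable_continuous_real continuous_intros Pc w)+
  have "((\<lambda>s. P s * (2 * M - w s)) has_integral (2 * M * integral {0..a} P - integral {0..a} (\<lambda>s. P s * w s))) {0..a}"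
    using has_integral_diff[OF has_integral_mult_right[OF integrable_integral[OF i2], of "2 * M"] integrable_integral[OF i1]]
    by (simp add: algebra_simps)
  moreover have "\<Phi>' s \<le> P s * (2 * M - w s)" if "s \<in> {0..a}" for s
    using mult_nonpos_nonneg[OF P'[OF that], of "2 * s * M - integral {0..s} w"] M'[OF that]
    by (simp add: \<Phi>'_def)
  ultimately have "\<Phi> a - \<Phi> 0 \<le> 2 * M * integral {0..a} P - integral {0..a} (\<lambda>s. P s * w s)"
    by (intro has_integral_le[OF I])
  moreover have "0 \<le> \<Phi> a" "\<Phi> 0 = 0"
    using M'[of a] P0[of a] a by (auto simp: \<Phi>_def)
  ultimately show ?thesis by linarith
qed

text \<open>The Poisson kernel of the disc at the real point \<open>r\<close>, without the factor
  1/(2*pi).\<close>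

definition pk :: "real \<Rightarrow> real \<Rightarrow> real" where
  "pk r s = (1 - r\<^sup>2) / (1 - 2 * r * cos s + r\<^sup>2)"

lemma pk_denom_pos:
  fixes r s :: real
  assumes "0 \<le> r" "r < 1" shows "0 < 1 - 2 * r * cos s + r\<^sup>2"
proof -
  have "0 < 1 - r" using assms by simp
  then have "0 < (1 - r)\<^sup>2" by (rule zero_less_power)
  also have "\<dots> \<le> 1 - 2 * r * cos s + r\<^sup>2"
    using assms mult_left_mono[OF cos_le_one[of s], of "2 * r"] by (simp add: power2_diff)
  finally show ?thesis .
qed

lemma pk_alt: "pk r s = (1 - r\<^sup>2) / (cmod (1 - complex_of_real r * cis s))\<^sup>2"
proof -
  have "(cmod (1 - complex_of_real r * cis s))\<^sup>2 = (1 - r * cos s)\<^sup>2 + (r * sin s)\<^sup>2"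
    by (simp add: cmod_power2)
  also have "\<dots> = 1 - 2 * r * cos s + r\<^sup>2 * ((sin s)\<^sup>2 + (cos s)\<^sup>2)"
    unfolding power2_eq_square by algebra
  finally show ?thesis
    by (simp add: pk_def)
qed

lemma pk_pos: "0 \<le> r \<Longrightarrow> r < 1 \<Longrightarrow> 0 < pk r s"
  using pk_denom_pos[of r s] by (auto simp: pk_def power_less_one_iff abs_square_less_1)

lemma pk_deriv:
  assumes "0 \<le> r" "r < 1"
  shows "(pk r has_real_derivative - ((1 - r\<^sup>2) * (2 * r * sin s)) / (1 - 2 * r * cos s + r\<^sup>2)\<^sup>2) (at s within S)"
proof -
  have "((\<lambda>s. 1 - 2 * r * cos s + r\<^sup>2) has_real_derivative 2 * r * sin s) (at s within S)"
    by (auto intro!: derivative_eq_intros)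
  from DERIV_divide[OF DERIV_const[of "1 - r\<^sup>2"] this] pk_denom_pos[OF assms, of s]
  show ?thesis
    unfolding pk_def [abs_def] by (simp add: power2_eq_square)
qed

lemma pk_continuous: "0 \<le> r \<Longrightarrow> r < 1 \<Longrightarrow> continuous_on S (pk r)"
  by (rule continuous_on_eq_continuous_within[THEN iffD2], rule ballI, rule DERIV_continuous[OF pk_deriv])

text \<open>The Cauchy kernel is expanded as a geometric series and integrated term by term; the
  terms are dominated in L^1 by a multiple of \<open>cmod z ^ n\<close>.\<close>

lemma szego_sums:
  assumes u: "integrable circ u" and z: "cmod z < 1"
  shows "(\<lambda>n. fc u n * z ^ n) sums szego u z"
proof -
  have g: "(\<lambda>n. u t * cnj (cis t ^ n) * z ^ n) sums (u t / (1 - z * cnj (cis t)))" for t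
  proof -
    have "(\<lambda>n. (z * cnj (cis t)) ^ n) sums (1 / (1 - z * cnj (cis t)))"
      by (rule geometric_sums) (use z in \<open>simp add: norm_mult\<close>)
    from sums_mult[OF this, of "u t"] show ?thesis
      by (simp add: power_mult_distrib mult_ac)
  qed
  have um: "u \<in> borel_measurable circ"
    using u by auto
  have i: "integrable circ (\<lambda>t. u t * cnj (cis t ^ n) * z ^ n)" for n
  proof (rule Bochner_Integration.integrable_bound[OF integrable_norm[OF u]])
    show "(\<lambda>t. u t * cnj (cis t ^ n) * z ^ n) \<in> borel_measurable circ"
      using um measurable_cnj_cis_power[of n] by measurable
    show "AE t in circ. norm (u t * cnj (cis t ^ n) * z ^ n) \<le> norm (norm (u t))"
      using z by (intro AE_I2) (simp add: norm_mult norm_power mult_left_le power_le_one)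
  qed
  have "(\<lambda>n. (LINT t|circ. u t * cnj (cis t ^ n) * z ^ n)) sums (LINT t|circ. (\<Sum>n. u t * cnj (cis t ^ n) * z ^ n))"
  proof (rule sums_integral[OF i])
    show "AE t in circ. summable (\<lambda>n. norm (u t * cnj (cis t ^ n) * z ^ n))"
      using z by (intro AE_I2) (simp add: norm_mult norm_power summable_mult summable_geometric)
    have "(\<lambda>n. (LINT t|circ. norm (u t * cnj (cis t ^ n) * z ^ n))) = (\<lambda>n. (LINT t|circ. norm (u t)) * cmod z ^ n)"
      by (simp add: norm_mult norm_power)
    then show "summable (\<lambda>n. (LINT t|circ. norm (u t * cnj (cis t ^ n) * z ^ n)))"
      using z by (simp add: summable_mult summable_geometric)
  qed
  then have "(\<lambda>n. (LINT t|circ. u t * cnj (cis t ^ n) * z ^ n) / (2 * pi)) sums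
      ((LINT t|circ. u t / (1 - z * cnj (cis t))) / (2 * pi))"
    using g by (intro sums_divide) (simp add: sums_iff)
  moreover have "(LINT t|circ. u t * cnj (cis t ^ n) * z ^ n) / (2 * pi) = fc u n * z ^ n" for n
    by (simp add: fc_def)
  ultimately show ?thesis
    by (simp add: szego_def set_LINT_circ)
qed

text \<open>Cauchy's formula for \<open>w \<mapsto> f w / (1 - r * w)\<close> at the real point \<open>r\<close> is Poisson's formula for \<open>f\<close>.\<close>

lemma poisson_series:
  assumes c: "summable (\<lambda>n. cmod (c n))" and r: "0 \<le> r" "r < 1"
    and f: "\<And>z. cmod z \<le> 1 \<Longrightarrow> (\<lambda>n. c n * z ^ n) sums f z"
  shows "f (complex_of_real r) = (LINT s|circ. f (cis s) * pk r s) / (2 * pi)"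
proof -
  \<comment> \<open>Taylor coefficients of \<open>f z / (1 - r * z)\<close>, written as a Cauchy
    product.\<close>
  define g where "g n = (\<Sum>i\<le>n. c i * complex_of_real r ^ (n - i))" for n
  have geo: "summable (\<lambda>n. cmod (complex_of_real r ^ n))"
    using r by (simp add: norm_power summable_geometric)
  have gs: "summable (\<lambda>n. cmod (g n))"
  proof -
    have "summable (\<lambda>n. \<Sum>i\<le>n. cmod (c i) * cmod (complex_of_real r ^ (n - i)))"
      by (rule summable_Cauchy_product) (use c geo in simp_all)
    then show ?thesis
    proof (rule summable_comparison_test'[where N = 0])
      show "norm (cmod (g n)) \<le> (\<Sum>i\<le>n. cmod (c i) * cmod (complex_of_real r ^ (n - i)))" for n
        unfolding g_def real_norm_def abs_norm_cancel by (rule order_trans[OF norm_sum]) (simp add: norm_mult)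
    qed
  qed
  have gf: "(\<lambda>n. g n * z ^ n) sums (f z / (1 - complex_of_real r * z))" if z: "cmod z \<le> 1" for z
  proof -
    have zn: "cmod z ^ n \<le> 1" for n
      using z by (simp add: power_le_one)
    have "r * cmod z \<le> r * 1"
      using r z by (intro mult_left_mono) auto
    then have "cmod (complex_of_real r * z) < 1"
      using r by (simp add: norm_mult)
    then have geo': "(\<lambda>n. (complex_of_real r * z) ^ n) sums (1 / (1 - complex_of_real r * z))"
      by (rule geometric_sums)
    have "(\<lambda>k. \<Sum>i\<le>k. c i * z ^ i * (complex_of_real r * z) ^ (k - i)) sums
        ((\<Sum>k. c k * z ^ k) * (\<Sum>k. (complex_of_real r * z) ^ k))"
    proof (rule Cauchy_product_sums)
      show "summable (\<lambda>k. norm (c k * z ^ k))"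
        by (rule summable_comparison_test'[OF c]) (use zn in \<open>simp add: norm_mult norm_power mult_left_le\<close>)
      show "summable (\<lambda>k. norm ((complex_of_real r * z) ^ k))"
        using \<open>cmod (complex_of_real r * z) < 1\<close> by (simp only: norm_power, intro summable_geometric) simp
    qed
    moreover have "(\<Sum>i\<le>k. c i * z ^ i * (complex_of_real r * z) ^ (k - i)) = g k * z ^ k" for k
      unfolding g_def sum_distrib_right
    proof (intro sum.cong refl)
      fix i assume "i \<in> {..k}"
      then have "z ^ k = z ^ i * z ^ (k - i)"
        by (simp add: power_add [symmetric])
      then show "c i * z ^ i * (complex_of_real r * z) ^ (k - i) = c i * complex_of_real r ^ (k - i) * z ^ k"
        by (simp add: power_mult_distrib)
    qed
    ultimately show ?thesis
      using f[OF z] geo' by (simp add: sums_iff)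
  qed
  define G where "G t = f (cis t) / (1 - complex_of_real r * cis t)" for t
  have Gs: "(\<lambda>n. g n * cis t ^ n) sums G t" for t
    unfolding G_def by (rule gf) simp
  note G = abs_series_fc[OF gs Gs]
  have "(\<lambda>n. g n * complex_of_real r ^ n) sums szego G (complex_of_real r)"
    using szego_sums[OF sq_int_circ_integrable[OF G(1)], of "complex_of_real r"] r by (simp add: G(2))
  moreover have "(\<lambda>n. g n * complex_of_real r ^ n) sums (f (complex_of_real r) / (1 - complex_of_real r * complex_of_real r))"
    using r by (intro gf) simp
  ultimately have "f (complex_of_real r) / (1 - complex_of_real r * complex_of_real r) = szego G (complex_of_real r)"
    by (rule sums_unique2[symmetric])
  moreover have "complex_of_real r * complex_of_real r \<noteq> 1"
  proof -
    have "r * r \<le> r * 1"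
      using r by (intro mult_left_mono) auto
    then have "r * r \<noteq> 1"
      using r by linarith
    then show ?thesis
      by (metis of_real_1 of_real_eq_iff of_real_mult)
  qed
  ultimately have "f (complex_of_real r) = (1 - (complex_of_real r)\<^sup>2) * szego G (complex_of_real r)"
    by (simp add: field_simps power2_eq_square)
  also have "\<dots> = (LINT s|circ. (1 - (complex_of_real r)\<^sup>2) * (G s / (1 - complex_of_real r * cnj (cis s)))) / (2 * pi)"
    unfolding szego_def set_LINT_circ integral_mult_right_zero by simp
  \<comment> \<open>On the circle the two Cauchy factors are conjugate to each other, so their
    product is the squared modulus in \<open>pk_alt\<close>.\<close>
  also have "(\<lambda>s. (1 - (complex_of_real r)\<^sup>2) * (G s / (1 - complex_of_real r * cnj (cis s)))) = (\<lambda>s. f (cis s) * pk r s)"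
  proof
    fix s
    have "complex_of_real (pk r s) = (1 - (complex_of_real r)\<^sup>2) /
        ((1 - complex_of_real r * cis s) * cnj (1 - complex_of_real r * cis s))"
      by (simp only: pk_alt complex_norm_square [symmetric] of_real_divide of_real_diff of_real_power of_real_1)
    then show "(1 - (complex_of_real r)\<^sup>2) * (G s / (1 - complex_of_real r * cnj (cis s))) = f (cis s) * pk r s"
      by (simp add: G_def mult_ac)
  qed
  finally show ?thesis .
qed

text \<open>Poisson's formula for the constant function 1 gives mass 2*pi over a period; evenness of
  the kernel halves it.\<close>

lemma integral_pk:
  assumes "0 \<le> r" "r < 1"
  shows "integral {0..pi} (pk r) = pi"
proof -
  have "(\<lambda>n. (if n = 0 then 1 else 0) * z ^ n) sums (1::complex)" for z
    using sums_single[of 0 "\<lambda>n. z ^ n"] by (simp add: if_distrib [of "\<lambda>x. x * _"] cong: if_cong)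
  then have "1 = (LINT s|circ. complex_of_real (pk r s)) / (2 * pi)"
    using poisson_series[of "\<lambda>n. if n = 0 then 1 else 0" r "\<lambda>z. 1"] assms
    by (simp add: if_distrib [of cmod] cong: if_cong)
  then have "complex_of_real (LINT s|circ. pk r s) = complex_of_real (2 * pi)"
    by (simp add: field_simps)
  then have "(LINT s|circ. pk r s) = 2 * pi"
    by (simp only: of_real_eq_iff)
  moreover have "(LINT s|circ. pk r s) = integral {0..pi} (\<lambda>s. pk r s + pk r (- s))"
    using pk_continuous[OF assms] by (simp add: circ_eq_integral integral_period(2) pk_def)
  moreover have "integral {0..pi} (\<lambda>s. pk r s + pk r (- s)) = 2 * integral {0..pi} (pk r)"
  proof -
    have "pk r (- s) = pk r s" for s
      by (simp add: pk_def)
    then show ?thesis by simp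
  qed
  ultimately show ?thesis by simp
qed

text \<open>A rotation moves the ray to the positive axis. There the Poisson integral, folded about
  0, has a decreasing weight on \<open>{0..pi}\<close>, so window averages bounded by
  \<open>M\<close> bound it; the kernel mass pi on that interval cancels all constants.\<close>

lemma radial_le_maximal:
  assumes c: "summable (\<lambda>n. cmod (c n))" and r: "0 \<le> r" "r < 1"
    and f: "\<And>z. cmod z \<le> 1 \<Longrightarrow> (\<lambda>n. c n * z ^ n) sums f z"
    and q: "continuous_on UNIV q" "\<And>s. q s = cmod (f (cis s))"
    and M: "\<And>h. 0 < h \<Longrightarrow> h \<le> pi \<Longrightarrow> integral {t-h..t+h} q \<le> 2 * h * M"
  shows "cmod (f (complex_of_real r * cis t)) \<le> M"
proof -
  have "f (complex_of_real r * cis t) = (LINT s|circ. f (cis s * cis t) * pk r s) / (2 * pi)"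
  proof (rule poisson_series[of "\<lambda>n. c n * cis t ^ n" r "\<lambda>z. f (z * cis t)", OF _ r])
    show "summable (\<lambda>n. cmod (c n * cis t ^ n))"
      using c by (simp add: norm_mult norm_power)
    show "(\<lambda>n. c n * cis t ^ n * z ^ n) sums f (z * cis t)" if "cmod z \<le> 1" for z
      using f[of "z * cis t"] that by (simp add: norm_mult power_mult_distrib mult_ac)
  qed
  then have "cmod (f (complex_of_real r * cis t)) = cmod (LINT s|circ. f (cis s * cis t) * pk r s) / (2 * pi)"
    by (simp add: norm_divide)
  also have "\<dots> \<le> (LINT s|circ. cmod (f (cis s * cis t) * pk r s)) / (2 * pi)"
    by (intro divide_right_mono integral_norm_bound) simp
  also have "(\<lambda>s. cmod (f (cis s * cis t) * pk r s)) = (\<lambda>s. q (t + s) * pk r s)"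
    using pk_pos[OF r] by (auto simp: norm_mult q(2) cis_mult add.commute less_imp_le)
  also have "(LINT s|circ. q (t + s) * pk r s) = integral {0..2*pi} (\<lambda>s. q (t + s) * pk r s)"
    by (intro circ_eq_integral continuous_intros pk_continuous r continuous_on_compose2[OF q(1)]) auto
  also have "\<dots> = integral {0..pi} (\<lambda>s. q (t + s) * pk r s + q (t + - s) * pk r (- s))"
    by (intro integral_period(2) continuous_intros pk_continuous r continuous_on_compose2[OF q(1)])
      (auto simp: pk_def q(2) cis_mult [symmetric] add.assoc [symmetric])
  also have "\<dots> = integral {0..pi} (\<lambda>s. pk r s * (q (t + s) + q (t - s)))"
  proof -
    have "pk r (- s) = pk r s" for s
      by (simp add: pk_def)
    then show ?thesis
      by (simp add: algebra_simps)
  qed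
  also have "\<dots> \<le> 2 * M * integral {0..pi} (pk r)"
  proof (rule decreasing_kernel_bound)
    show "continuous_on {0..pi} (\<lambda>s. q (t + s) + q (t - s))"
      by (intro continuous_intros continuous_on_compose2[OF q(1)]) auto
    show "integral {0..h} (\<lambda>s. q (t + s) + q (t - s)) \<le> 2 * h * M" if "0 < h" "h \<le> pi" for h
      using M[OF that] that by (subst integral_symmetric[OF q(1)]) auto
    \<comment> \<open>The kernel decreases on the half period because the sine is nonnegative
      there.\<close>
    show "- ((1 - r\<^sup>2) * (2 * r * sin s)) / (1 - 2 * r * cos s + r\<^sup>2)\<^sup>2 \<le> 0" if "s \<in> {0..pi}" for s
      using r that by (intro divide_nonpos_nonneg) (auto simp: sin_ge_zero abs_square_le_1)
  qed (use r pk_deriv pk_pos in \<open>auto simp: less_imp_le\<close>)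
  finally show ?thesis
    by (simp add: integral_pk r divide_right_mono)
qed

text \<open>The weak type (1,1) bound of Hardy and Littlewood. Vitali's lemma selects disjoint
  windows whose fivefold enlargements cover \<open>U\<close>, which is the origin of the 5;
  disjointness lets their integrals add up to at most one integral over the enlarged
  interval.\<close>

lemma maximal_weak_type:
  fixes q :: "real \<Rightarrow> real"
  assumes q: "continuous_on UNIV q" and q0: "\<And>s. 0 \<le> q s" and lam: "0 < lam"
    and U: "U \<in> sets lborel" "U \<subseteq> {0..2*pi}"
    and E: "\<And>t. t \<in> U \<Longrightarrow> \<exists>h. 0 < h \<and> h \<le> pi \<and> 2 * h * lam < integral {t-h..t+h} q"
  shows "emeasure lborel U \<le> ennreal (5 / lam * integral {-pi..3*pi} q)"
proof -
  obtain h where h: "\<And>t. t \<in> U \<Longrightarrow> 0 < h t \<and> h t \<le> pi \<and> 2 * h t * lam < integral {t-h t..t+h t} q"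
    using E by metis
  obtain C where C: "countable C" "C \<subseteq> U"
     "pairwise (\<lambda>i j. disjnt (cball i (h i)) (cball j (h j))) C"
     "U \<subseteq> (\<Union>i\<in>C. cball i (5 * h i))"
  proof (rule Vitali_covering_lemma_cballs[where S = U and K = U and a = "\<lambda>i. i" and r = h and B = pi])
    show "U \<subseteq> (\<Union>i\<in>U. cball i (h i))"
      using h by (force simp: less_imp_le)
  qed (use h in auto)
  define \<nu> where "\<nu> = density lborel (\<lambda>x. ennreal (q x))"
  have [measurable]: "q \<in> borel_measurable borel"
    by (rule borel_measurable_continuous_onI[OF q])
  have \<nu>: "emeasure \<nu> {a..b} = ennreal (integral {a..b} q)" for a b
  proof -
    have "((\<lambda>x. q x * indicator {a..b} x) has_integral integral {a..b} q) UNIV"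
    proof -
      have "(\<lambda>x. q x * indicator {a..b} x) = (\<lambda>x. if x \<in> {a..b} then q x else 0)"
        by auto
      then show ?thesis
        using integrable_integral[OF integrable_cont[OF q, of a b]]
        by (simp only: has_integral_restrict_UNIV)
    qed
    then have "(\<integral>\<^sup>+x. ennreal (q x * indicator {a..b} x) \<partial>lborel) = ennreal (integral {a..b} q)"
      by (intro nn_integral_has_integral_lborel) (auto simp: q0)
    then show ?thesis
      by (simp add: \<nu>_def emeasure_density ennreal_mult' q0 ennreal_indicator)
  qed
  \<comment> \<open>\<open>C\<close> may be finite, so its balls are indexed by all natural numbers
    with empty sets outside \<open>I\<close>.\<close>
  define I where "I = to_nat_on C ` C"
  define c where "c n = from_nat_into C n" for n
  have c: "c n \<in> C" if "n \<in> I" for n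
    using that C(1) by (auto simp: I_def c_def)
  have cinj: "n = m" if "n \<in> I" "m \<in> I" "c n = c m" for n m
    using that C(1) by (auto simp: I_def c_def)
  define g where "g n = (if n \<in> I then cball (c n) (h (c n)) else {})" for n
  define G where "G n = (if n \<in> I then cball (c n) (5 * h (c n)) else {})" for n
  have "disjoint_family g"
    unfolding disjoint_family_on_def
  proof (intro ballI impI)
    fix m n :: nat assume "m \<noteq> n"
    show "g m \<inter> g n = {}"
    proof (cases "m \<in> I \<and> n \<in> I")
      case True
      then have "c m \<noteq> c n"
        using cinj \<open>m \<noteq> n\<close> by blast
      then show ?thesis
        using True C(3) c by (simp add: g_def pairwise_def disjnt_def)
    qed (auto simp: g_def)
  qed
  have "(\<Union>i\<in>C. cball i (5 * h i)) \<subseteq> (\<Union>n. G n)"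
  proof clarify
    fix i x assume "i \<in> C" "x \<in> cball i (5 * h i)"
    then show "x \<in> (\<Union>n. G n)"
      using C(1) by (auto simp: G_def I_def c_def intro!: exI[of _ "to_nat_on C i"])
  qed
  then have "emeasure lborel U \<le> emeasure lborel (\<Union>n. G n)"
    using C(4) by (intro emeasure_mono) (auto simp: G_def)
  also have "\<dots> \<le> (\<Sum>n. emeasure lborel (G n))"
    by (rule emeasure_subadditive_countably) (auto simp: G_def)
  also have "\<dots> \<le> (\<Sum>n. ennreal (5 / lam) * emeasure \<nu> (g n))"
  proof (rule suminf_le)
    fix n
    show "emeasure lborel (G n) \<le> ennreal (5 / lam) * emeasure \<nu> (g n)"
    proof (cases "n \<in> I")
      case True
      let ?t = "c n"
      have t: "?t \<in> U"
        using c[OF True] C(2) by blast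
      \<comment> \<open>10 h is the length of the enlarged window, and \<open>2 * h * lam\<close>
        lies below the integral over the original one.\<close>
      have "10 * h ?t \<le> 5 / lam * integral {?t - h ?t..?t + h ?t} q"
        using h[OF t] lam by (simp add: field_simps)
      then have "ennreal (10 * h ?t) \<le> ennreal (5 / lam) * ennreal (integral {?t - h ?t..?t + h ?t} q)"
        using lam by (subst ennreal_mult' [symmetric]) (auto intro: ennreal_leI)
      then show ?thesis
        using True h[OF t] by (simp add: G_def g_def cball_eq_atLeastAtMost \<nu>)
    qed (simp add: G_def)
  qed auto
  also have "\<dots> = ennreal (5 / lam) * emeasure \<nu> (\<Union>n. g n)"
    using \<open>disjoint_family g\<close>
    by (subst ennreal_suminf_cmult, subst suminf_emeasure) (auto simp: g_def \<nu>_def)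
  also have "\<dots> \<le> ennreal (5 / lam) * emeasure \<nu> {-pi..3*pi}"
  proof (intro mult_left_mono emeasure_mono)
    have "cball t (h t) \<subseteq> {-pi..3*pi}" if "t \<in> U" for t
      using h[OF that] U(2) that by (force simp: cball_eq_atLeastAtMost)
    then show "(\<Union>n. g n) \<subseteq> {-pi..3*pi}"
      using c C(2) unfolding g_def by (auto split: if_splits) 
  qed (auto simp: \<nu>_def)
  also have "\<dots> = ennreal (5 / lam * integral {-pi..3*pi} q)"
    unfolding \<nu> using lam by (subst ennreal_mult' [symmetric]) auto
  finally show ?thesis .
qed

text \<open>If no window about \<open>t\<close> had average above \<open>lam\<close>,
  \<open>radial_le_maximal\<close> would bound the whole ray by \<open>lam\<close>. The constant is
  5/lam from the covering, times 2 for the two periods, times 2*pi from Cauchy-Schwarz against the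
  function 1.\<close>

lemma radial_maximal:
  assumes c: "summable (\<lambda>n. cmod (c n))" and lam: "0 < lam"
    and f: "\<And>z. cmod z \<le> 1 \<Longrightarrow> (\<lambda>n. c n * z ^ n) sums f z"
    and U: "U \<in> sets lborel" "U \<subseteq> {0..2*pi}"
    and E: "\<And>t. t \<in> U \<Longrightarrow> \<exists>r. 0 \<le> r \<and> r < 1 \<and> lam < cmod (f (complex_of_real r * cis t))"
  shows "emeasure lborel U \<le> ennreal (20 * pi / lam * sqrt (\<Sum>n. (cmod (c n))\<^sup>2))"
proof -
  define q where "q s = cmod (f (cis s))" for s
  have fs: "(\<lambda>n. c n * cis t ^ n) sums f (cis t)" for t
    by (rule f) simp
  have "continuous_on UNIV (\<lambda>s. f (cis s))"
  proof (rule uniform_limit_theorem)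
    show "uniform_limit UNIV (\<lambda>N s. \<Sum>n<N. c n * cis s ^ n) (\<lambda>s. f (cis s)) sequentially"
      using fs Weierstrass_m_test[of UNIV "\<lambda>n s. c n * cis s ^ n" "\<lambda>n. cmod (c n)"] c
      by (simp add: norm_mult norm_power sums_iff)
    show "\<forall>\<^sub>F N in sequentially. continuous_on UNIV (\<lambda>s. \<Sum>n<N. c n * cis s ^ n)"
      by (intro always_eventually allI continuous_intros)
  qed auto
  then have q: "continuous_on UNIV q"
    unfolding q_def [abs_def] by (intro continuous_intros)
  have per: "q (s + 2 * pi) = q s" for s
    by (simp add: q_def cis_mult [symmetric])
  have "emeasure lborel U \<le> ennreal (5 / lam * integral {-pi..3*pi} q)"
  proof (rule maximal_weak_type[OF q _ lam U])
    show "\<exists>h. 0 < h \<and> h \<le> pi \<and> 2 * h * lam < integral {t-h..t+h} q" if "t \<in> U" for t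
    proof (rule ccontr)
      assume "\<not> ?thesis"
      then have "\<And>h. 0 < h \<Longrightarrow> h \<le> pi \<Longrightarrow> integral {t-h..t+h} q \<le> 2 * h * lam"
        by (meson not_le)
      then have "cmod (f (complex_of_real r * cis t)) \<le> lam" if "0 \<le> r" "r < 1" for r
        using that by (intro radial_le_maximal[OF c _ _ f q q_def])
      then show False
        using E[OF that] by (meson not_le)
    qed
  qed (simp add: q_def)
  also have "5 / lam * integral {-pi..3*pi} q = 10 / lam * (LINT s|circ. q s)"
    by (simp add: integral_period(1)[OF q per] circ_eq_integral[OF q])
  also have "(LINT s|circ. q s) \<le> 2 * pi * sqrt (\<Sum>n. (cmod (c n))\<^sup>2)"
  proof -
    note F = abs_series_fc[OF c fs]
    define S where "S = (\<Sum>n. (cmod (c n))\<^sup>2)"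
    have q2: "sq_int circ (\<lambda>s. complex_of_real (q s))"
      using F(1) by (auto simp: sq_int_def q_def)
    have "(cmod (LINT s|circ. complex_of_real (q s) * 1))\<^sup>2 \<le>
        (LINT s|circ. (cmod (complex_of_real (q s)))\<^sup>2) * (LINT s|circ. (cmod 1)\<^sup>2)"
      by (intro L2_Cauchy_Schwarz q2 sq_int_circ_bounded[of _ 1]) auto
    also have "(LINT s|circ. (cmod (complex_of_real (q s)))\<^sup>2) = 2 * pi * S"
      using F(3) by (simp add: q_def sums_iff S_def field_simps)
    also have "(LINT s|circ. (cmod 1)\<^sup>2) = 2 * pi"
      by simp
    finally have "(LINT s|circ. q s)\<^sup>2 \<le> (2 * pi)\<^sup>2 * S"
      by (simp add: power2_eq_square mult_ac)
    then have "\<bar>LINT s|circ. q s\<bar> \<le> sqrt ((2 * pi)\<^sup>2 * S)"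
      using real_sqrt_le_mono by fastforce
    then show ?thesis
      by (simp add: real_sqrt_mult S_def)
  qed
  then have "10 / lam * (LINT s|circ. q s) \<le> 20 * pi / lam * sqrt (\<Sum>n. (cmod (c n))\<^sup>2)"
    using lam mult_left_mono[of "LINT s|circ. q s" _ "10 / lam"] by fastforce
  then have "ennreal (10 / lam * (LINT s|circ. q s)) \<le> ennreal (20 * pi / lam * sqrt (\<Sum>n. (cmod (c n))\<^sup>2))"
    by (rule ennreal_leI)
  finally show ?thesis .
qed

section \<open>Fatou's theorem\<close>

text \<open>Fatou's lemma for squared moduli. Integrability of the limit is part of the conclusion;
  the convergent majorant \<open>J\<close> replaces a limes inferior of integrals.\<close>

lemma L2_fatou:
  assumes u: "\<And>k. sq_int M (u k)" and v: "v \<in> borel_measurable M"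
    and lim: "AE x in M. (\<lambda>k. u k x) \<longlonglongrightarrow> v x"
    and J: "\<And>k::nat. (LINT x|M. (cmod (u k x))\<^sup>2) \<le> J k" "J \<longlonglongrightarrow> L"
  shows "sq_int M v" "(LINT x|M. (cmod (v x))\<^sup>2) \<le> L"
proof -
  have um [measurable]: "u k \<in> borel_measurable M" for k
    using u by (simp add: sq_int_def)
  note v [measurable]
  have J0: "0 \<le> J k" for k
    by (rule order_trans[OF _ J(1)]) simp
  have L0: "0 \<le> L"
    by (rule LIMSEQ_le_const[OF J(2)]) (use J0 in auto)
  have "(\<integral>\<^sup>+x. ennreal ((cmod (v x))\<^sup>2) \<partial>M) = (\<integral>\<^sup>+x. liminf (\<lambda>k. ennreal ((cmod (u k x))\<^sup>2)) \<partial>M)"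
  proof (rule nn_integral_cong_AE)
    show "AE x in M. ennreal ((cmod (v x))\<^sup>2) = liminf (\<lambda>k. ennreal ((cmod (u k x))\<^sup>2))"
      using lim
    proof eventually_elim
      case (elim x)
      have "(\<lambda>k. ennreal ((cmod (u k x))\<^sup>2)) \<longlonglongrightarrow> ennreal ((cmod (v x))\<^sup>2)"
        by (intro tendsto_ennrealI tendsto_intros elim)
      then show ?case
        by (rule lim_imp_Liminf[OF sequentially_bot, symmetric])
    qed
  qed
  also have "\<dots> \<le> liminf (\<lambda>k. \<integral>\<^sup>+x. ennreal ((cmod (u k x))\<^sup>2) \<partial>M)"
    by (rule nn_integral_liminf) measurable
  also have "\<dots> \<le> liminf (\<lambda>k. ennreal (J k))"
  proof (rule Liminf_mono, rule always_eventually, rule allI)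
    fix k
    have "(\<integral>\<^sup>+x. ennreal ((cmod (u k x))\<^sup>2) \<partial>M) = ennreal (LINT x|M. (cmod (u k x))\<^sup>2)"
      by (rule nn_integral_eq_integral) (use u in \<open>auto simp: sq_int_def\<close>)
    then show "(\<integral>\<^sup>+x. ennreal ((cmod (u k x))\<^sup>2) \<partial>M) \<le> ennreal (J k)"
      using J(1) by (simp add: ennreal_leI)
  qed
  also have "\<dots> = ennreal L"
    by (rule lim_imp_Liminf[OF sequentially_bot tendsto_ennrealI[OF J(2)]])
  finally have *: "(\<integral>\<^sup>+x. ennreal ((cmod (v x))\<^sup>2) \<partial>M) \<le> ennreal L" .
  have "integrable M (\<lambda>x. (cmod (v x))\<^sup>2)"
  proof (rule integrableI_nonneg)
    show "(\<integral>\<^sup>+x. ennreal ((cmod (v x))\<^sup>2) \<partial>M) < \<infinity>"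
      using * by (rule order_le_less_trans) simp
  qed auto
  then show "sq_int M v"
    using v by (simp add: sq_int_def)
  show "(LINT x|M. (cmod (v x))\<^sup>2) \<le> L"
    using nn_integral_eq_integral[OF \<open>integrable M (\<lambda>x. (cmod (v x))\<^sup>2)\<close>] * L0 by simp
qed

lemma L2_tendsto_inner:
  assumes v: "sq_int M v" and u: "\<And>N. sq_int M (u N)" "sq_int M w"
    and lim: "(\<lambda>N. LINT x|M. (cmod (u N x - w x))\<^sup>2) \<longlonglongrightarrow> 0"
  shows "(\<lambda>N::nat. LINT x|M. v x * u N x) \<longlonglongrightarrow> (LINT x|M. v x * w x)"
proof -
  have le: "cmod ((LINT x|M. v x * u N x) - (LINT x|M. v x * w x)) \<le>
      sqrt ((LINT x|M. (cmod (v x))\<^sup>2) * (LINT x|M. (cmod (u N x - w x))\<^sup>2))" for N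
  proof -
    have "(LINT x|M. v x * u N x) - (LINT x|M. v x * w x) = (LINT x|M. v x * (u N x - w x))"
      unfolding right_diff_distrib
      by (rule Bochner_Integration.integral_diff [symmetric]; intro sq_int_mult_integrable v u)
    then show ?thesis
      using L2_Cauchy_Schwarz[OF v sq_int_diff[OF u(1) u(2)], of N] by (simp add: real_le_rsqrt)
  qed
  have "(\<lambda>N. sqrt ((LINT x|M. (cmod (v x))\<^sup>2) * (LINT x|M. (cmod (u N x - w x))\<^sup>2))) \<longlonglongrightarrow>
      sqrt ((LINT x|M. (cmod (v x))\<^sup>2) * 0)"
    by (intro tendsto_intros lim)
  then have "(\<lambda>N. (LINT x|M. v x * u N x) - (LINT x|M. v x * w x)) \<longlonglongrightarrow> 0"
    by (intro Lim_null_comparison[OF always_eventually[OF allI[OF le]]]) simp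
  then show ?thesis
    by (rule LIM_zero_cancel)
qed

text \<open>Radii increasing to 1, for convergence theorems that speak of sequences and not of
  \<open>at_left 1\<close>.\<close>

definition rad :: "nat \<Rightarrow> real" where
  "rad k = 1 - 1 / (real k + 2)"

lemma rad: "0 < rad k" "rad k < 1" "rad k \<le> rad (Suc k)"
  by (auto simp: rad_def field_simps)

lemma rad_LIMSEQ: "rad \<longlonglongrightarrow> 1"
  unfolding rad_def by real_asymp

lemma rad_at_left: "filterlim rad (at_left 1) sequentially"
  unfolding rad_def by real_asymp

lemma has_bv_rad: "has_bv f t \<Longrightarrow> (\<lambda>k. f (complex_of_real (rad k) * cis t)) \<longlonglongrightarrow> bv f t"
  unfolding has_bv_def by (rule filterlim_compose[OF _ rad_at_left])

lemma Cauchy_at_left_1: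
  fixes g :: "real \<Rightarrow> 'a::complete_space"
  assumes g: "\<And>e. 0 < e \<Longrightarrow> \<exists>b<1. \<forall>r s. b < r \<longrightarrow> r < 1 \<longrightarrow> b < s \<longrightarrow> s < 1 \<longrightarrow> dist (g r) (g s) \<le> e"
  shows "\<exists>l. (g \<longlongrightarrow> l) (at_left 1)"
proof -
  have ev: "\<exists>N. \<forall>k\<ge>N. b < rad k" if "b < 1" for b
    using order_tendstoD(1)[OF rad_LIMSEQ that] by (simp add: eventually_sequentially)
  have "Cauchy (\<lambda>k. g (rad k))"
  proof (rule metric_CauchyI)
    fix e :: real assume "0 < e"
    then obtain b where b: "b < 1" "\<And>r s. b < r \<Longrightarrow> r < 1 \<Longrightarrow> b < s \<Longrightarrow> s < 1 \<Longrightarrow> dist (g r) (g s) \<le> e / 2"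
      using g[of "e / 2"] by auto
    obtain N where N: "\<And>k. k \<ge> N \<Longrightarrow> b < rad k"
      using ev[OF b(1)] by blast
    have "dist (g (rad m)) (g (rad n)) < e" if "m \<ge> N" "n \<ge> N" for m n
      using b(2)[OF N[OF that(1)] rad(2) N[OF that(2)] rad(2)] \<open>0 < e\<close> by linarith
    then show "\<exists>M. \<forall>m\<ge>M. \<forall>n\<ge>M. dist (g (rad m)) (g (rad n)) < e"
      by blast
  qed
  then obtain l where l: "(\<lambda>k. g (rad k)) \<longlonglongrightarrow> l"
    using Cauchy_convergent_iff convergent_def by blast
  have "(g \<longlongrightarrow> l) (at_left 1)"
  proof (rule tendstoI)
    fix e :: real assume "0 < e"
    then obtain b where b: "b < 1" "\<And>r s. b < r \<Longrightarrow> r < 1 \<Longrightarrow> b < s \<Longrightarrow> s < 1 \<Longrightarrow> dist (g r) (g s) \<le> e / 2"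
      using g[of "e / 2"] by auto
    obtain N where N: "\<And>k. k \<ge> N \<Longrightarrow> b < rad k"
      using ev[OF b(1)] by blast
    have "eventually (\<lambda>r. r \<in> {b<..<1}) (at_left 1)"
      by (rule eventually_at_left_real[OF b(1)])
    then show "eventually (\<lambda>r. dist (g r) l < e) (at_left 1)"
    proof eventually_elim
      case (elim r)
      have "(\<lambda>k. dist (g r) (g (rad k))) \<longlonglongrightarrow> dist (g r) l"
        by (intro tendsto_intros l)
      moreover have "dist (g r) (g (rad k)) \<le> e / 2" if "k \<ge> N" for k
        using b(2)[of r "rad k"] elim N[OF that] rad(2) by simp
      ultimately have "dist (g r) l \<le> e / 2"
        by (intro LIMSEQ_le_const2[of _ "dist (g r) l"]) auto
      then show ?case
        using \<open>0 < e\<close> by linarith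
    qed
  qed
  then show ?thesis by blast
qed

text \<open>The dilates of \<open>f\<close> by \<open>rad k\<close> have absolutely summable
  coefficients, so \<open>radial_maximal\<close> bounds their exceptional sets \<open>V k\<close>
  uniformly. These sets increase to \<open>U\<close>, since a point of one dilate is a point of the
  next at a smaller parameter, and continuity of the measure from below keeps the constant.\<close>

lemma radial_maximal_H2:
  assumes c: "summable (\<lambda>n. (cmod (c n))\<^sup>2)" and lam: "0 < lam"
    and f: "\<And>z. cmod z < 1 \<Longrightarrow> (\<lambda>n. c n * z ^ n) sums f z"
  defines "U \<equiv> {t\<in>{0..2*pi}. \<exists>r. 0 \<le> r \<and> r < 1 \<and> lam < cmod (f (complex_of_real r * cis t))}"
  shows "U \<in> sets lborel" "emeasure lborel U \<le> ennreal (20 * pi / lam * sqrt (\<Sum>n. (cmod (c n))\<^sup>2))"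
proof -
  define V where "V k = {t\<in>{0..2*pi}. \<exists>r. 0 \<le> r \<and> r < 1 \<and> lam < cmod (f (complex_of_real (rad k) * (complex_of_real r * cis t)))}" for k
  have hol: "f holomorphic_on ball 0 1"
    by (rule tc_eqI(1)[OF f])
  have Vm: "V k \<in> sets lborel" for k
  proof -
    have "open {t. lam < cmod (f (complex_of_real (rad k) * (complex_of_real r * cis t)))}" if "0 \<le> r" "r < 1" for r
    proof (intro open_Collect_less continuous_intros continuous_on_compose2[OF holomorphic_on_imp_continuous_on[OF hol]])
      have "rad k * r \<le> 1 * r"
        using that rad(2)[of k] by (intro mult_right_mono) auto
      then have "rad k * r < 1"
        using that by simp
      then show "(\<lambda>t. complex_of_real (rad k) * (complex_of_real r * cis t)) ` UNIV \<subseteq> ball 0 1"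
        using rad(1)[of k] that by (auto simp: norm_mult)
    qed
    \<comment> \<open>The union over uncountably many radii stays measurable because each of its
      members is open.\<close>
    then have "open (\<Union>r\<in>{0..<1}. {t. lam < cmod (f (complex_of_real (rad k) * (complex_of_real r * cis t)))})"
      by auto
    moreover have "V k = {0..2*pi} \<inter> (\<Union>r\<in>{0..<1}. {t. lam < cmod (f (complex_of_real (rad k) * (complex_of_real r * cis t)))})"
      by (auto simp: V_def)
    ultimately show ?thesis
      by auto
  qed
  have Vb: "emeasure lborel (V k) \<le> ennreal (20 * pi / lam * sqrt (\<Sum>n. (cmod (c n))\<^sup>2))" for k
  proof -
    have s: "summable (\<lambda>n. cmod (c n * complex_of_real (rad k) ^ n))"
      by (rule abs_summable_inside) (use f rad[of k] in \<open>auto simp: sums_iff less_imp_le\<close>)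
    have le: "(cmod (c n * complex_of_real (rad k) ^ n))\<^sup>2 \<le> (cmod (c n))\<^sup>2" for n
      using rad[of k] by (intro power_mono) (auto simp: norm_mult norm_power less_imp_le intro!: mult_left_le power_le_one)
    have "emeasure lborel (V k) \<le> ennreal (20 * pi / lam * sqrt (\<Sum>n. (cmod (c n * complex_of_real (rad k) ^ n))\<^sup>2))"
    proof (rule radial_maximal[OF s lam _ Vm])
      show "(\<lambda>n. c n * complex_of_real (rad k) ^ n * z ^ n) sums f (complex_of_real (rad k) * z)" if "cmod z \<le> 1" for z
      proof -
        have "rad k * cmod z \<le> rad k * 1"
          using rad(1)[of k] that by (intro mult_left_mono) auto
        moreover have "cmod (complex_of_real (rad k) * z) = rad k * cmod z"
          using rad(1)[of k] by (simp add: norm_mult)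
        ultimately have "cmod (complex_of_real (rad k) * z) < 1"
          using rad(2)[of k] by linarith
        from f[OF this] show ?thesis
          by (simp add: power_mult_distrib mult.assoc)
      qed
    qed (auto simp: V_def)
    also have "\<dots> \<le> ennreal (20 * pi / lam * sqrt (\<Sum>n. (cmod (c n))\<^sup>2))"
    proof (intro ennreal_leI mult_left_mono real_sqrt_le_mono suminf_le le c)
      show "summable (\<lambda>n. (cmod (c n * complex_of_real (rad k) ^ n))\<^sup>2)"
      proof (rule summable_comparison_test'[OF c, of 0])
        show "norm ((cmod (c n * complex_of_real (rad k) ^ n))\<^sup>2) \<le> (cmod (c n))\<^sup>2" for n
          using le[of n] by simp
      qed
    qed (use lam in auto)
    finally show ?thesis .
  qed
  have Vinc: "incseq V"
  proof (rule incseq_SucI, rule subsetI)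
    fix k t assume "t \<in> V k"
    then obtain r where t: "t \<in> {0..2*pi}" and r: "0 \<le> r" "r < 1"
      "lam < cmod (f (complex_of_real (rad k) * (complex_of_real r * cis t)))"
      by (auto simp: V_def)
    have pos: "0 < rad (Suc k)" by (rule rad)
    have "r * rad k \<le> r * rad (Suc k)"
      using r rad(3)[of k] by (intro mult_left_mono)
    also have "\<dots> < rad (Suc k)"
      using r pos by simp
    finally have "r * rad k / rad (Suc k) < 1"
      using pos by simp
    moreover have "0 \<le> r * rad k / rad (Suc k)"
      using r rad(1)[of k] pos by simp
    moreover have "complex_of_real (rad (Suc k)) * (complex_of_real (r * rad k / rad (Suc k)) * cis t) =
        complex_of_real (rad k) * (complex_of_real r * cis t)"
      using pos by (simp add: field_simps)
    ultimately show "t \<in> V (Suc k)"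
      unfolding V_def mem_Collect_eq using t r(3)
      by (intro conjI exI[of _ "r * rad k / rad (Suc k)"]) simp_all
  qed
  have U: "U = (\<Union>k. V k)"
  proof (intro equalityI subsetI)
    fix t assume "t \<in> U"
    then obtain r where t: "t \<in> {0..2*pi}" and r: "0 \<le> r" "r < 1" "lam < cmod (f (complex_of_real r * cis t))"
      by (auto simp: U_def)
    obtain k where k: "r < rad k"
      using eventually_happens'[OF sequentially_bot order_tendstoD(1)[OF rad_LIMSEQ r(2)]] by blast
    have pos: "0 < rad k" by (rule rad)
    have "complex_of_real (rad k) * (complex_of_real (r / rad k) * cis t) = complex_of_real r * cis t"
      using pos by simp
    moreover have "0 \<le> r / rad k" "r / rad k < 1"
      using r(1) k pos by auto
    ultimately have "t \<in> V k"
      unfolding V_def mem_Collect_eq using t r(3)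
      by (intro conjI exI[of _ "r / rad k"]) simp_all
    then show "t \<in> (\<Union>k. V k)" by blast
  next
    fix t assume "t \<in> (\<Union>k. V k)"
    then obtain k r where t: "t \<in> {0..2*pi}" and r: "0 \<le> r" "r < 1"
      "lam < cmod (f (complex_of_real (rad k * r) * cis t))"
      by (auto simp: V_def mult.assoc)
    have "rad k * r \<le> 1 * r"
      using r rad(2)[of k] by (intro mult_right_mono) auto
    then have "rad k * r < 1" "0 \<le> rad k * r"
      using r rad(1)[of k] by auto
    then show "t \<in> U"
      unfolding U_def mem_Collect_eq using t r(3) by (intro conjI exI[of _ "rad k * r"])
  qed
  show "U \<in> sets lborel"
    unfolding U using Vm by blast
  have "(SUP k. emeasure lborel (V k)) = emeasure lborel U"
    unfolding U by (rule SUP_emeasure_incseq) (use Vm Vinc in auto)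
  moreover have "(SUP k. emeasure lborel (V k)) \<le> ennreal (20 * pi / lam * sqrt (\<Sum>n. (cmod (c n))\<^sup>2))"
    by (rule SUP_least) (rule Vb)
  ultimately show "emeasure lborel U \<le> ennreal (20 * pi / lam * sqrt (\<Sum>n. (cmod (c n))\<^sup>2))"
    by simp
qed

text \<open>Tails carry leading zeros and no shifted index, because they serve as the coefficients
  of a function minus its Taylor polynomial.\<close>

lemma suminf_tail_tendsto:
  fixes a :: "nat \<Rightarrow> real"
  assumes "summable a"
  shows "(\<lambda>N. \<Sum>n. if n < N then 0 else a n) \<longlonglongrightarrow> 0"
    and "summable (\<lambda>n. if n < N then 0 else a n)"
    and "(\<Sum>n. if n < N then 0 else a n) = suminf a - (\<Sum>n<N. a n)"
proof -
  have s: "(\<lambda>n. if n < N then 0 else a n) sums (suminf a - (\<Sum>n<N. a n))" for N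
  proof -
    have "(\<lambda>n. if n < N then a n else 0) sums (\<Sum>n<N. a n)"
      using sums_If_finite[of "\<lambda>n. n < N" a] by (simp add: lessThan_def)
    from sums_diff[OF summable_sums[OF assms] this] show ?thesis
      by (rule sums_cong[THEN iffD1, rotated]) auto
  qed
  then show "summable (\<lambda>n. if n < N then 0 else a n)"
    and e: "(\<Sum>n. if n < N then 0 else a n) = suminf a - (\<Sum>n<N. a n)" for N
    by (auto simp: sums_iff)
  have "(\<lambda>N. suminf a - (\<Sum>n<N. a n)) \<longlonglongrightarrow> suminf a - suminf a"
    by (intro tendsto_intros summable_LIMSEQ assms)
  then show "(\<lambda>N. \<Sum>n. if n < N then 0 else a n) \<longlonglongrightarrow> 0"
    by (simp add: e)
qed

text \<open>\<open>f\<close> is a polynomial, continuous up to the circle, plus a tail. By the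
  maximal estimate the tail exceeds \<open>e j\<close> somewhere on the ray only for a set of angles
  whose measure tends to 0 with \<open>N\<close>. So for almost every angle each \<open>j\<close>
  has an \<open>N\<close> with a uniformly small tail, and the ray satisfies the Cauchy
  criterion.\<close>

theorem H2_has_bv:
  assumes "f \<in> H2"
  shows "AE t in circ. has_bv f t"
proof -
  define a where "a = tc f"
  have hol: "f holomorphic_on ball 0 1" and a2: "summable (\<lambda>n. (cmod (a n))\<^sup>2)"
    using assms by (auto simp: H2_iff a_def)
  define c where "c N n = (if n < N then 0 else a n)" for N n
  define p where "p N z = (\<Sum>n<N. a n * z ^ n)" for N z
  define v where "v N z = f z - p N z" for N z
  have v: "(\<lambda>n. c N n * z ^ n) sums v N z" if "cmod z < 1" for N z
  proof -
    have "(\<lambda>n. if n < N then a n * z ^ n else 0) sums (\<Sum>n<N. a n * z ^ n)"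
      using sums_If_finite[of "\<lambda>n. n < N" "\<lambda>n. a n * z ^ n"] by (simp add: lessThan_def)
    from sums_diff[OF tc_sums[OF hol that] this] show ?thesis
      unfolding v_def p_def by (rule sums_cong[THEN iffD1, rotated]) (auto simp: c_def a_def)
  qed
  have c2: "(\<lambda>n. (cmod (c N n))\<^sup>2) = (\<lambda>n. if n < N then 0 else (cmod (a n))\<^sup>2)" for N
    by (auto simp: c_def)
  have cs: "summable (\<lambda>n. (cmod (c N n))\<^sup>2)" for N
    unfolding c2 by (rule suminf_tail_tendsto(2)[OF a2])
  define e where "e j = 1 / (real j + 1)" for j :: nat
  have e: "0 < e j" for j by (simp add: e_def)
  define U where "U j N = {t\<in>{0..2*pi}. \<exists>r. 0 \<le> r \<and> r < 1 \<and> e j < cmod (v N (complex_of_real r * cis t))}" for j N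
  have Um: "U j N \<in> sets lborel" for j N
    unfolding U_def by (rule radial_maximal_H2(1)[OF cs e v])
  have null: "(\<Inter>N. U j N) \<in> null_sets lborel" for j
  proof (rule null_setsI)
    show "(\<Inter>N. U j N) \<in> sets lborel"
      using Um by blast
    have "emeasure lborel (\<Inter>N. U j N) \<le> ennreal (20 * pi / e j * sqrt (\<Sum>n. (cmod (c N n))\<^sup>2))" for N
    proof -
      have "emeasure lborel (\<Inter>N. U j N) \<le> emeasure lborel (U j N)"
        by (intro emeasure_mono Um) auto
      also have "\<dots> \<le> ennreal (20 * pi / e j * sqrt (\<Sum>n. (cmod (c N n))\<^sup>2))"
        unfolding U_def by (rule radial_maximal_H2(2)[OF cs e v])
      finally show ?thesis .
    qed
    moreover have "(\<lambda>N. ennreal (20 * pi / e j * sqrt (\<Sum>n. (cmod (c N n))\<^sup>2))) \<longlonglongrightarrow> ennreal (20 * pi / e j * sqrt 0)"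
      unfolding c2 by (intro tendsto_ennrealI tendsto_intros suminf_tail_tendsto(1)[OF a2])
    ultimately have "emeasure lborel (\<Inter>N. U j N) \<le> ennreal (20 * pi / e j * sqrt 0)"
      by (intro LIMSEQ_le_const[of _ _ "emeasure lborel (\<Inter>N. U j N)"]) auto
    then show "emeasure lborel (\<Inter>N. U j N) = 0"
      by simp
  qed
  have "AE t in lborel. \<forall>j. t \<notin> (\<Inter>N. U j N)"
    unfolding AE_all_countable by (intro allI AE_not_in null)
  then show ?thesis
    unfolding AE_circ_iff
  proof eventually_elim
    case (elim t)
    show ?case
    proof
      assume t: "t \<in> {0..2*pi}"
      have "\<exists>l. ((\<lambda>r. f (complex_of_real r * cis t)) \<longlongrightarrow> l) (at_left 1)"
      proof (rule Cauchy_at_left_1)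
        fix d :: real assume "0 < d"
        \<comment> \<open>Budget for the distance \<open>d\<close>: two tail values of at most d/3
          each and two polynomial differences below d/6 each.\<close>
        then have "0 < d / 3"
          by simp
        then obtain j where j: "e j < d / 3"
          unfolding e_def by (metis reals_Archimedean inverse_eq_divide of_nat_Suc add.commute)
        obtain N where "t \<notin> U j N"
          using elim by blast
        then have vb: "cmod (v N (complex_of_real r * cis t)) \<le> e j" if "0 \<le> r" "r < 1" for r
          using t that unfolding U_def mem_Collect_eq by (meson not_less)
        have "((\<lambda>r. p N (complex_of_real r * cis t)) \<longlongrightarrow> p N (complex_of_real 1 * cis t)) (at_left 1)"
          unfolding p_def by (intro tendsto_intros)
        then have "eventually (\<lambda>r. dist (p N (complex_of_real r * cis t)) (p N (complex_of_real 1 * cis t)) < d / 6) (at_left 1)"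
          by (rule tendstoD) (use \<open>0 < d\<close> in auto)
        then obtain b where b: "b < 1" "\<And>r. b < r \<Longrightarrow> r < 1 \<Longrightarrow>
            dist (p N (complex_of_real r * cis t)) (p N (complex_of_real 1 * cis t)) < d / 6"
          unfolding eventually_at_left_field by blast
        \<comment> \<open>The tail bound holds for nonnegative radii, hence the maximum of
          \<open>b\<close> with 0.\<close>
        show "\<exists>b<1. \<forall>r s. b < r \<longrightarrow> r < 1 \<longrightarrow> b < s \<longrightarrow> s < 1 \<longrightarrow>
          dist (f (complex_of_real r * cis t)) (f (complex_of_real s * cis t)) \<le> d"
        proof (intro exI[of _ "max b 0"] conjI allI impI)
          fix r s :: real assume rs: "max b 0 < r" "r < 1" "max b 0 < s" "s < 1"
          let ?r = "complex_of_real r * cis t" and ?s = "complex_of_real s * cis t" and ?o = "complex_of_real 1 * cis t"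
          have "f ?r - f ?s = (v N ?r - v N ?s) + (p N ?r - p N ?s)"
            by (simp add: v_def)
          then have "cmod (f ?r - f ?s) \<le> cmod (v N ?r) + cmod (v N ?s) + cmod (p N ?r - p N ?s)"
            using norm_triangle_ineq[of "v N ?r - v N ?s" "p N ?r - p N ?s"] norm_triangle_ineq4[of "v N ?r" "v N ?s"]
            by simp
          moreover have "cmod (p N ?r - p N ?s) \<le> cmod (p N ?r - p N ?o) + cmod (p N ?s - p N ?o)"
            using dist_triangle2[of "p N ?r" "p N ?s" "p N ?o"] by (simp add: dist_norm)
          moreover have "cmod (p N ?r - p N ?o) < d / 6" "cmod (p N ?s - p N ?o) < d / 6"
            using b(2)[of r] b(2)[of s] rs by (auto simp: dist_norm)
          moreover have "cmod (v N ?r) \<le> e j" "cmod (v N ?s) \<le> e j"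
            using vb rs by auto
          ultimately show "dist (f ?r) (f ?s) \<le> d"
            using j unfolding dist_norm by linarith
        qed (use b in auto)
      qed
      then show "has_bv f t"
        by (simp add: has_bv_iff)
    qed
  qed
qed

section \<open>Boundary functions, Parseval's identity and the Szego projection\<close>

lemma H2_bv_measurable: "f \<in> H2 \<Longrightarrow> bv f \<in> borel_measurable circ"
  by (intro borel_imp_circ bv_measurable holomorphic_on_imp_continuous_on) (simp add: H2_def)

text \<open>Fatou's lemma is applied to the dilate by \<open>rad k\<close> minus the Taylor
  polynomial. Its coefficients are a_n (r^n - 1) below \<open>N\<close> and a_n r^n from
  \<open>N\<close> on; as \<open>r\<close> tends to 1 the first group vanishes, and only the tail
  remains in the bound.\<close>

lemma H2_bv_approx:
  assumes f: "f \<in> H2"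
  shows "sq_int circ (bv f)"
    and "(LINT t|circ. (cmod (bv f t - trigp (tc f) N t))\<^sup>2) \<le> 2 * pi * (\<Sum>n. if n < N then 0 else (cmod (tc f n))\<^sup>2)"
proof -
  define a where "a = tc f"
  have hol: "f holomorphic_on ball 0 1" and a2: "summable (\<lambda>n. (cmod (a n))\<^sup>2)"
    using f by (auto simp: H2_iff a_def)
  have ser: "(\<lambda>n. a n * z ^ n) sums f z" if "cmod z < 1" for z
    unfolding a_def by (rule tc_sums[OF hol that])
  define u where "u k t = f (complex_of_real (rad k) * cis t) - trigp a N t" for k t
  define J where "J k = (\<Sum>n<N. (cmod (a n))\<^sup>2 * (1 - rad k ^ n)\<^sup>2) + (\<Sum>n. if n < N then 0 else (cmod (a n))\<^sup>2)" for k
  define c where "c k n = (if n < N then a n * complex_of_real (rad k) ^ n - a n else a n * complex_of_real (rad k) ^ n)" for k n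
  have fin: "(\<lambda>n. if n < N then g n else 0) sums (\<Sum>n<N. g n)" for g :: "nat \<Rightarrow> 'a::real_normed_vector"
    using sums_If_finite[of "\<lambda>n. n < N" g] by (simp add: lessThan_def)
  have cs: "summable (\<lambda>n. cmod (c k n))" for k
  proof -
    have "summable (\<lambda>n. cmod (a n * complex_of_real (rad k) ^ n))"
      by (rule abs_summable_inside) (use ser rad[of k] in \<open>auto simp: sums_iff less_imp_le\<close>)
    moreover have "summable (\<lambda>n. if n < N then cmod (a n) else 0)"
      by (rule sums_summable[OF fin])
    ultimately have "summable (\<lambda>n. cmod (a n * complex_of_real (rad k) ^ n) + (if n < N then cmod (a n) else 0))"
      by (rule summable_add)
    then show ?thesis
      by (rule summable_comparison_test'[where N = 0]) (auto simp: c_def norm_triangle_ineq4)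
  qed
  have us: "(\<lambda>n. c k n * cis t ^ n) sums u k t" for k t
  proof -
    have "(\<lambda>n. a n * (complex_of_real (rad k) * cis t) ^ n) sums f (complex_of_real (rad k) * cis t)"
      by (rule ser) (use rad[of k] in \<open>simp add: norm_mult\<close>)
    from sums_diff[OF this fin[of "\<lambda>n. a n * cis t ^ n"]] show ?thesis
      unfolding u_def trigp_def
      by (rule sums_cong[THEN iffD1, rotated]) (auto simp: c_def power_mult_distrib algebra_simps)
  qed
  note U = abs_series_fc[OF cs us]
  have uJ: "(LINT t|circ. (cmod (u k t))\<^sup>2) \<le> 2 * pi * J k" for k
  proof -
    have "(LINT t|circ. (cmod (u k t))\<^sup>2) / (2 * pi) \<le> J k"
    proof (rule sums_le[OF _ U(3)])
      show "(\<lambda>n. (if n < N then (cmod (a n))\<^sup>2 * (1 - rad k ^ n)\<^sup>2 else 0) + (if n < N then 0 else (cmod (a n))\<^sup>2)) sums J k"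
        unfolding J_def by (intro sums_add fin summable_sums suminf_tail_tendsto(2)[OF a2])
      fix n
      have "cmod (a n * complex_of_real (rad k) ^ n - a n) = cmod (a n) * \<bar>1 - rad k ^ n\<bar>"
      proof -
        have "a n * complex_of_real (rad k) ^ n - a n = a n * complex_of_real (- (1 - rad k ^ n))"
          by (simp add: algebra_simps)
        then show ?thesis
          by (simp only: norm_mult norm_of_real abs_minus_cancel)
      qed
      moreover have "(cmod (a n * complex_of_real (rad k) ^ n))\<^sup>2 \<le> (cmod (a n))\<^sup>2"
        using rad[of k] by (intro power_mono) (auto simp: norm_mult norm_power less_imp_le intro!: mult_left_le power_le_one)
      ultimately show "(cmod (c k n))\<^sup>2 \<le> (if n < N then (cmod (a n))\<^sup>2 * (1 - rad k ^ n)\<^sup>2 else 0) + (if n < N then 0 else (cmod (a n))\<^sup>2)"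
        by (simp add: c_def power_mult_distrib)
    qed
    then show ?thesis
      by (simp add: field_simps)
  qed
  have J: "(\<lambda>k. 2 * pi * J k) \<longlonglongrightarrow> 2 * pi * ((\<Sum>n<N. (cmod (a n))\<^sup>2 * (1 - 1 ^ n)\<^sup>2) + (\<Sum>n. if n < N then 0 else (cmod (a n))\<^sup>2))"
    unfolding J_def by (intro tendsto_intros rad_LIMSEQ)
  have tm: "trigp a N \<in> borel_measurable circ"
    by (rule sq_int_measurable[OF sq_int_trigp])
  have m: "(\<lambda>t. bv f t - trigp a N t) \<in> borel_measurable circ"
    using H2_bv_measurable[OF f] tm by measurable
  have l: "AE t in circ. (\<lambda>k. u k t) \<longlonglongrightarrow> bv f t - trigp a N t"
    using H2_has_bv[OF f]
  proof eventually_elim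
    case (elim t)
    show ?case
      unfolding u_def by (intro tendsto_intros has_bv_rad elim)
  qed
  have *: "sq_int circ (\<lambda>t. bv f t - trigp a N t)"
    "(LINT t|circ. (cmod (bv f t - trigp a N t))\<^sup>2) \<le> 2 * pi * ((\<Sum>n<N. (cmod (a n))\<^sup>2 * (1 - 1 ^ n)\<^sup>2) + (\<Sum>n. if n < N then 0 else (cmod (a n))\<^sup>2))"
    by (rule L2_fatou[OF U(1) m l uJ J])+
  from sq_int_add[OF *(1) sq_int_trigp[of a N]] show "sq_int circ (bv f)"
    by simp
  show "(LINT t|circ. (cmod (bv f t - trigp (tc f) N t))\<^sup>2) \<le> 2 * pi * (\<Sum>n. if n < N then 0 else (cmod (tc f n))\<^sup>2)"
    using *(2) unfolding a_def by simp
qed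

lemma H2_trigp_tendsto:
  assumes f: "f \<in> H2"
  shows "(\<lambda>N. LINT t|circ. (cmod (bv f t - trigp (tc f) N t))\<^sup>2) \<longlonglongrightarrow> 0"
proof (rule tendsto_sandwich[of "\<lambda>_. 0" _ _ "\<lambda>N. 2 * pi * (\<Sum>n. if n < N then 0 else (cmod (tc f n))\<^sup>2)"])
  have "summable (\<lambda>n. (cmod (tc f n))\<^sup>2)"
    using f by (simp add: H2_iff)
  from tendsto_mult[OF tendsto_const suminf_tail_tendsto(1)[OF this], of "2 * pi"]
  show "(\<lambda>N. 2 * pi * (\<Sum>n. if n < N then 0 else (cmod (tc f n))\<^sup>2)) \<longlonglongrightarrow> 0"
    by simp
qed (use H2_bv_approx(2)[OF f] in auto)

lemma fc_norm_le:
  assumes "sq_int circ u"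
  shows "2 * pi * (cmod (fc u n))\<^sup>2 \<le> (LINT t|circ. (cmod (u t))\<^sup>2)"
proof -
  have "(cmod (fc u n))\<^sup>2 \<le> (\<Sum>n<Suc n. (cmod (fc u n))\<^sup>2)"
    by (rule member_le_sum) auto
  then have "2 * pi * (cmod (fc u n))\<^sup>2 \<le> 2 * pi * (\<Sum>n<Suc n. (cmod (fc u n))\<^sup>2)"
    by (intro mult_left_mono) auto
  also have "\<dots> \<le> (LINT t|circ. (cmod (u t))\<^sup>2)"
    by (rule Bessel[OF assms])
  finally show ?thesis .
qed

lemma fc_diff:
  assumes "sq_int circ u" "sq_int circ v"
  shows "fc (\<lambda>t. u t - v t) n = fc u n - fc v n"
  using sq_int_cnj_mult_integrable[OF assms(1) sq_int_cis_power] sq_int_cnj_mult_integrable[OF assms(2) sq_int_cis_power]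
  by (simp add: fc_def left_diff_distrib diff_divide_distrib)

text \<open>A Fourier coefficient is continuous in L^2, and for the approximating partial sums it
  equals \<open>tc f n\<close> as soon as \<open>N > n\<close>.\<close>

lemma fc_bv:
  assumes f: "f \<in> H2"
  shows "fc (bv f) n = tc f n"
proof -
  note b = H2_bv_approx(1)[OF f]
  have "(\<lambda>N. (cmod (fc (bv f) n - fc (trigp (tc f) N) n))\<^sup>2) \<longlonglongrightarrow> 0"
  proof (rule tendsto_sandwich[of "\<lambda>_. 0" _ _ "\<lambda>N. (LINT t|circ. (cmod (bv f t - trigp (tc f) N t))\<^sup>2) / (2 * pi)"])
    show "(\<lambda>N. (LINT t|circ. (cmod (bv f t - trigp (tc f) N t))\<^sup>2) / (2 * pi)) \<longlonglongrightarrow> 0"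
      using tendsto_divide[OF H2_trigp_tendsto[OF f] tendsto_const[of "2 * pi"]] by simp
    show "\<forall>\<^sub>F N in sequentially. (cmod (fc (bv f) n - fc (trigp (tc f) N) n))\<^sup>2 \<le>
        (LINT t|circ. (cmod (bv f t - trigp (tc f) N t))\<^sup>2) / (2 * pi)"
      using fc_norm_le[OF sq_int_diff[OF b sq_int_trigp]]
      by (intro always_eventually allI) (simp add: fc_diff[OF b sq_int_trigp] field_simps)
  qed auto
  moreover have "\<forall>\<^sub>F N in sequentially. (cmod (fc (bv f) n - fc (trigp (tc f) N) n))\<^sup>2 = (cmod (fc (bv f) n - tc f n))\<^sup>2"
    using eventually_gt_at_top[of n] by eventually_elim (simp add: fc_trigp)
  ultimately have "(\<lambda>N::nat. (cmod (fc (bv f) n - tc f n))\<^sup>2) \<longlonglongrightarrow> 0"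
    by (rule Lim_transform_eventually)
  then show ?thesis
    by (simp add: LIMSEQ_const_iff)
qed

lemma H2_parseval:
  assumes f: "f \<in> H2"
  shows "(\<lambda>n. (cmod (tc f n))\<^sup>2) sums ((LINT t|circ. (cmod (bv f t))\<^sup>2) / (2 * pi))"
proof -
  note b = H2_bv_approx(1)[OF f]
  have fe: "fc (bv f) = tc f"
    by (rule ext) (rule fc_bv[OF f])
  have "(LINT t|circ. (cmod (bv f t - trigp (tc f) N t))\<^sup>2) =
    (LINT t|circ. (cmod (bv f t))\<^sup>2) - 2 * pi * (\<Sum>n<N. (cmod (tc f n))\<^sup>2)" for N
    using L2_diff_trigp[OF b, of N] by (simp add: fe)
  then have "(\<Sum>n<N. (cmod (tc f n))\<^sup>2) = ((LINT t|circ. (cmod (bv f t))\<^sup>2) -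
      (LINT t|circ. (cmod (bv f t - trigp (tc f) N t))\<^sup>2)) / (2 * pi)" for N
    by simp
  moreover have "(\<lambda>N. ((LINT t|circ. (cmod (bv f t))\<^sup>2) -
      (LINT t|circ. (cmod (bv f t - trigp (tc f) N t))\<^sup>2)) / (2 * pi)) \<longlonglongrightarrow> ((LINT t|circ. (cmod (bv f t))\<^sup>2) - 0) / (2 * pi)"
    by (intro tendsto_intros H2_trigp_tendsto[OF f]) auto
  ultimately show ?thesis
    by (simp add: sums_def)
qed

lemma szego_bv:
  assumes f: "f \<in> H2" and z: "cmod z < 1"
  shows "szego (bv f) z = f z"
proof -
  have "(\<lambda>n. tc f n * z ^ n) sums szego (bv f) z"
    using szego_sums[OF sq_int_circ_integrable[OF H2_bv_approx(1)[OF f]] z] by (simp add: fc_bv[OF f])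
  moreover have "(\<lambda>n. tc f n * z ^ n) sums f z"
    using f z by (intro tc_sums) (auto simp: H2_iff)
  ultimately show ?thesis
    by (rule sums_unique2)
qed

text \<open>Bessel's inequality makes the coefficients kept by the Cauchy integral square
  summable.\<close>

lemma szego_H2:
  assumes u: "sq_int circ u"
  shows "szego u \<in> H2" "tc (szego u) = fc u"
proof -
  have "(\<lambda>n. fc u n * z ^ n) sums szego u z" if "cmod z < 1" for z
    by (rule szego_sums[OF sq_int_circ_integrable[OF u] that])
  note tc = tc_eqI[OF this]
  then show "tc (szego u) = fc u" by blast
  then show "szego u \<in> H2"
    unfolding H2_iff using tc(1) summable_fc[OF u] by simp
qed

text \<open>\<open>v\<close> is an arbitrary L^2 function: tested against a boundary function of
  H^2, only its coefficients of nonnegative index count. Through \<open>H2_inner_szego\<close> this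
  makes \<open>szego\<close> the orthogonal projection.\<close>

lemma inner_bv_sums:
  assumes v: "sq_int circ v" and g: "g \<in> H2"
  shows "(\<lambda>n. fc v n * cnj (tc g n)) sums ((LINT t|circ. v t * cnj (bv g t)) / (2 * pi))"
proof -
  note b = H2_bv_approx(1)[OF g]
  have "(\<lambda>N. LINT t|circ. v t * cnj (trigp (tc g) N t)) \<longlonglongrightarrow> (LINT t|circ. v t * cnj (bv g t))"
  proof (rule L2_tendsto_inner[OF v sq_int_cnj[OF sq_int_trigp] sq_int_cnj[OF b]])
    have "cmod (cnj (trigp (tc g) N t) - cnj (bv g t)) = cmod (bv g t - trigp (tc g) N t)" for N t
      by (metis complex_cnj_diff complex_mod_cnj norm_minus_commute)
    then show "(\<lambda>N. LINT t|circ. (cmod (cnj (trigp (tc g) N t) - cnj (bv g t)))\<^sup>2) \<longlonglongrightarrow> 0"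
      using H2_trigp_tendsto[OF g] by simp
  qed
  from tendsto_divide[OF this tendsto_const[of "complex_of_real (2 * pi)"]] show ?thesis
    by (simp add: integral_mult_cnj_trigp[OF v] sums_def mult.commute)
qed

lemma H2_inner_circ: "H2_inner f g = (LINT t|circ. bv f t * cnj (bv g t)) / (2 * pi)"
  by (simp add: H2_inner_def set_LINT_circ)

lemma H2_inner_sums:
  assumes "f \<in> H2" "g \<in> H2"
  shows "(\<lambda>n. tc f n * cnj (tc g n)) sums H2_inner f g"
  using inner_bv_sums[OF H2_bv_approx(1)[OF assms(1)] assms(2)]
  by (simp add: H2_inner_circ fc_bv[OF assms(1)])

lemma H2_inner_szego:
  assumes "sq_int circ u" "g \<in> H2"
  shows "H2_inner (szego u) g = (LINT t|circ. u t * cnj (bv g t)) / (2 * pi)"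
  using H2_inner_sums[OF szego_H2(1)[OF assms(1)] assms(2)] inner_bv_sums[OF assms]
  by (simp add: szego_H2(2)[OF assms(1)] sums_unique2)

lemma H2_norm_sums:
  assumes "f \<in> H2"
  shows "(\<lambda>n. (cmod (tc f n))\<^sup>2) sums (H2_norm f)\<^sup>2"
  using H2_parseval[OF assms] by (simp add: H2_norm_def set_LINT_circ)

section \<open>Hardy spaces as Hilbert spaces\<close>

lemma H2_holomorphic: "f \<in> H2 \<Longrightarrow> f holomorphic_on ball 0 1"
  by (simp add: H2_def)

lemma H2_tc_sums: "f \<in> H2 \<Longrightarrow> cmod z < 1 \<Longrightarrow> (\<lambda>n. tc f n * z ^ n) sums f z"
  by (rule tc_sums[OF H2_holomorphic])

text \<open>Square summable coefficients give convergence in the disc because |c z^n| <= |c|^2 +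
  |z|^(2n).\<close>

lemma H2_from_coeffs:
  assumes "summable (\<lambda>n. (cmod (c n))\<^sup>2)"
  shows "\<exists>f\<in>H2. tc f = c"
proof -
  define f where "f z = (\<Sum>n. c n * z ^ n)" for z
  have "(\<lambda>n. c n * z ^ n) sums f z" if z: "cmod z < 1" for z
    unfolding f_def
  proof (rule summable_sums, rule summable_norm_cancel, rule summable_comparison_test'[where N = 0])
    have "summable (\<lambda>n. (cmod z ^ 2) ^ n)"
      using z by (intro summable_geometric) (simp add: power_less_one_iff)
    from summable_add[OF assms this] show "summable (\<lambda>n. (cmod (c n))\<^sup>2 + (cmod z ^ 2) ^ n)" .
    fix n :: nat
    have "cmod (c n * z ^ n) \<le> (cmod (c n))\<^sup>2 + (cmod (z ^ n))\<^sup>2"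
      by (rule cmod_mult_le_squares)
    also have "(cmod (z ^ n))\<^sup>2 = (cmod z ^ 2) ^ n"
      by (simp add: norm_power power_mult [symmetric] mult.commute)
    finally show "norm (norm (c n * z ^ n)) \<le> (cmod (c n))\<^sup>2 + (cmod z ^ 2) ^ n"
      by simp
  qed
  note tc = tc_eqI[OF this]
  have "f \<in> H2"
    unfolding H2_iff using tc(1) assms by (simp add: tc(2))
  with tc(2) show ?thesis
    by blast
qed

lemma H2_cong:
  assumes "f \<in> H2" "\<And>z. cmod z < 1 \<Longrightarrow> f z = g z"
  shows "g \<in> H2" "tc g = tc f"
proof -
  have s: "(\<lambda>n. tc f n * z ^ n) sums g z" if "cmod z < 1" for z
    using H2_tc_sums[OF assms(1) that] assms(2)[OF that] by simp
  note tc = tc_eqI[OF s]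
  then show "tc g = tc f" by blast
  then show "g \<in> H2"
    using tc(1) assms(1) by (simp add: H2_iff)
qed

lemma H2_add:
  assumes "f \<in> H2" "g \<in> H2"
  shows "(\<lambda>z. f z + g z) \<in> H2" "tc (\<lambda>z. f z + g z) = (\<lambda>n. tc f n + tc g n)"
proof -
  have "(\<lambda>n. (tc f n + tc g n) * z ^ n) sums (f z + g z)" if "cmod z < 1" for z
    using sums_add[OF H2_tc_sums[OF assms(1) that] H2_tc_sums[OF assms(2) that]] by (simp add: distrib_right)
  note tc = tc_eqI[OF this]
  then show t: "tc (\<lambda>z. f z + g z) = (\<lambda>n. tc f n + tc g n)" by blast
  have "summable (\<lambda>n. (cmod (tc f n + tc g n))\<^sup>2)"
  proof (rule summable_comparison_test'[where N = 0])
    show "summable (\<lambda>n. 2 * (cmod (tc f n))\<^sup>2 + 2 * (cmod (tc g n))\<^sup>2)"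
      using assms by (intro summable_add summable_mult) (simp_all add: H2_iff)
    fix n :: nat
    have "(cmod (tc f n + tc g n))\<^sup>2 \<le> (cmod (tc f n) + cmod (tc g n))\<^sup>2"
      by (intro power_mono norm_triangle_ineq) auto
    also have "\<dots> \<le> 2 * (cmod (tc f n))\<^sup>2 + 2 * (cmod (tc g n))\<^sup>2"
      using sum_squares_bound[of "cmod (tc f n)" "cmod (tc g n)"] by (simp add: power2_sum)
    finally show "norm ((cmod (tc f n + tc g n))\<^sup>2) \<le> 2 * (cmod (tc f n))\<^sup>2 + 2 * (cmod (tc g n))\<^sup>2"
      by (simp only: real_norm_def abs_of_nonneg zero_le_power2)
  qed
  then show "(\<lambda>z. f z + g z) \<in> H2"
    unfolding H2_iff t using tc(1) by blast
qed

lemma H2_scale: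
  assumes "f \<in> H2"
  shows "(\<lambda>z. c * f z) \<in> H2" "tc (\<lambda>z. c * f z) = (\<lambda>n. c * tc f n)"
proof -
  have "(\<lambda>n. (c * tc f n) * z ^ n) sums (c * f z)" if "cmod z < 1" for z
    using sums_mult[OF H2_tc_sums[OF assms that], of c] by (simp add: mult.assoc)
  note tc = tc_eqI[OF this]
  then show t: "tc (\<lambda>z. c * f z) = (\<lambda>n. c * tc f n)" by blast
  have "summable (\<lambda>n. (cmod c)\<^sup>2 * (cmod (tc f n))\<^sup>2)"
    using assms by (intro summable_mult) (simp add: H2_iff)
  then show "(\<lambda>z. c * f z) \<in> H2"
    unfolding H2_iff t using tc(1) by (simp add: norm_mult power_mult_distrib)
qed

lemma H2_zero: "(\<lambda>z. 0) \<in> H2"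
  by (auto simp: H2_def)

lemma H2_sum: "(\<And>i. i \<in> I \<Longrightarrow> f i \<in> H2) \<Longrightarrow> (\<lambda>z. \<Sum>i\<in>I. f i z) \<in> H2"
  by (induction I rule: infinite_finite_induct) (auto simp: H2_zero intro: H2_add)

lemma H2_uminus: "f \<in> H2 \<Longrightarrow> (\<lambda>z. - f z) \<in> H2"
  using H2_scale(1)[of f "-1"] by simp

lemma H2_diff: "f \<in> H2 \<Longrightarrow> g \<in> H2 \<Longrightarrow> (\<lambda>z. f z - g z) \<in> H2"
  using H2_add(1)[of f "\<lambda>z. - g z"] H2_uminus[of g] by simp

lemma tc_diff: "f \<in> H2 \<Longrightarrow> g \<in> H2 \<Longrightarrow> tc (\<lambda>z. f z - g z) = (\<lambda>n. tc f n - tc g n)"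
  using H2_add(2)[of f "\<lambda>z. (-1) * g z"] H2_scale[of g "-1"] by simp

lemma H2_inner_add_left:
  assumes "f \<in> H2" "g \<in> H2" "h \<in> H2"
  shows "H2_inner (\<lambda>z. f z + g z) h = H2_inner f h + H2_inner g h"
  using sums_add[OF H2_inner_sums[OF assms(1,3)] H2_inner_sums[OF assms(2,3)]]
    H2_inner_sums[OF H2_add(1)[OF assms(1,2)] assms(3)]
  by (simp add: H2_add(2)[OF assms(1,2)] distrib_right sums_unique2)

lemma H2_inner_scale_left:
  assumes "f \<in> H2" "h \<in> H2"
  shows "H2_inner (\<lambda>z. c * f z) h = c * H2_inner f h"
  using sums_mult[OF H2_inner_sums[OF assms], of c] H2_inner_sums[OF H2_scale(1)[OF assms(1)] assms(2), of c]
  by (simp add: H2_scale(2)[OF assms(1)] mult.assoc sums_unique2)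

lemma H2_inner_commute:
  assumes "f \<in> H2" "h \<in> H2"
  shows "H2_inner h f = cnj (H2_inner f h)"
proof (rule sums_unique2[OF H2_inner_sums[OF assms(2,1)]])
  show "(\<lambda>n. tc h n * cnj (tc f n)) sums cnj (H2_inner f h)"
    using sums_cnj[THEN iffD2, OF H2_inner_sums[OF assms]] by (simp add: mult.commute)
qed

lemma H2_inner_self:
  assumes "f \<in> H2"
  shows "H2_inner f f = complex_of_real ((H2_norm f)\<^sup>2)"
proof (rule sums_unique2[OF H2_inner_sums[OF assms assms]])
  have "(\<lambda>n. complex_of_real ((cmod (tc f n))\<^sup>2)) sums complex_of_real ((H2_norm f)\<^sup>2)"
    by (rule sums_of_real[OF H2_norm_sums[OF assms]])
  then show "(\<lambda>n. tc f n * cnj (tc f n)) sums complex_of_real ((H2_norm f)\<^sup>2)"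
    by (simp only: complex_norm_square)
qed

lemma H2_inner_cong:
  assumes "\<And>z. cmod z < 1 \<Longrightarrow> f z = f' z" "\<And>z. cmod z < 1 \<Longrightarrow> g z = g' z"
  shows "H2_inner f g = H2_inner f' g'"
proof -
  have "bv f = bv f'" "bv g = bv g'"
    using has_bv_cong(2)[of f f'] has_bv_cong(2)[of g g'] assms by (auto simp: fun_eq_iff)
  then show ?thesis
    by (simp add: H2_inner_def)
qed

lemma H2_norm_cong:
  assumes "\<And>z. cmod z < 1 \<Longrightarrow> f z = f' z"
  shows "H2_norm f = H2_norm f'"
proof -
  have "bv f = bv f'"
    using has_bv_cong(2)[of f f'] assms by (auto simp: fun_eq_iff)
  then show ?thesis
    by (simp add: H2_norm_def)
qed

lemma H2_norm_nonneg: "0 \<le> H2_norm f"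
  by (simp add: H2_norm_def set_LINT_circ)

text \<open>Completeness of l^2: coefficients converge one by one, and bounds on finite partial sums
  pass to the limit before the number of terms is let go to infinity.\<close>

lemma H2_complete:
  assumes x: "\<And>k. x k \<in> H2"
    and C: "\<And>e. 0 < e \<Longrightarrow> \<exists>N. \<forall>m\<ge>N. \<forall>n\<ge>N. H2_norm (\<lambda>z. x m z - x n z) < e"
  shows "\<exists>y\<in>H2. (\<lambda>k. H2_norm (\<lambda>z. x k z - y z)) \<longlonglongrightarrow> 0"
proof -
  have xd: "(\<lambda>n. (cmod (tc (x k) n - tc (x l) n))\<^sup>2) sums (H2_norm (\<lambda>z. x k z - x l z))\<^sup>2" for k l
    using H2_norm_sums[OF H2_diff[OF x x]] by (simp add: tc_diff[OF x x])
  have part: "(\<Sum>n<K. (cmod (tc (x k) n - tc (x l) n))\<^sup>2) \<le> (H2_norm (\<lambda>z. x k z - x l z))\<^sup>2" for k l K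
    using sum_le_suminf[OF sums_summable[OF xd[of k l]], of "{..<K}"] xd[of k l] by (simp add: sums_iff)
  have "Cauchy (\<lambda>k. tc (x k) n)" for n
  proof (rule metric_CauchyI)
    fix e :: real assume "0 < e"
    then obtain N where N: "\<And>m l. m \<ge> N \<Longrightarrow> l \<ge> N \<Longrightarrow> H2_norm (\<lambda>z. x m z - x l z) < e"
      using C by blast
    have "dist (tc (x m) n) (tc (x l) n) < e" if "m \<ge> N" "l \<ge> N" for m l
    proof -
      have "(cmod (tc (x m) n - tc (x l) n))\<^sup>2 \<le> (\<Sum>n<Suc n. (cmod (tc (x m) n - tc (x l) n))\<^sup>2)"
        by (rule member_le_sum) auto
      also have "\<dots> \<le> (H2_norm (\<lambda>z. x m z - x l z))\<^sup>2"
        by (rule part)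
      finally have "cmod (tc (x m) n - tc (x l) n) \<le> H2_norm (\<lambda>z. x m z - x l z)"
        by (rule power2_le_imp_le[OF _ H2_norm_nonneg])
      then show ?thesis
        using N[OF that] by (simp add: dist_norm)
    qed
    then show "\<exists>M. \<forall>m\<ge>M. \<forall>l\<ge>M. dist (tc (x m) n) (tc (x l) n) < e"
      by blast
  qed
  then have "\<exists>a. (\<lambda>k. tc (x k) n) \<longlonglongrightarrow> a" for n
    using Cauchy_convergent_iff convergent_def by blast
  then obtain a where a: "\<And>n. (\<lambda>k. tc (x k) n) \<longlonglongrightarrow> a n"
    by metis
  have lim: "\<exists>N. \<forall>m\<ge>N. \<forall>K. (\<Sum>n<K. (cmod (tc (x m) n - a n))\<^sup>2) \<le> e\<^sup>2" if "0 < e" for e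
  proof -
    obtain N where N: "\<And>m l. m \<ge> N \<Longrightarrow> l \<ge> N \<Longrightarrow> H2_norm (\<lambda>z. x m z - x l z) < e"
      using C[OF \<open>0 < e\<close>] by blast
    have "(\<Sum>n<K. (cmod (tc (x m) n - a n))\<^sup>2) \<le> e\<^sup>2" if "m \<ge> N" for m K
    proof (rule LIMSEQ_le_const2)
      show "(\<lambda>l. \<Sum>n<K. (cmod (tc (x m) n - tc (x l) n))\<^sup>2) \<longlonglongrightarrow> (\<Sum>n<K. (cmod (tc (x m) n - a n))\<^sup>2)"
        by (intro tendsto_intros a)
      have "(\<Sum>n<K. (cmod (tc (x m) n - tc (x l) n))\<^sup>2) \<le> e\<^sup>2" if "l \<ge> N" for l
        using part[of m l K] power_mono[OF less_imp_le[OF N[OF \<open>m \<ge> N\<close> that]] H2_norm_nonneg, of 2] by linarith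
      then show "\<exists>N. \<forall>l\<ge>N. (\<Sum>n<K. (cmod (tc (x m) n - tc (x l) n))\<^sup>2) \<le> e\<^sup>2"
        by blast
    qed
    then show ?thesis by blast
  qed
  obtain M where M: "\<And>K. (\<Sum>n<K. (cmod (tc (x M) n - a n))\<^sup>2) \<le> 1\<^sup>2"
    using lim[of 1] by auto
  have "summable (\<lambda>n. (cmod (tc (x M) n - a n))\<^sup>2)"
    by (rule summableI_nonneg_bounded[OF _ M]) simp
  then obtain d where d: "d \<in> H2" "tc d = (\<lambda>n. tc (x M) n - a n)"
    using H2_from_coeffs by meson
  \<comment> \<open>What is known to be square summable is the difference between the coefficients
    of \<open>x M\<close> and their limits, so the limit function is recovered by
    subtraction.\<close>
  define y where "y z = x M z - d z" for z
  have y: "y \<in> H2" "tc y = a"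
    using H2_diff[OF x d(1)] tc_diff[OF x d(1)] by (simp_all add: y_def [abs_def] d(2))
  have "(\<lambda>k. H2_norm (\<lambda>z. x k z - y z)) \<longlonglongrightarrow> 0"
  proof (rule metric_LIMSEQ_I)
    fix e :: real assume "0 < e"
    then obtain N where N: "\<And>m K. m \<ge> N \<Longrightarrow> (\<Sum>n<K. (cmod (tc (x m) n - a n))\<^sup>2) \<le> (e / 2)\<^sup>2"
      using lim[of "e / 2"] by auto
    have "dist (H2_norm (\<lambda>z. x m z - y z)) 0 < e" if "m \<ge> N" for m
    proof -
      have s: "(\<lambda>n. (cmod (tc (x m) n - a n))\<^sup>2) sums (H2_norm (\<lambda>z. x m z - y z))\<^sup>2"
        using H2_norm_sums[OF H2_diff[OF x y(1)]] by (simp add: tc_diff[OF x y(1)] y(2))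
      have "(H2_norm (\<lambda>z. x m z - y z))\<^sup>2 \<le> (e / 2)\<^sup>2"
        using s N[OF that] unfolding sums_def by (intro LIMSEQ_le_const2) auto
      then have "H2_norm (\<lambda>z. x m z - y z) \<le> e / 2"
        by (rule power2_le_imp_le) (use \<open>0 < e\<close> in simp)
      then show ?thesis
        using \<open>0 < e\<close> H2_norm_nonneg[of "\<lambda>z. x m z - y z"] by simp
    qed
    then show "\<exists>N. \<forall>m\<ge>N. dist (H2_norm (\<lambda>z. x m z - y z)) 0 < e"
      by blast
  qed
  with y(1) show ?thesis by blast
qed

text \<open>The Szego kernel, which reproduces H^2 at the point \<open>w\<close> by
  \<open>H2_inner_szk\<close>.\<close>

definition szk :: "complex \<Rightarrow> complex \<Rightarrow> complex" where
  "szk w z = 1 / (1 - cnj w * z)"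

lemma szk_H2:
  assumes w: "cmod w < 1"
  shows "szk w \<in> H2" "tc (szk w) = (\<lambda>n. cnj w ^ n)"
proof -
  have "(\<lambda>n. cnj w ^ n * z ^ n) sums szk w z" if z: "cmod z < 1" for z
  proof -
    have "cmod w * cmod z \<le> 1 * cmod z"
      using w by (intro mult_right_mono) auto
    then have "cmod (cnj w * z) < 1"
      using z by (simp add: norm_mult)
    from geometric_sums[OF this] show ?thesis
      by (simp add: szk_def power_mult_distrib)
  qed
  note tc = tc_eqI[OF this]
  then show t: "tc (szk w) = (\<lambda>n. cnj w ^ n)" by blast
  have "summable (\<lambda>n. ((cmod w)\<^sup>2) ^ n)"
    using w by (intro summable_geometric) (simp add: power_less_one_iff)
  then show "szk w \<in> H2"
    unfolding H2_iff t using tc(1) by (simp add: norm_power power_mult [symmetric] mult.commute)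
qed

lemma H2_inner_szk:
  assumes "f \<in> H2" "cmod w < 1"
  shows "H2_inner f (szk w) = f w"
  using H2_inner_sums[OF assms(1) szk_H2(1)[OF assms(2)]] H2_tc_sums[OF assms]
  by (simp add: szk_H2(2)[OF assms(2)] sums_unique2)

section \<open>The vector-valued Hardy space as a Hilbert space\<close>

lemma H2vD: "f \<in> H2v \<Longrightarrow> (\<lambda>z. f z $ i) \<in> H2"
  by (simp add: H2v_def)

lemma H2vI: "(\<And>i. (\<lambda>z. f z $ i) \<in> H2) \<Longrightarrow> f \<in> H2v"
  by (simp add: H2v_def)

lemma H2v_add: "f \<in> H2v \<Longrightarrow> g \<in> H2v \<Longrightarrow> (\<lambda>z. f z + g z) \<in> H2v"
  by (simp add: H2v_def H2_add)

lemma H2v_scale: "f \<in> H2v \<Longrightarrow> (\<lambda>z. c *s f z) \<in> H2v"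
  by (simp add: H2v_def H2_scale)

lemma H2v_diff: "f \<in> H2v \<Longrightarrow> g \<in> H2v \<Longrightarrow> (\<lambda>z. f z - g z) \<in> H2v"
  by (simp add: H2v_def H2_diff)

lemma H2v_uminus: "f \<in> H2v \<Longrightarrow> (\<lambda>z. - f z) \<in> H2v"
  by (simp add: H2v_def H2_uminus)

lemma H2v_zero: "(\<lambda>z. 0) \<in> H2v"
  by (simp add: H2v_def H2_zero)

lemma H2v_sum: "(\<And>i. i \<in> I \<Longrightarrow> f i \<in> H2v) \<Longrightarrow> (\<lambda>z. \<Sum>i\<in>I. f i z) \<in> H2v"
  by (induction I rule: infinite_finite_induct) (auto simp: H2v_zero intro: H2v_add)

lemma H2v_inner_add_left:
  "f \<in> H2v \<Longrightarrow> g \<in> H2v \<Longrightarrow> h \<in> H2v \<Longrightarrow> H2v_inner (\<lambda>z. f z + g z) h = H2v_inner f h + H2v_inner g h"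
  by (simp add: H2v_inner_def H2v_def H2_inner_add_left sum.distrib)

lemma H2v_inner_scale_left:
  "f \<in> H2v \<Longrightarrow> h \<in> H2v \<Longrightarrow> H2v_inner (\<lambda>z. c *s f z) h = c * H2v_inner f h"
  by (simp add: H2v_inner_def H2v_def H2_inner_scale_left sum_distrib_left)

lemma H2v_inner_commute:
  "f \<in> H2v \<Longrightarrow> h \<in> H2v \<Longrightarrow> H2v_inner h f = cnj (H2v_inner f h)"
  unfolding H2v_inner_def cnj_sum by (intro sum.cong refl H2_inner_commute H2vD)

lemma H2v_norm_nonneg: "0 \<le> H2v_norm f"
  by (simp add: H2v_norm_def sum_nonneg)

lemma H2v_norm_sq: "(H2v_norm f)\<^sup>2 = (\<Sum>i\<in>UNIV. (H2_norm (\<lambda>z. f z $ i))\<^sup>2)"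
  by (simp add: H2v_norm_def sum_nonneg)

lemma H2v_inner_self:
  "f \<in> H2v \<Longrightarrow> H2v_inner f f = complex_of_real ((H2v_norm f)\<^sup>2)"
  unfolding H2v_inner_def H2v_norm_sq of_real_sum by (intro sum.cong refl H2_inner_self H2vD)

lemma H2v_inner_uminus_left:
  "f \<in> H2v \<Longrightarrow> h \<in> H2v \<Longrightarrow> H2v_inner (\<lambda>z. - f z) h = - H2v_inner f h"
  using H2v_inner_scale_left[of f h "-1"] by (simp add: vector_sneg_minus1 [symmetric])

lemma H2v_inner_diff_left:
  assumes "f \<in> H2v" "g \<in> H2v" "h \<in> H2v"
  shows "H2v_inner (\<lambda>z. f z - g z) h = H2v_inner f h - H2v_inner g h"
  using H2v_inner_add_left[OF assms(1) H2v_uminus[OF assms(2)] assms(3)] H2v_inner_uminus_left[OF assms(2,3)] by simp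

lemma H2v_inner_add_right:
  assumes "f \<in> H2v" "g \<in> H2v" "h \<in> H2v"
  shows "H2v_inner h (\<lambda>z. f z + g z) = H2v_inner h f + H2v_inner h g"
  using H2v_inner_add_left[OF assms] assms
  by (simp add: H2v_inner_commute[OF _ assms(3)] H2v_inner_commute[OF H2v_add[OF assms(1,2)] assms(3)] flip: complex_cnj_add)

lemma H2v_inner_scale_right:
  assumes "f \<in> H2v" "h \<in> H2v"
  shows "H2v_inner h (\<lambda>z. c *s f z) = cnj c * H2v_inner h f"
  using H2v_inner_scale_left[OF assms, of c] assms
  by (simp add: H2v_inner_commute[OF assms(1,2)] H2v_inner_commute[OF H2v_scale[OF assms(1)] assms(2)])

lemma H2v_inner_uminus_right:
  "f \<in> H2v \<Longrightarrow> h \<in> H2v \<Longrightarrow> H2v_inner h (\<lambda>z. - f z) = - H2v_inner h f"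
  using H2v_inner_scale_right[of f h "-1"] by (simp add: vector_sneg_minus1 [symmetric])

lemma H2v_inner_diff_right:
  assumes "f \<in> H2v" "g \<in> H2v" "h \<in> H2v"
  shows "H2v_inner h (\<lambda>z. f z - g z) = H2v_inner h f - H2v_inner h g"
  using H2v_inner_add_right[OF assms(1) H2v_uminus[OF assms(2)] assms(3)] H2v_inner_uminus_right[OF assms(2,3)] by simp

lemma H2v_inner_zero_left: "h \<in> H2v \<Longrightarrow> H2v_inner (\<lambda>z. 0) h = 0"
  using H2v_inner_scale_left[OF H2v_zero, of h 0] by simp

lemma H2v_inner_sum_left:
  "(\<And>i. i \<in> I \<Longrightarrow> f i \<in> H2v) \<Longrightarrow> h \<in> H2v \<Longrightarrow> H2v_inner (\<lambda>z. \<Sum>i\<in>I. f i z) h = (\<Sum>i\<in>I. H2v_inner (f i) h)"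
  by (induction I rule: infinite_finite_induct)
    (auto simp: H2v_inner_zero_left H2v_inner_add_left H2v_sum)

lemma H2v_inner_sum_right:
  assumes "\<And>i. i \<in> I \<Longrightarrow> f i \<in> H2v" "h \<in> H2v"
  shows "H2v_inner h (\<lambda>z. \<Sum>i\<in>I. f i z) = (\<Sum>i\<in>I. H2v_inner h (f i))"
proof -
  have "H2v_inner h (\<lambda>z. \<Sum>i\<in>I. f i z) = cnj (H2v_inner (\<lambda>z. \<Sum>i\<in>I. f i z) h)"
    by (rule H2v_inner_commute[OF H2v_sum[OF assms(1)] assms(2)])
  also have "\<dots> = (\<Sum>i\<in>I. cnj (H2v_inner (f i) h))"
    by (simp add: H2v_inner_sum_left[OF assms])
  also have "\<dots> = (\<Sum>i\<in>I. H2v_inner h (f i))"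
    by (intro sum.cong refl H2v_inner_commute [symmetric] assms)
  finally show ?thesis .
qed

lemma H2v_norm_diff_sq:
  assumes "f \<in> H2v" "g \<in> H2v"
  shows "(H2v_norm (\<lambda>z. f z - g z))\<^sup>2 = (H2v_norm f)\<^sup>2 - 2 * Re (H2v_inner f g) + (H2v_norm g)\<^sup>2"
proof -
  have "complex_of_real ((H2v_norm (\<lambda>z. f z - g z))\<^sup>2) = H2v_inner f f - H2v_inner f g - (cnj (H2v_inner f g) - H2v_inner g g)"
    unfolding H2v_inner_self[OF H2v_diff[OF assms], symmetric]
    using assms H2v_inner_commute[OF assms]
    by (simp add: H2v_diff H2v_inner_diff_left H2v_inner_diff_right)
  also have "\<dots> = complex_of_real ((H2v_norm f)\<^sup>2 - 2 * Re (H2v_inner f g) + (H2v_norm g)\<^sup>2)"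
    using assms by (simp add: H2v_inner_self complex_eq_iff)
  finally show ?thesis
    by (simp only: of_real_eq_iff)
qed

lemma H2v_norm_scale_sq:
  assumes "f \<in> H2v"
  shows "(H2v_norm (\<lambda>z. c *s f z))\<^sup>2 = (cmod c)\<^sup>2 * (H2v_norm f)\<^sup>2"
proof -
  have "complex_of_real ((H2v_norm (\<lambda>z. c *s f z))\<^sup>2) = c * (cnj c * H2v_inner f f)"
    unfolding H2v_inner_self[OF H2v_scale[OF assms], symmetric]
    using assms by (simp add: H2v_scale H2v_inner_scale_left H2v_inner_scale_right)
  also have "\<dots> = complex_of_real ((cmod c)\<^sup>2 * (H2v_norm f)\<^sup>2)"
    using assms by (simp only: H2v_inner_self of_real_mult complex_norm_square mult.assoc)
  finally show ?thesis
    by (simp only: of_real_eq_iff)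
qed

lemma H2v_Cauchy_Schwarz:
  assumes f: "f \<in> H2v" and g: "g \<in> H2v"
  shows "cmod (H2v_inner f g) \<le> H2v_norm f * H2v_norm g"
proof -
  \<comment> \<open>A unimodular factor that turns the inner product into its modulus; its value 1
    in the degenerate case is arbitrary.\<close>
  define u where "u = (if H2v_inner f g = 0 then 1 else H2v_inner f g / cmod (H2v_inner f g))"
  have u: "cmod u = 1" "cnj u * H2v_inner f g = cmod (H2v_inner f g)"
  proof -
    show "cmod u = 1"
      by (simp add: u_def norm_divide)
    show "cnj u * H2v_inner f g = cmod (H2v_inner f g)"
      by (simp add: u_def cnj_mult_self power2_eq_square)
  qed
  have "0 \<le> (H2v_norm f)\<^sup>2 - 2 * s * cmod (H2v_inner f g) + s\<^sup>2 * (H2v_norm g)\<^sup>2" for s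
  proof -
    have "0 \<le> (H2v_norm (\<lambda>z. f z - (complex_of_real s * u) *s g z))\<^sup>2"
      by simp
    also have "\<dots> = (H2v_norm f)\<^sup>2 - 2 * Re (cnj (complex_of_real s * u) * H2v_inner f g) + (cmod (complex_of_real s * u))\<^sup>2 * (H2v_norm g)\<^sup>2"
      using f g by (simp only: H2v_norm_diff_sq H2v_scale H2v_inner_scale_right H2v_norm_scale_sq)
    also have "cnj (complex_of_real s * u) * H2v_inner f g = complex_of_real (s * cmod (H2v_inner f g))"
      using u(2) by (simp add: mult.assoc)
    also have "(cmod (complex_of_real s * u))\<^sup>2 = s\<^sup>2"
      by (simp add: norm_mult u(1))
    finally show ?thesis
      by (simp add: mult.assoc)
  qed
  then have "(cmod (H2v_inner f g))\<^sup>2 \<le> (H2v_norm f)\<^sup>2 * (H2v_norm g)\<^sup>2"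
    by (rule discriminant_le)
  then have "(cmod (H2v_inner f g))\<^sup>2 \<le> (H2v_norm f * H2v_norm g)\<^sup>2"
    by (simp add: power_mult_distrib)
  then show ?thesis
    by (rule power2_le_imp_le) (simp add: H2v_norm_nonneg)
qed

lemma H2_comp_norm_le: "H2_norm (\<lambda>z. f z $ i) \<le> H2v_norm f"
proof (rule power2_le_imp_le[OF _ H2v_norm_nonneg])
  show "(H2_norm (\<lambda>z. f z $ i))\<^sup>2 \<le> (H2v_norm f)\<^sup>2"
    unfolding H2v_norm_sq by (rule member_le_sum) auto
qed

lemma H2v_complete:
  fixes x :: "nat \<Rightarrow> complex \<Rightarrow> complex^'n"
  assumes x: "\<And>k. x k \<in> H2v"
    and C: "\<And>e. 0 < e \<Longrightarrow> \<exists>N. \<forall>m\<ge>N. \<forall>n\<ge>N. H2v_norm (\<lambda>z. x m z - x n z) < e"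
  shows "\<exists>y\<in>H2v. (\<lambda>k. H2v_norm (\<lambda>z. x k z - y z)) \<longlonglongrightarrow> 0"
proof -
  have ex: "\<exists>y\<in>H2. (\<lambda>k. H2_norm (\<lambda>z. x k z $ i - y z)) \<longlonglongrightarrow> 0" for i
  proof (rule H2_complete[OF H2vD[OF x]])
    fix e :: real assume "0 < e"
    then obtain N where N: "\<And>m n. m \<ge> N \<Longrightarrow> n \<ge> N \<Longrightarrow> H2v_norm (\<lambda>z. x m z - x n z) < e"
      using C by blast
    have "H2_norm (\<lambda>z. x m z $ i - x n z $ i) < e" if "m \<ge> N" "n \<ge> N" for m n
      using H2_comp_norm_le[where f = "\<lambda>z. x m z - x n z" and i = i] N[OF that] by simp
    then show "\<exists>N. \<forall>m\<ge>N. \<forall>n\<ge>N. H2_norm (\<lambda>z. x m z $ i - x n z $ i) < e"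
      by blast
  qed
  define y where "y i = (SOME y. y \<in> H2 \<and> (\<lambda>k. H2_norm (\<lambda>z. x k z $ i - y z)) \<longlonglongrightarrow> 0)" for i
  have y: "y i \<in> H2 \<and> (\<lambda>k. H2_norm (\<lambda>z. x k z $ i - y i z)) \<longlonglongrightarrow> 0" for i
    unfolding y_def using ex[of i, unfolded Bex_def] by (rule someI_ex)
  define Y where "Y z = (\<chi> i. y i z)" for z
  have "Y \<in> H2v"
    unfolding Y_def [abs_def] by (rule H2vI) (simp add: y)
  moreover have "(\<lambda>k. H2v_norm (\<lambda>z. x k z - Y z)) \<longlonglongrightarrow> 0"
  proof -
    have "(\<lambda>k. sqrt (\<Sum>i\<in>UNIV. (H2_norm (\<lambda>z. x k z $ i - y i z))\<^sup>2)) \<longlonglongrightarrow> sqrt (\<Sum>i\<in>(UNIV::'n set). 0\<^sup>2)"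
      by (intro tendsto_intros conjunct2[OF y])
    then show ?thesis
      by (simp add: H2v_norm_def Y_def)
  qed
  ultimately show ?thesis by blast
qed

text \<open>The functional is given as a relation, so that its being well defined need not be checked:
  it follows from the bound. The representing function is the limit of a minimising sequence of
  \<open>\<parallel>x\<parallel>\<^sup>2 - 2 Re a\<close>.\<close>

lemma H2v_Riesz:
  fixes P :: "((complex \<Rightarrow> complex^'n) \<times> complex) set"
  assumes P: "\<And>x a. (x, a) \<in> P \<Longrightarrow> x \<in> H2v"
    and Pne: "P \<noteq> {}"
    and Padd: "\<And>x a y b s. (x, a) \<in> P \<Longrightarrow> (y, b) \<in> P \<Longrightarrow> ((\<lambda>z. x z - s *s y z), a - s * b) \<in> P"
    and bd: "\<And>x a. (x, a) \<in> P \<Longrightarrow> cmod a \<le> C * H2v_norm x" and C: "0 \<le> C"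
  obtains y where "y \<in> H2v" "H2v_norm y \<le> C" "\<And>x a. (x, a) \<in> P \<Longrightarrow> H2v_inner x y = a"
    "\<And>v. v \<in> H2v \<Longrightarrow> (\<And>x a. (x, a) \<in> P \<Longrightarrow> H2v_inner x v = 0) \<Longrightarrow> H2v_inner y v = 0"
proof -
  define J where "J p = (H2v_norm (fst p))\<^sup>2 - 2 * Re (snd p)" for p :: "(complex \<Rightarrow> complex^'n) \<times> complex"
  have Jlow: "- C\<^sup>2 \<le> J p" if "p \<in> P" for p
  proof -
    have "Re (snd p) \<le> C * H2v_norm (fst p)"
      using bd[of "fst p" "snd p"] complex_Re_le_cmod[of "snd p"] that by simp
    moreover have "2 * (C * H2v_norm (fst p)) \<le> C\<^sup>2 + (H2v_norm (fst p))\<^sup>2"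
      using sum_squares_bound[of C "H2v_norm (fst p)"] by (simp add: mult.assoc)
    ultimately show ?thesis
      unfolding J_def by linarith
  qed
  define m where "m = Inf (J ` P)"
  have m: "m \<le> J p" if "p \<in> P" for p
    unfolding m_def by (rule cInf_lower) (use that Jlow in \<open>auto intro!: bdd_belowI[of _ "- C\<^sup>2"]\<close>)
  have "\<exists>p\<in>P. J p < m + e" if "0 < e" for e
  proof -
    have "\<exists>j\<in>J ` P. j < m + e"
      unfolding m_def by (rule cInf_lessD) (use Pne that in \<open>auto simp: m_def\<close>)
    then show ?thesis by blast
  qed
  \<comment> \<open>The excess over the infimum is a square so that the discriminant bound below
    becomes linear in \<open>e k\<close>.\<close>
  then have "\<exists>p. p \<in> P \<and> J p < m + (1 / (real k + 1))\<^sup>2" for k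
    by (metis add_increasing of_nat_0_le_iff zero_le_one zero_less_divide_1_iff zero_less_power
        add_nonneg_pos zero_less_one)
  then obtain p where p: "\<And>k. p k \<in> P" "\<And>k. J (p k) < m + (1 / (real k + 1))\<^sup>2"
    by metis
  define x where "x k = fst (p k)" for k
  define a where "a k = snd (p k)" for k
  define e where "e k = 1 / (real k + 1)" for k :: nat
  have e0: "0 < e k" for k by (simp add: e_def)
  have e_lim: "e \<longlonglongrightarrow> 0"
    unfolding e_def by real_asymp
  have xa: "(x k, a k) \<in> P" for k
    using p(1) by (simp add: x_def a_def)
  have xH: "x k \<in> H2v" for k
    by (rule P[OF xa])
  \<comment> \<open>The first-order condition for an approximate minimiser: moving
    \<open>x k\<close> by a multiple of \<open>d\<close> lowers \<open>J\<close> by at most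
    \<open>(e k)^2\<close>, and the resulting quadratic in \<open>s\<close> has nonpositive
    discriminant.\<close>
  have near: "cmod (H2v_inner d (x k) - b) \<le> e k * H2v_norm d" if db: "(d, b) \<in> P" for d b k
  proof -
    have dH: "d \<in> H2v" by (rule P[OF db])
    define g where "g = H2v_inner d (x k) - b"
    define u where "u = (if g = 0 then 1 else cnj g / cmod g)"
    have u: "cmod u = 1" "u * g = cmod g"
      by (auto simp: u_def norm_divide cnj_mult_self power2_eq_square)
    have "0 \<le> (e k)\<^sup>2 - 2 * s * cmod g + s\<^sup>2 * (H2v_norm d)\<^sup>2" for s
    proof -
      let ?s = "complex_of_real s * u"
      have "m \<le> J ((\<lambda>z. x k z - ?s *s d z), a k - ?s * b)"
        by (rule m[OF Padd[OF xa db]])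
      also have "\<dots> = (H2v_norm (x k))\<^sup>2 - 2 * Re (H2v_inner (x k) (\<lambda>z. ?s *s d z)) + (H2v_norm (\<lambda>z. ?s *s d z))\<^sup>2 - 2 * Re (a k - ?s * b)"
        by (simp add: J_def H2v_norm_diff_sq[OF xH H2v_scale[OF dH]])
      also have "Re (H2v_inner (x k) (\<lambda>z. ?s *s d z)) = Re (?s * H2v_inner d (x k))"
        by (subst H2v_inner_commute[OF H2v_scale[OF dH] xH]) (simp only: H2v_inner_scale_left[OF dH xH] complex_cnj(1) cnj.sel)
      also have "(H2v_norm (\<lambda>z. ?s *s d z))\<^sup>2 = s\<^sup>2 * (H2v_norm d)\<^sup>2"
        by (simp add: H2v_norm_scale_sq[OF dH] norm_mult u(1))
      also have "(H2v_norm (x k))\<^sup>2 - 2 * Re (?s * H2v_inner d (x k)) + s\<^sup>2 * (H2v_norm d)\<^sup>2 - 2 * Re (a k - ?s * b) =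
          J (p k) - 2 * Re (?s * g) + s\<^sup>2 * (H2v_norm d)\<^sup>2"
        by (simp add: J_def x_def a_def g_def right_diff_distrib)
      also have "?s * g = complex_of_real (s * cmod g)"
        using u(2) by (simp add: mult.assoc)
      finally show ?thesis
        using p(2)[of k] unfolding e_def Re_complex_of_real by linarith
    qed
    then have "(cmod g)\<^sup>2 \<le> (e k)\<^sup>2 * (H2v_norm d)\<^sup>2"
      by (rule discriminant_le)
    then have "(cmod g)\<^sup>2 \<le> (e k * H2v_norm d)\<^sup>2"
      by (simp add: power_mult_distrib)
    then show ?thesis
      unfolding g_def by (rule power2_le_imp_le) (use e0[of k] in \<open>simp add: H2v_norm_nonneg\<close>)
  qed
  \<comment> \<open>For \<open>d\<close> the difference of two members, its squared norm is the
    inner product of \<open>d\<close> with \<open>x k\<close> minus that with \<open>x l\<close>.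
    Both are close to the same value \<open>a k - a l\<close>, which cancels.\<close>
  have cau: "H2v_norm (\<lambda>z. x k z - x l z) \<le> e k + e l" for k l
  proof -
    let ?d = "\<lambda>z. x k z - x l z"
    have "(\<lambda>z. x k z - 1 *s x l z, a k - 1 * a l) \<in> P"
      by (rule Padd[OF xa xa])
    then have dP: "(?d, a k - a l) \<in> P" by simp
    have dH: "?d \<in> H2v" by (rule P[OF dP])
    have "complex_of_real ((H2v_norm ?d)\<^sup>2) = (H2v_inner ?d (x k) - (a k - a l)) - (H2v_inner ?d (x l) - (a k - a l))"
      by (simp only: H2v_inner_self[OF dH, symmetric] H2v_inner_diff_right[OF xH xH dH]) simp
    note eq = this
    have "cmod (complex_of_real ((H2v_norm ?d)\<^sup>2)) \<le> e k * H2v_norm ?d + e l * H2v_norm ?d"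
      unfolding eq
      using norm_triangle_ineq4[of "H2v_inner ?d (x k) - (a k - a l)" "H2v_inner ?d (x l) - (a k - a l)"]
        near[OF dP, of k] near[OF dP, of l] by linarith
    then have "H2v_norm ?d * H2v_norm ?d \<le> (e k + e l) * H2v_norm ?d"
      by (simp add: power2_eq_square distrib_right H2v_norm_nonneg norm_mult)
    then show ?thesis
      using e0[of k] e0[of l] H2v_norm_nonneg[of ?d]
      by (cases "H2v_norm ?d = 0") (auto simp: mult_le_cancel_right)
  qed
  have "\<exists>y\<in>H2v. (\<lambda>k. H2v_norm (\<lambda>z. x k z - y z)) \<longlonglongrightarrow> 0"
  proof (rule H2v_complete[OF xH])
    fix \<epsilon> :: real assume "0 < \<epsilon>"
    then obtain N where N: "\<And>k. k \<ge> N \<Longrightarrow> e k < \<epsilon> / 2"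
      using order_tendstoD(2)[OF e_lim, of "\<epsilon> / 2"] by (auto simp: eventually_sequentially)
    have "H2v_norm (\<lambda>z. x k z - x l z) < \<epsilon>" if "k \<ge> N" "l \<ge> N" for k l
      using cau[of k l] N[OF that(1)] N[OF that(2)] by linarith
    then show "\<exists>N. \<forall>m\<ge>N. \<forall>n\<ge>N. H2v_norm (\<lambda>z. x m z - x n z) < \<epsilon>"
      by blast
  qed
  then obtain y where y: "y \<in> H2v" and ylim: "(\<lambda>k. H2v_norm (\<lambda>z. x k z - y z)) \<longlonglongrightarrow> 0"
    by blast
  have inl: "(\<lambda>k. H2v_inner d (x k)) \<longlonglongrightarrow> H2v_inner d y" if d: "d \<in> H2v" for d
  proof -
    have "(\<lambda>k. H2v_inner d (x k) - H2v_inner d y) \<longlonglongrightarrow> 0"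
    proof (rule Lim_null_comparison)
      show "\<forall>\<^sub>F k in sequentially. norm (H2v_inner d (x k) - H2v_inner d y) \<le> H2v_norm d * H2v_norm (\<lambda>z. x k z - y z)"
        using H2v_Cauchy_Schwarz[OF d H2v_diff[OF xH y]] by (simp add: H2v_inner_diff_right[OF xH y d])
      show "(\<lambda>k. H2v_norm d * H2v_norm (\<lambda>z. x k z - y z)) \<longlonglongrightarrow> 0"
        using tendsto_mult[OF tendsto_const ylim, of "H2v_norm d"] by simp
    qed
    then show ?thesis by (rule LIM_zero_cancel)
  qed
  have rep: "H2v_inner d y = b" if db: "(d, b) \<in> P" for d b
  proof -
    have "(\<lambda>k. H2v_inner d (x k) - b) \<longlonglongrightarrow> 0"
    proof (rule Lim_null_comparison)
      show "\<forall>\<^sub>F k in sequentially. norm (H2v_inner d (x k) - b) \<le> e k * H2v_norm d"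
        using near[OF db] by simp
      show "(\<lambda>k. e k * H2v_norm d) \<longlonglongrightarrow> 0"
        using tendsto_mult[OF e_lim tendsto_const, of "H2v_norm d"] by simp
    qed
    then have "(\<lambda>k. H2v_inner d (x k)) \<longlonglongrightarrow> b"
      by (rule LIM_zero_cancel)
    with inl[OF P[OF db]] show ?thesis
      by (rule LIMSEQ_unique)
  qed
  \<comment> \<open>\<open>y\<close> is a limit of first components of \<open>P\<close>, so whatever
    is orthogonal to all of these is orthogonal to \<open>y\<close>.\<close>
  have orth: "H2v_inner y v = 0" if v: "v \<in> H2v" "\<And>x a. (x, a) \<in> P \<Longrightarrow> H2v_inner x v = 0" for v
  proof -
    have "H2v_inner v (x k) = 0" for k
      using v(2)[OF xa, of k] H2v_inner_commute[OF xH v(1), of k] by simp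
    then have "H2v_inner v y = 0"
      using inl[OF v(1)] by (simp add: LIMSEQ_const_iff)
    then show ?thesis
      using H2v_inner_commute[OF v(1) y] by simp
  qed
  \<comment> \<open>The bound on the functional along \<open>x k\<close>, whose values
    \<open>a k\<close> are inner products with \<open>y\<close>, passes to the limit as a bound for
    the squared norm of \<open>y\<close>.\<close>
  have "H2v_norm y \<le> C"
  proof -
    have yx: "cmod (H2v_inner y (x k)) \<le> C * (H2v_norm y + H2v_norm (\<lambda>z. x k z - y z))" for k
    proof -
      have "cmod (H2v_inner y (x k)) = cmod (a k)"
        using rep[OF xa, of k] H2v_inner_commute[OF xH y, of k] by simp
      also have "\<dots> \<le> C * H2v_norm (x k)"
        by (rule bd[OF xa])
      also have "H2v_norm (x k) \<le> H2v_norm y + H2v_norm (\<lambda>z. x k z - y z)"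
      proof (rule power2_le_imp_le)
        let ?d = "\<lambda>z. x k z - y z"
        have "(H2v_norm (x k))\<^sup>2 = (H2v_norm (\<lambda>z. ?d z - (- y z)))\<^sup>2"
          by simp
        also have "\<dots> = (H2v_norm ?d)\<^sup>2 + 2 * Re (H2v_inner ?d y) + (H2v_norm (\<lambda>z. - y z))\<^sup>2"
          by (subst H2v_norm_diff_sq[OF H2v_diff[OF xH y] H2v_uminus[OF y]])
            (simp add: H2v_inner_uminus_right[OF y H2v_diff[OF xH y]])
        also have "(H2v_norm (\<lambda>z. - y z))\<^sup>2 = (H2v_norm y)\<^sup>2"
          using H2v_norm_scale_sq[OF y, of "-1"] by (simp add: vector_sneg_minus1 [symmetric])
        also have "Re (H2v_inner ?d y) \<le> H2v_norm ?d * H2v_norm y"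
          using H2v_Cauchy_Schwarz[OF H2v_diff[OF xH y] y] complex_Re_le_cmod order_trans by blast
        finally show "(H2v_norm (x k))\<^sup>2 \<le> (H2v_norm y + H2v_norm ?d)\<^sup>2"
          by (simp add: power2_sum mult.commute)
      qed (simp add: H2v_norm_nonneg)
      finally show ?thesis
        using C by (simp add: mult_left_mono)
    qed
    have "cmod (H2v_inner y y) \<le> C * (H2v_norm y + 0)"
      by (rule LIMSEQ_le[OF tendsto_norm[OF inl[OF y]] tendsto_mult[OF tendsto_const tendsto_add[OF tendsto_const ylim]]])
        (use yx in blast)
    then have "H2v_norm y * H2v_norm y \<le> C * H2v_norm y"
      by (simp add: H2v_inner_self[OF y] power2_eq_square norm_mult H2v_norm_nonneg)
    then show ?thesis
      using C H2v_norm_nonneg[of y] by (cases "H2v_norm y = 0") (auto simp: mult_le_cancel_right)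
  qed
  with y rep orth that show thesis
    by blast
qed

section \<open>Bounded multipliers and Poisson integrals\<close>

definition bdd_hol :: "(complex \<Rightarrow> complex) \<Rightarrow> bool" where
  "bdd_hol m \<longleftrightarrow> m holomorphic_on ball 0 1 \<and> (\<exists>M. \<forall>z\<in>ball 0 1. cmod (m z) \<le> M)"

lemma bdd_hol_const: "bdd_hol (\<lambda>z. c)"
  by (auto simp: bdd_hol_def)

lemma bdd_hol_ident: "bdd_hol (\<lambda>z. z)"
  unfolding bdd_hol_def by (intro conjI holomorphic_intros exI[of _ 1]) (auto simp: less_imp_le)

lemma bdd_hol_add:
  assumes "bdd_hol f" "bdd_hol g" shows "bdd_hol (\<lambda>z. f z + g z)"
proof -
  obtain M N where "\<And>z. z \<in> ball 0 1 \<Longrightarrow> cmod (f z) \<le> M" "\<And>z. z \<in> ball 0 1 \<Longrightarrow> cmod (g z) \<le> N"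
    using assms unfolding bdd_hol_def by blast
  then have "\<forall>z\<in>ball 0 1. cmod (f z + g z) \<le> M + N"
    by (meson add_mono norm_triangle_le)
  then have "\<exists>K. \<forall>z\<in>ball 0 1. cmod (f z + g z) \<le> K"
    by blast
  then show ?thesis
    using assms by (simp add: bdd_hol_def holomorphic_on_add)
qed

lemma bdd_hol_mult:
  assumes "bdd_hol f" "bdd_hol g" shows "bdd_hol (\<lambda>z. f z * g z)"
proof -
  obtain M N where M: "\<And>z. z \<in> ball 0 1 \<Longrightarrow> cmod (f z) \<le> M" and N: "\<And>z. z \<in> ball 0 1 \<Longrightarrow> cmod (g z) \<le> N"
    using assms unfolding bdd_hol_def by blast
  have "cmod (f z * g z) \<le> M * N" if "z \<in> ball 0 1" for z
    unfolding norm_mult using M[OF that] N[OF that] by (intro mult_mono) (auto intro: order_trans[OF norm_ge_zero])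
  then have "\<exists>K. \<forall>z\<in>ball 0 1. cmod (f z * g z) \<le> K"
    by blast
  then show ?thesis
    using assms by (simp add: bdd_hol_def holomorphic_on_mult)
qed

lemma bdd_hol_sum: "(\<And>i. i \<in> I \<Longrightarrow> bdd_hol (f i)) \<Longrightarrow> bdd_hol (\<lambda>z. \<Sum>i\<in>I. f i z)"
  by (induction I rule: infinite_finite_induct) (auto simp: bdd_hol_const intro: bdd_hol_add)

lemma bdd_hol_prod: "(\<And>i. i \<in> I \<Longrightarrow> bdd_hol (f i)) \<Longrightarrow> bdd_hol (\<lambda>z. \<Prod>i\<in>I. f i z)"
  by (induction I rule: infinite_finite_induct) (auto simp: bdd_hol_const intro: bdd_hol_mult)

lemma bdd_hol_power: "bdd_hol f \<Longrightarrow> bdd_hol (\<lambda>z. f z ^ n)"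
  by (induction n) (auto simp: bdd_hol_const intro: bdd_hol_mult)

lemma bdd_hol_det:
  fixes A :: "complex \<Rightarrow> complex^'n^'n"
  assumes "\<And>i j. bdd_hol (\<lambda>z. A z $ i $ j)"
  shows "bdd_hol (\<lambda>z. det (A z))"
  unfolding det_def by (intro bdd_hol_sum bdd_hol_mult bdd_hol_prod bdd_hol_const assms)

lemma H2_mult:
  assumes m: "bdd_hol m" and f: "f \<in> H2"
  shows "(\<lambda>z. m z * f z) \<in> H2"
proof -
  obtain M where M: "\<And>z. z \<in> ball 0 1 \<Longrightarrow> cmod (m z) \<le> M"
    using m unfolding bdd_hol_def by blast
  obtain K where K: "\<And>r. 0 \<le> r \<Longrightarrow> r < 1 \<Longrightarrow> (LINT t|circ. (cmod (f (complex_of_real r * cis t)))\<^sup>2) \<le> K"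
    using f unfolding H2_def set_LINT_circ by blast
  have hm: "(\<lambda>z. m z * f z) holomorphic_on ball 0 1"
    using m f by (auto simp: bdd_hol_def H2_def intro!: holomorphic_intros)
  have "(LINT t|circ. (cmod (m (complex_of_real r * cis t) * f (complex_of_real r * cis t)))\<^sup>2) \<le> M\<^sup>2 * K"
    if r: "0 \<le> r" "r < 1" for r
  proof -
    have "(LINT t|circ. (cmod (m (complex_of_real r * cis t) * f (complex_of_real r * cis t)))\<^sup>2) \<le>
        (LINT t|circ. M\<^sup>2 * (cmod (f (complex_of_real r * cis t)))\<^sup>2)"
    proof (rule integral_mono)
      show "integrable circ (\<lambda>t. (cmod (m (complex_of_real r * cis t) * f (complex_of_real r * cis t)))\<^sup>2)"
        by (rule sq_int_integrable_sq[OF circle_series(1)[OF tc_sums[OF hm] r]])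
      show "integrable circ (\<lambda>t. M\<^sup>2 * (cmod (f (complex_of_real r * cis t)))\<^sup>2)"
        by (intro integrable_mult_right sq_int_integrable_sq[OF circle_series(1)[OF H2_tc_sums[OF f] r]])
      show "(cmod (m (complex_of_real r * cis t) * f (complex_of_real r * cis t)))\<^sup>2 \<le> M\<^sup>2 * (cmod (f (complex_of_real r * cis t)))\<^sup>2" for t
        unfolding norm_mult power_mult_distrib using M[of "complex_of_real r * cis t"] r
        by (intro mult_right_mono power_mono) auto
    qed
    also have "\<dots> \<le> M\<^sup>2 * K"
      using K[OF r] by (simp add: mult_left_mono)
    finally show ?thesis .
  qed
  then show ?thesis
    unfolding H2_def set_LINT_circ using hm by blast
qed

lemma H2_const: "(\<lambda>z. c) \<in> H2"
proof -
  have "(\<lambda>z. c * szk 0 z) \<in> H2"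
    by (rule H2_scale(1)[OF szk_H2(1)]) simp
  then show ?thesis
    by (simp add: szk_def)
qed

lemma bdd_hol_H2: "bdd_hol m \<Longrightarrow> m \<in> H2"
  using H2_mult[OF _ H2_const[of 1]] by simp

lemma bdd_hol_szk:
  assumes w: "cmod w < 1" shows "bdd_hol (szk w)"
proof -
  have b: "1 - cmod w \<le> cmod (1 - cnj w * z)" if "cmod z < 1" for z
  proof -
    have "cmod w * cmod z \<le> cmod w * 1"
      using that by (intro mult_left_mono) auto
    then show ?thesis
      using norm_triangle_ineq2[of 1 "cnj w * z"] by (simp add: norm_mult)
  qed
  have nz: "1 - cnj w * z \<noteq> 0" if "cmod z < 1" for z
    using b[OF that] w by auto
  have "szk w holomorphic_on ball 0 1"
    unfolding szk_def [abs_def] using nz by (intro holomorphic_intros) auto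
  moreover have "cmod (szk w z) \<le> 1 / (1 - cmod w)" if "z \<in> ball 0 1" for z
    using b[of z] that w unfolding szk_def norm_divide by (intro frac_le) auto
  ultimately show ?thesis
    unfolding bdd_hol_def by blast
qed

section \<open>Calculus of radial limits\<close>

lemma has_bvI: "((\<lambda>r. f (complex_of_real r * cis t)) \<longlongrightarrow> l) (at_left 1) \<Longrightarrow> has_bv f t \<and> bv f t = l"
  using bv_eqI has_bv_iff by blast

lemma bv_mult:
  fixes f g :: "complex \<Rightarrow> complex"
  assumes "has_bv f t" "has_bv g t"
  shows "has_bv (\<lambda>z. f z * g z) t" "bv (\<lambda>z. f z * g z) t = bv f t * bv g t"
  using has_bvI[OF tendsto_mult[OF assms[unfolded has_bv_def]]] by auto

lemma bv_const: "has_bv (\<lambda>z. c) t" "bv (\<lambda>z. c) t = c"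
  using has_bvI[of "\<lambda>z. c" t c] by auto

lemma bv_sum:
  fixes f :: "'i \<Rightarrow> complex \<Rightarrow> complex"
  assumes "\<And>i. i \<in> I \<Longrightarrow> has_bv (f i) t"
  shows "has_bv (\<lambda>z. \<Sum>i\<in>I. f i z) t \<and> bv (\<lambda>z. \<Sum>i\<in>I. f i z) t = (\<Sum>i\<in>I. bv (f i) t)"
  using assms
  by (intro has_bvI tendsto_sum) (auto simp: has_bv_def)

lemma has_bv_vec_iff:
  fixes f :: "complex \<Rightarrow> 'a::metric_space^'n"
  shows "has_bv f t \<longleftrightarrow> (\<forall>i. has_bv (\<lambda>z. f z $ i) t)"
proof
  assume "has_bv f t"
  then have "((\<lambda>r. f (complex_of_real r * cis t) $ i) \<longlongrightarrow> bv f t $ i) (at_left 1)" for i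
    unfolding has_bv_def by (rule tendsto_vec_nth)
  then show "\<forall>i. has_bv (\<lambda>z. f z $ i) t"
    using has_bvI[of "\<lambda>z. f z $ _" t] by blast
next
  assume "\<forall>i. has_bv (\<lambda>z. f z $ i) t"
  then have "((\<lambda>r. f (complex_of_real r * cis t)) \<longlongrightarrow> (\<chi> i. bv (\<lambda>z. f z $ i) t)) (at_left 1)"
    by (intro vec_tendstoI) (simp add: has_bv_def)
  then show "has_bv f t"
    using has_bvI by blast
qed

lemma bv_nth:
  fixes f :: "complex \<Rightarrow> 'a::metric_space^'n"
  assumes "has_bv f t"
  shows "bv (\<lambda>z. f z $ i) t = bv f t $ i"
  by (rule bv_eqI, rule tendsto_vec_nth) (use assms in \<open>simp add: has_bv_def\<close>)

lemma H2v_has_bv: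
  fixes f :: "complex \<Rightarrow> complex^'n"
  assumes "f \<in> H2v"
  shows "AE t in circ. has_bv f t"
proof -
  have "AE t in circ. \<forall>i\<in>(UNIV::'n set). has_bv (\<lambda>z. f z $ i) t"
    by (rule AE_finite_allI) (use H2_has_bv[OF H2vD[OF assms]] in auto)
  then show ?thesis
    by eventually_elim (simp add: has_bv_vec_iff)
qed

lemma bv_nth_measurable:
  fixes f :: "complex \<Rightarrow> complex^'n"
  assumes "\<And>i. (\<lambda>z. f z $ i) holomorphic_on ball 0 1"
  shows "(\<lambda>t. bv f t $ i) \<in> borel_measurable circ"
proof -
  have "continuous_on (ball 0 1) (\<lambda>z. \<chi> i. f z $ i)"
    by (intro continuous_on_vec_lambda holomorphic_on_imp_continuous_on assms)
  then have "bv f \<in> borel_measurable circ"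
    by (intro borel_imp_circ bv_measurable) simp
  then show ?thesis
    by (rule measurable_compose[OF _ borel_measurable_continuous_onI]) (intro continuous_intros)
qed

lemma bdd_hol_bv_le:
  assumes "\<And>z. z \<in> ball 0 1 \<Longrightarrow> cmod (m z) \<le> M" "has_bv m t"
  shows "cmod (bv m t) \<le> M"
proof (rule tendsto_upperbound)
  show "((\<lambda>r. cmod (m (complex_of_real r * cis t))) \<longlongrightarrow> cmod (bv m t)) (at_left 1)"
    using assms(2) unfolding has_bv_def by (rule tendsto_norm)
  show "\<forall>\<^sub>F r in at_left 1. cmod (m (complex_of_real r * cis t)) \<le> M"
    using eventually_at_left_1 by eventually_elim (auto intro: assms(1))
qed simp

lemma bdd_hol_has_bv: "bdd_hol m \<Longrightarrow> AE t in circ. has_bv m t"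
  by (rule H2_has_bv[OF bdd_hol_H2])

text \<open>The Poisson kernel at an arbitrary point \<open>z\<close> of the disc, again without the
  factor 1/(2*pi).\<close>

definition pz :: "complex \<Rightarrow> real \<Rightarrow> real" where
  "pz z t = (1 - (cmod z)\<^sup>2) / (cmod (1 - z * cnj (cis t)))\<^sup>2"

lemma pz_denom:
  assumes "cmod z < 1" shows "1 - cmod z \<le> cmod (1 - z * cnj (cis t))" "1 - z * cnj (cis t) \<noteq> 0"
proof -
  show "1 - cmod z \<le> cmod (1 - z * cnj (cis t))"
    using norm_triangle_ineq2[of 1 "z * cnj (cis t)"] by (simp add: norm_mult)
  then show "1 - z * cnj (cis t) \<noteq> 0"
    using assms by auto
qed

lemma pz_nonneg: "cmod z < 1 \<Longrightarrow> 0 \<le> pz z t"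
  by (simp add: pz_def abs_square_le_1)

lemma pz_bounded:
  assumes "cmod z < 1" shows "\<bar>pz z t\<bar> \<le> 1 / (1 - cmod z)\<^sup>2"
proof -
  have "(1 - cmod z)\<^sup>2 \<le> (cmod (1 - z * cnj (cis t)))\<^sup>2"
    using pz_denom(1)[OF assms] assms by (intro power_mono) auto
  moreover have "0 \<le> 1 - (cmod z)\<^sup>2" "1 - (cmod z)\<^sup>2 \<le> 1"
    using assms by (auto simp: abs_square_le_1)
  ultimately have "pz z t \<le> 1 / (1 - cmod z)\<^sup>2"
    unfolding pz_def using assms by (intro frac_le) auto
  then show ?thesis
    using pz_nonneg[OF assms, of t] by simp
qed

lemma pz_measurable [measurable]: "cmod z < 1 \<Longrightarrow> pz z \<in> borel_measurable circ"
  unfolding pz_def [abs_def]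
  by (intro borel_imp_circ borel_measurable_continuous_onI continuous_intros) (use pz_denom in auto)

text \<open>Cauchy's formula for the product of \<open>f\<close> with \<open>szk z\<close>, taken at
  \<open>z\<close>. The boundary values of \<open>szk z\<close> are conjugate to the Cauchy factor,
  so together they form the Poisson kernel up to the constant \<open>1 - cnj z * z\<close>.\<close>

lemma H2_poisson:
  assumes f: "f \<in> H2" and z: "cmod z < 1"
  shows "f z = (LINT t|circ. bv f t * pz z t) / (2 * pi)"
proof -
  define G where "G w = szk z w * f w" for w
  have G: "G \<in> H2"
    unfolding G_def [abs_def] by (rule H2_mult[OF bdd_hol_szk[OF z] f])
  have zz: "1 - cnj z * z \<noteq> 0"
  proof -
    have "cnj z * z = complex_of_real ((cmod z)\<^sup>2)"
      by (rule cnj_mult_self)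
    moreover have "(cmod z)\<^sup>2 < 1"
      using z by (simp add: power_less_one_iff)
    then have "(cmod z)\<^sup>2 \<noteq> 1"
      by simp
    ultimately show ?thesis
      by (metis eq_iff_diff_eq_0 of_real_1 of_real_eq_iff)
  qed
  have fz: "f z = (1 - cnj z * z) * G z"
    using zz by (simp add: G_def szk_def)
  have bG: "AE t in circ. bv G t = bv f t / (1 - cnj z * cis t)"
    using H2_has_bv[OF f] bdd_hol_has_bv[OF bdd_hol_szk[OF z]]
  proof eventually_elim
    case (elim t)
    have "bv (szk z) t = 1 / (1 - cnj z * (complex_of_real 1 * cis t))"
    proof (rule bv_eqI)
      have "1 - cnj z * (complex_of_real 1 * cis t) \<noteq> 0"
      proof
        assume "1 - cnj z * (complex_of_real 1 * cis t) = 0"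
        then have "cnj (1 - z * cnj (cis t)) = 0"
          by simp
        then show False
          using pz_denom(2)[OF z, of t] by (simp only: complex_cnj_zero_iff)
      qed
      then show "((\<lambda>r. szk z (complex_of_real r * cis t)) \<longlongrightarrow> 1 / (1 - cnj z * (complex_of_real 1 * cis t))) (at_left 1)"
        unfolding szk_def by (intro tendsto_intros)
    qed
    then show ?case
      using bv_mult(2)[OF elim(2,1)] by (simp add: G_def [abs_def])
  qed
  have "G z = (LINT t|circ. bv G t / (1 - z * cnj (cis t))) / (2 * pi)"
    using szego_bv[OF G z] by (simp add: szego_def set_LINT_circ)
  also have "(LINT t|circ. bv G t / (1 - z * cnj (cis t))) = (LINT t|circ. (bv f t / (1 - cnj z * cis t)) / (1 - z * cnj (cis t)))"
  proof (rule integral_cong_AE)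
    have c: "(\<lambda>t. 1 - cnj z * cis t) \<in> borel_measurable circ" "(\<lambda>t. 1 - z * cnj (cis t)) \<in> borel_measurable circ"
      by (intro borel_imp_circ borel_measurable_continuous_onI continuous_intros)+
    show "(\<lambda>t. bv G t / (1 - z * cnj (cis t))) \<in> borel_measurable circ"
      "(\<lambda>t. (bv f t / (1 - cnj z * cis t)) / (1 - z * cnj (cis t))) \<in> borel_measurable circ"
      by (intro borel_measurable_divide c H2_bv_measurable f G)+
    show "AE t in circ. bv G t / (1 - z * cnj (cis t)) = bv f t / (1 - cnj z * cis t) / (1 - z * cnj (cis t))"
      using bG by eventually_elim simp
  qed
  finally have "f z = (LINT t|circ. (1 - cnj z * z) * ((bv f t / (1 - cnj z * cis t)) / (1 - z * cnj (cis t)))) / (2 * pi)"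
    unfolding fz integral_mult_right_zero by simp
  also have "(\<lambda>t. (1 - cnj z * z) * ((bv f t / (1 - cnj z * cis t)) / (1 - z * cnj (cis t)))) = (\<lambda>t. bv f t * pz z t)"
  proof
    fix t
    have "complex_of_real (pz z t) = (1 - cnj z * z) / ((1 - z * cnj (cis t)) * cnj (1 - z * cnj (cis t)))"
      unfolding pz_def by (simp only: complex_norm_square [symmetric] cnj_mult_self of_real_divide of_real_diff of_real_1)
    then show "(1 - cnj z * z) * ((bv f t / (1 - cnj z * cis t)) / (1 - z * cnj (cis t))) = bv f t * pz z t"
      by (simp add: mult_ac)
  qed
  finally show ?thesis .
qed

lemma integral_pz:
  assumes "cmod z < 1"
  shows "(LINT t|circ. pz z t) = 2 * pi"
proof -
  have "complex_of_real 1 = (LINT t|circ. complex_of_real (pz z t)) / complex_of_real (2 * pi)"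
    using H2_poisson[OF H2_const[of 1] assms] by (simp add: bv_const)
  then have "complex_of_real (2 * pi) = complex_of_real (LINT t|circ. pz z t)"
    by (simp add: field_simps)
  then show ?thesis
    by (simp only: of_real_eq_iff)
qed

lemma integrable_pz_mult:
  fixes g :: "real \<Rightarrow> 'a::{real_normed_field,banach,second_countable_topology}"
  assumes "integrable circ g" "cmod z < 1"
  shows "integrable circ (\<lambda>t. g t * of_real (pz z t))"
proof (rule Bochner_Integration.integrable_bound)
  show "integrable circ (\<lambda>t. norm (g t) * (1 / (1 - cmod z)\<^sup>2))"
    using assms(1) by (intro integrable_mult_left integrable_norm)
  show "(\<lambda>t. g t * of_real (pz z t)) \<in> borel_measurable circ"
    using borel_measurable_integrable[OF assms(1)] pz_measurable[OF assms(2)] by measurable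
  show "AE t in circ. norm (g t * of_real (pz z t)) \<le> norm (norm (g t) * (1 / (1 - cmod z)\<^sup>2))"
  proof (rule AE_I2)
    fix t
    show "norm (g t * of_real (pz z t)) \<le> norm (norm (g t) * (1 / (1 - cmod z)\<^sup>2))"
      using mult_left_mono[OF pz_bounded[OF assms(2), of t] norm_ge_zero[of "g t"]] by (simp add: norm_mult)
  qed
qed

text \<open>A variance argument: the mean of |bv f - f z|^2 against the Poisson kernel is
  nonnegative, and by \<open>H2_poisson\<close> the mean of \<open>bv f\<close> is
  \<open>f z\<close>.\<close>

lemma H2_poisson_sq:
  assumes f: "f \<in> H2" and z: "cmod z < 1"
  shows "(cmod (f z))\<^sup>2 \<le> (LINT t|circ. (cmod (bv f t))\<^sup>2 * pz z t) / (2 * pi)"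
proof -
  note b = H2_bv_approx(1)[OF f]
  let ?S = "LINT t|circ. (cmod (bv f t))\<^sup>2 * pz z t"
  have i1: "integrable circ (\<lambda>t. (cmod (bv f t))\<^sup>2 * pz z t)"
    using integrable_pz_mult[OF sq_int_integrable_sq[OF b] z] by simp
  have i2: "integrable circ (\<lambda>t. bv f t * complex_of_real (pz z t))"
    by (rule integrable_pz_mult[OF sq_int_circ_integrable[OF b] z])
  have i3: "integrable circ (\<lambda>t. pz z t)"
    using integrable_pz_mult[where g = "\<lambda>_. 1::real", OF finite_measure.integrable_const[OF finite_measure_circ] z]
    by simp
  have P: "(LINT t|circ. bv f t * pz z t) = f z * (2 * pi)"
    using H2_poisson[OF f z] by simp
  have "0 \<le> (LINT t|circ. (cmod (bv f t - f z))\<^sup>2 * pz z t)"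
    using pz_nonneg[OF z] by simp
  also have "\<dots> = (LINT t|circ. (cmod (bv f t))\<^sup>2 * pz z t - 2 * Re (cnj (f z) * (bv f t * complex_of_real (pz z t))) + (cmod (f z))\<^sup>2 * pz z t)"
  proof (intro Bochner_Integration.integral_cong refl)
    fix t
    have "(cmod (a - b))\<^sup>2 * p = (cmod a)\<^sup>2 * p - 2 * Re (cnj b * (a * complex_of_real p)) + (cmod b)\<^sup>2 * p" for a b :: complex and p :: real
      unfolding cmod_power2 by (simp add: power2_eq_square algebra_simps)
    then show "(cmod (bv f t - f z))\<^sup>2 * pz z t = (cmod (bv f t))\<^sup>2 * pz z t - 2 * Re (cnj (f z) * (bv f t * complex_of_real (pz z t))) + (cmod (f z))\<^sup>2 * pz z t" .
  qed
  also have "\<dots> = ?S - 2 * Re (cnj (f z) * (f z * (2 * pi))) + (cmod (f z))\<^sup>2 * (2 * pi)"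
  proof -
    have h: "integrable circ (\<lambda>t. cnj (f z) * (bv f t * complex_of_real (pz z t)))"
      by (intro integrable_mult_right i2)
    have hv: "(LINT t|circ. Re (cnj (f z) * (bv f t * complex_of_real (pz z t)))) = Re (cnj (f z) * (f z * (2 * pi)))"
      unfolding integral_Re[OF h] integral_mult_right_zero P ..
    have i2': "integrable circ (\<lambda>t. 2 * Re (cnj (f z) * (bv f t * complex_of_real (pz z t))))"
      by (intro integrable_mult_right integrable_Re h)
    have i3': "integrable circ (\<lambda>t. (cmod (f z))\<^sup>2 * pz z t)"
      by (intro integrable_mult_right i3)
    show ?thesis
      unfolding Bochner_Integration.integral_add[OF Bochner_Integration.integrable_diff[OF i1 i2'] i3']
        Bochner_Integration.integral_diff[OF i1 i2'] integral_mult_right_zero hv integral_pz[OF z] ..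
  qed
  also have "Re (cnj (f z) * (f z * (2 * pi))) = (cmod (f z))\<^sup>2 * (2 * pi)"
    by (simp only: mult.assoc [symmetric] cnj_mult_self of_real_mult [symmetric] Re_complex_of_real)
  finally show ?thesis
    by (simp add: field_simps)
qed

text \<open>The Herglotz integral. With \<open>w = z * cnj (cis t)\<close> its kernel (1 + w)/(1 -
  w) is written as 2/(1 - w) - 1, which makes it a Cauchy integral minus a mean; its real part is
  the Poisson integral of \<open>g\<close>.\<close>

definition herg :: "(real \<Rightarrow> real) \<Rightarrow> complex \<Rightarrow> complex" where
  "herg g z = 2 * szego (\<lambda>t. complex_of_real (g t)) z - (LINT t|circ. g t) / (2 * pi)"

lemma herg_holomorphic:
  assumes "integrable circ g"
  shows "herg g holomorphic_on ball 0 1"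
proof -
  have "szego (\<lambda>t. complex_of_real (g t)) holomorphic_on ball 0 1"
    by (rule tc_eqI(1)[OF szego_sums]) (use assms in auto)
  then show ?thesis
    unfolding herg_def [abs_def] by (intro holomorphic_intros)
qed

lemma szego_integrable:
  assumes g: "integrable circ g" and z: "cmod z < 1"
  shows "integrable circ (\<lambda>t. g t / (1 - z * cnj (cis t)))"
proof (rule Bochner_Integration.integrable_bound)
  show "integrable circ (\<lambda>t. norm (g t) * (1 / (1 - cmod z)))"
    using g by (intro integrable_mult_left integrable_norm)
  have "(\<lambda>t. 1 - z * cnj (cis t)) \<in> borel_measurable circ"
    by (intro borel_imp_circ borel_measurable_continuous_onI continuous_intros)
  then show "(\<lambda>t. g t / (1 - z * cnj (cis t))) \<in> borel_measurable circ"
    using borel_measurable_integrable[OF g] by (intro borel_measurable_divide)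
  have "norm (g t / (1 - z * cnj (cis t))) \<le> norm (norm (g t) * (1 / (1 - cmod z)))" for t
    using pz_denom[OF z, of t] z by (simp add: norm_divide frac_le)
  then show "AE t in circ. norm (g t / (1 - z * cnj (cis t))) \<le> norm (norm (g t) * (1 / (1 - cmod z)))"
    by simp
qed

lemma Re_herg:
  assumes g: "integrable circ g" and z: "cmod z < 1"
  shows "Re (herg g z) = (LINT t|circ. g t * pz z t) / (2 * pi)"
proof -
  have gi: "integrable circ (\<lambda>t. complex_of_real (g t))"
    using g by simp
  have pt: "2 * Re (complex_of_real x / (1 - z * cnj (cis t))) - x = x * pz z t" for t x
  proof -
    define w where "w = z * cnj (cis t)"
    have w: "cmod w = cmod z" by (simp add: w_def norm_mult)
    have nz: "1 - w \<noteq> 0" using pz_denom(2)[OF z] by (simp add: w_def)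
    have "2 * Re (complex_of_real x / (1 - w)) - x = x * (2 * Re (1 - w) / (cmod (1 - w))\<^sup>2 - 1)"
      by (simp add: Re_divide' algebra_simps)
    also have "2 * Re (1 - w) / (cmod (1 - w))\<^sup>2 - 1 = (1 - (cmod w)\<^sup>2) / (cmod (1 - w))\<^sup>2"
    proof -
      have "2 * Re (1 - w) - (cmod (1 - w))\<^sup>2 = 1 - (cmod w)\<^sup>2"
        unfolding cmod_power2 by (simp add: power2_eq_square algebra_simps)
      then show ?thesis
        using nz by (simp add: field_simps)
    qed
    finally show ?thesis
      unfolding pz_def w by (simp add: w_def)
  qed
  have "Re (herg g z) = (2 * Re (LINT t|circ. complex_of_real (g t) / (1 - z * cnj (cis t))) - (LINT t|circ. g t)) / (2 * pi)"
    by (simp add: herg_def szego_def set_LINT_circ Re_divide_of_real diff_divide_distrib)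
  also have "Re (LINT t|circ. complex_of_real (g t) / (1 - z * cnj (cis t))) = (LINT t|circ. Re (complex_of_real (g t) / (1 - z * cnj (cis t))))"
    by (rule integral_Re [symmetric], rule szego_integrable[OF gi z])
  also have "2 * (LINT t|circ. Re (complex_of_real (g t) / (1 - z * cnj (cis t)))) - (LINT t|circ. g t) =
      (LINT t|circ. 2 * Re (complex_of_real (g t) / (1 - z * cnj (cis t))) - g t)"
    using integrable_Re[OF szego_integrable[OF gi z]] g by simp
  also have "\<dots> = (LINT t|circ. g t * pz z t)"
    by (simp only: pt)
  finally show ?thesis .
qed

text \<open>At a fixed point \<open>z\<close> the bound tends to 0 with the integral of
  \<open>g\<close>; this is what sends the bounding multipliers to 1.\<close>

lemma norm_herg_le:
  assumes g: "integrable circ g" "\<And>t. 0 \<le> g t" and z: "cmod z < 1"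
  shows "cmod (herg g z) \<le> (2 / (1 - cmod z) + 1) * (LINT t|circ. g t) / (2 * pi)"
proof -
  let ?I = "LINT t|circ. g t"
  have gi: "integrable circ (\<lambda>t. complex_of_real (g t))"
    using g by simp
  have I0: "0 \<le> ?I"
    using g(2) by simp
  have "cmod (LINT t|circ. complex_of_real (g t) / (1 - z * cnj (cis t))) \<le> (LINT t|circ. cmod (complex_of_real (g t) / (1 - z * cnj (cis t))))"
    by (rule integral_norm_bound)
  also have "\<dots> \<le> (LINT t|circ. g t * (1 / (1 - cmod z)))"
  proof (rule integral_mono)
    show "integrable circ (\<lambda>t. cmod (complex_of_real (g t) / (1 - z * cnj (cis t))))"
      by (intro integrable_norm szego_integrable[OF gi z])
    show "integrable circ (\<lambda>t. g t * (1 / (1 - cmod z)))"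
      using g(1) by (rule integrable_mult_left)
    show "cmod (complex_of_real (g t) / (1 - z * cnj (cis t))) \<le> g t * (1 / (1 - cmod z))" for t
      using pz_denom[OF z, of t] z g(2)[of t] by (simp add: norm_divide frac_le)
  qed
  also have "\<dots> = ?I / (1 - cmod z)"
    by simp
  finally have "cmod (szego (\<lambda>t. complex_of_real (g t)) z) \<le> ?I / (1 - cmod z) / (2 * pi)"
    using divide_right_mono[of _ "?I / (1 - cmod z)" "2 * pi"] by (simp add: szego_def set_LINT_circ norm_divide)
  moreover have "cmod (herg g z) \<le> 2 * cmod (szego (\<lambda>t. complex_of_real (g t)) z) + ?I / (2 * pi)"
    unfolding herg_def using norm_triangle_ineq4[of "2 * szego (\<lambda>t. complex_of_real (g t)) z" "complex_of_real (?I / (2 * pi))"] I0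
    by (simp add: norm_mult norm_divide)
  moreover have "2 * (?I / (1 - cmod z) / (2 * pi)) + ?I / (2 * pi) = (2 / (1 - cmod z) + 1) * ?I / (2 * pi)"
    by (simp add: distrib_right add_divide_distrib)
  ultimately show ?thesis
    by linarith
qed

section \<open>Outer matrix functions\<close>

text \<open>Cramer's numerator: column \<open>i\<close> of the matrix is replaced by the
  \<open>j\<close>-th unit vector. Being a polynomial in the entries, it stays bounded and
  holomorphic, unlike the inverse matrix itself.\<close>

definition cof :: "complex^'n^'n \<Rightarrow> 'n \<Rightarrow> 'n \<Rightarrow> complex" where
  "cof A i j = det (\<chi> k l. if l = i then (if k = j then 1 else 0) else A $ k $ l)"

lemma matrix_inv_mult:
  fixes A :: "complex^'n^'n"
  assumes "det A \<noteq> 0"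
  shows "A ** matrix_inv A = mat 1" "matrix_inv A ** A = mat 1"
proof -
  have "\<exists>B. A ** B = mat 1 \<and> B ** A = mat 1"
    using assms by (simp add: invertible_det_nz [symmetric] invertible_def)
  then have "A ** matrix_inv A = mat 1 \<and> matrix_inv A ** A = mat 1"
    unfolding matrix_inv_def by (rule someI_ex)
  then show "A ** matrix_inv A = mat 1" "matrix_inv A ** A = mat 1"
    by auto
qed

lemma matrix_inv_cof:
  fixes A :: "complex^'n^'n"
  assumes "det A \<noteq> 0"
  shows "matrix_inv A $ i $ j * det A = cof A i j"
proof -
  let ?x = "matrix_inv A *v axis j 1"
  have e: "A *v ?x = axis j 1"
    by (simp add: matrix_vector_mul_assoc matrix_inv_mult[OF assms])
  have "(\<chi> k l. if l = i then axis j 1 $ k else A $ k $ l) = (\<chi> k l. if l = i then (if k = j then 1 else 0) else A $ k $ l)"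
    by (simp add: vec_eq_iff axis_def)
  then have "cof A i j = ?x $ i * det A"
    using cramer_lemma[of i A ?x] unfolding e by (simp add: cof_def)
  moreover have "?x $ i = matrix_inv A $ i $ j"
    by (simp add: matrix_vector_mult_def axis_def if_distrib [of "\<lambda>x. _ * x"] cong: if_cong)
  ultimately show ?thesis
    by simp
qed

lemma bdd_hol_cof:
  fixes A :: "complex \<Rightarrow> complex^'n^'n"
  assumes "\<And>i j. bdd_hol (\<lambda>z. A z $ i $ j)"
  shows "bdd_hol (\<lambda>z. cof (A z) i j)"
  unfolding cof_def
proof (rule bdd_hol_det)
  show "bdd_hol (\<lambda>z. (\<chi> k l. if l = i then if k = j then 1 else 0 else A z $ k $ l) $ k' $ l')" for k' l'
    using assms[of k' l'] by (cases "l' = i"; cases "k' = j") (simp_all add: bdd_hol_const)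
qed

lemma det_bound:
  fixes M :: "complex^'n^'n"
  assumes "\<And>i j. cmod (M $ i $ j) \<le> c"
  shows "cmod (det M) \<le> fact CARD('n) * c ^ CARD('n)"
proof -
  have "cmod (det M) \<le> (\<Sum>p\<in>{p. p permutes (UNIV::'n set)}. cmod (of_int (sign p) * (\<Prod>i\<in>UNIV. M $ i $ p i)))"
    unfolding det_def by (rule norm_sum)
  also have "\<dots> \<le> (\<Sum>p\<in>{p. p permutes (UNIV::'n set)}. c ^ CARD('n))"
  proof (rule sum_mono)
    fix p :: "'n \<Rightarrow> 'n"
    have "cmod (of_int (sign p) * (\<Prod>i\<in>UNIV. M $ i $ p i)) = (\<Prod>i\<in>UNIV. cmod (M $ i $ p i))"
      by (simp add: norm_mult prod_norm [symmetric] sign_def)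
    also have "\<dots> \<le> (\<Prod>i\<in>(UNIV::'n set). c)"
      by (rule prod_mono) (use assms in auto)
    finally show "cmod (of_int (sign p) * (\<Prod>i\<in>UNIV. M $ i $ p i)) \<le> c ^ CARD('n)"
      by simp
  qed
  also have "\<dots> = fact CARD('n) * c ^ CARD('n)"
    by (simp add: card_permutations[OF refl])
  finally show ?thesis .
qed

lemma det_tendsto:
  fixes M :: "nat \<Rightarrow> complex^'n^'n"
  assumes "\<And>i j. (\<lambda>k. M k $ i $ j) \<longlonglongrightarrow> L $ i $ j"
  shows "(\<lambda>k. det (M k)) \<longlonglongrightarrow> det L"
  unfolding det_def by (intro tendsto_intros assms)

lemma det_scale:
  fixes M :: "complex^'n^'n"
  shows "det (\<chi> i j. c * M $ i $ j) = c ^ CARD('n) * det M"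
proof -
  have "det (\<chi> i j. c * M $ i $ j) = (\<Sum>p\<in>{p. p permutes (UNIV::'n set)}. c ^ CARD('n) * (of_int (sign p) * (\<Prod>i\<in>UNIV. M $ i $ p i)))"
    unfolding det_def by (simp add: prod.distrib mult_ac)
  then show ?thesis
    by (simp add: det_def sum_distrib_left)
qed

lemma H2_norm_sq_circ: "(LINT t|circ. (cmod (bv f t))\<^sup>2) = 2 * pi * (H2_norm f)\<^sup>2"
  by (simp add: H2_norm_def set_LINT_circ)

text \<open>Origin of the entry bound 2: an entry at distance \<open>x\<close> from that of the
  identity has modulus at most \<open>1 + x\<close>, while the multiplier is at most exp(-x^2)
  there.\<close>

lemma one_plus_exp_bound:
  fixes x :: real
  shows "(1 + x) * exp (- (x\<^sup>2)) \<le> 2"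
proof -
  have x: "2 * x \<le> x\<^sup>2 + 1"
    using sum_squares_bound[of x 1] by simp
  have "1 + x \<le> 2 * (1 + q)" if "2 * x \<le> q + 1" "0 \<le> q" for q
    using that by (simp add: field_simps)
  from this[OF x zero_le_power2] have "1 + x \<le> 2 * (1 + x\<^sup>2)" .
  also have "\<dots> \<le> 2 * exp (x\<^sup>2)"
    by (rule mult_left_mono[OF exp_ge_add_one_self]) simp
  finally have "(1 + x) * exp (- (x\<^sup>2)) \<le> 2 * exp (x\<^sup>2) * exp (- (x\<^sup>2))"
    by (intro mult_right_mono) auto
  then show ?thesis
    by (simp add: mult.assoc exp_minus)
qed

text \<open>A scalar multiplier making an analytic matrix function close to the identity bounded: its modulus
  is the exponential of minus the Poisson integral of the squared boundary distance to the identity,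
  which dominates the squared distance inside the disc.\<close>

lemma bounding_multiplier:
  fixes F :: "complex \<Rightarrow> complex^'n^'n"
  assumes F: "\<And>i j. (\<lambda>z. F z $ i $ j - mat 1 $ i $ j) \<in> H2"
    and e: "\<And>i j. H2_norm (\<lambda>z. F z $ i $ j - mat 1 $ i $ j) \<le> e"
  obtains h where "bdd_hol h" "\<And>z i j. cmod z < 1 \<Longrightarrow> cmod (h z * F z $ i $ j) \<le> 2"
    "\<And>z. cmod z < 1 \<Longrightarrow> \<exists>u. h z = exp (- u) \<and> cmod u \<le> (2 / (1 - cmod z) + 1) * (real (CARD('n) * CARD('n)) * e\<^sup>2)"
    "\<And>z i j. cmod z < 1 \<Longrightarrow> (cmod (F z $ i $ j - mat 1 $ i $ j))\<^sup>2 \<le> (2 / (1 - cmod z) + 1) * (real (CARD('n) * CARD('n)) * e\<^sup>2)"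
proof -
  define D where "D i j z = F z $ i $ j - mat 1 $ i $ j" for i j z
  have D: "D i j \<in> H2" "H2_norm (D i j) \<le> e" for i j
    using F e by (simp_all add: D_def [abs_def])
  define g where "g t = (\<Sum>i\<in>UNIV. \<Sum>j\<in>UNIV. (cmod (bv (D i j) t))\<^sup>2)" for t
  have gi: "integrable circ g"
    unfolding g_def [abs_def] by (intro Bochner_Integration.integrable_sum sq_int_integrable_sq H2_bv_approx(1) D)
  have g0: "0 \<le> g t" for t
    unfolding g_def by (intro sum_nonneg) auto
  have gI: "(LINT t|circ. g t) \<le> 2 * pi * (real (CARD('n) * CARD('n)) * e\<^sup>2)"
  proof -
    have "(LINT t|circ. g t) = (\<Sum>i\<in>UNIV. \<Sum>j\<in>UNIV. (LINT t|circ. (cmod (bv (D i j) t))\<^sup>2))"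
      unfolding g_def
      by (subst Bochner_Integration.integral_sum, intro Bochner_Integration.integrable_sum sq_int_integrable_sq H2_bv_approx(1) D,
          intro sum.cong refl Bochner_Integration.integral_sum sq_int_integrable_sq H2_bv_approx(1) D)
    also have "\<dots> \<le> (\<Sum>i\<in>(UNIV::'n set). \<Sum>j\<in>(UNIV::'n set). 2 * pi * e\<^sup>2)"
      unfolding H2_norm_sq_circ using D(2) by (intro sum_mono mult_left_mono power_mono H2_norm_nonneg) auto
    also have "\<dots> = 2 * pi * (real (CARD('n) * CARD('n)) * e\<^sup>2)"
      by simp
    finally show ?thesis .
  qed
  define h where "h z = exp (- herg g z)" for z
  let ?K = "\<lambda>z. (2 / (1 - cmod z) + 1) * (real (CARD('n) * CARD('n)) * e\<^sup>2)"
  have hK: "cmod (herg g z) \<le> ?K z" if "cmod z < 1" for z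
  proof -
    have "cmod (herg g z) \<le> (2 / (1 - cmod z) + 1) * (LINT t|circ. g t) / (2 * pi)"
      by (rule norm_herg_le[OF gi g0 that])
    also have "\<dots> \<le> (2 / (1 - cmod z) + 1) * (2 * pi * (real (CARD('n) * CARD('n)) * e\<^sup>2)) / (2 * pi)"
      using that gI by (intro divide_right_mono mult_left_mono) auto
    also have "\<dots> = ?K z"
      by simp
    finally show ?thesis .
  qed
  have DRe: "(cmod (D i j z))\<^sup>2 \<le> Re (herg g z)" if z: "cmod z < 1" for i j z
  proof -
    have "(cmod (D i j z))\<^sup>2 \<le> (LINT t|circ. (cmod (bv (D i j) t))\<^sup>2 * pz z t) / (2 * pi)"
      by (rule H2_poisson_sq[OF D(1) z])
    also have "(LINT t|circ. (cmod (bv (D i j) t))\<^sup>2 * pz z t) \<le> (LINT t|circ. g t * pz z t)"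
    proof (rule integral_mono)
      show "integrable circ (\<lambda>t. (cmod (bv (D i j) t))\<^sup>2 * pz z t)"
        using integrable_pz_mult[OF sq_int_integrable_sq[OF H2_bv_approx(1)[OF D(1)]] z] by simp
      show "integrable circ (\<lambda>t. g t * pz z t)"
        using integrable_pz_mult[OF gi z] by simp
      fix t
      have "(cmod (bv (D i j) t))\<^sup>2 \<le> (\<Sum>j\<in>UNIV. (cmod (bv (D i j) t))\<^sup>2)"
        by (rule member_le_sum) auto
      also have "\<dots> \<le> g t"
        unfolding g_def by (rule member_le_sum[of i UNIV "\<lambda>i. \<Sum>j\<in>UNIV. (cmod (bv (D i j) t))\<^sup>2"]) (auto intro: sum_nonneg)
      finally show "(cmod (bv (D i j) t))\<^sup>2 * pz z t \<le> g t * pz z t"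
        using pz_nonneg[OF z] by (rule mult_right_mono)
    qed
    finally show ?thesis
      unfolding Re_herg[OF gi z] by (simp add: divide_right_mono)
  qed
  have hn: "cmod (h z) = exp (- Re (herg g z))" for z
    by (simp add: h_def)
  show thesis
  proof (rule that[of h])
    have "cmod (h z) \<le> 1" if "z \<in> ball 0 1" for z
      \<comment> \<open>Any entry will do, since only nonnegativity of the real part is
        wanted.\<close>
      using DRe[of z undefined undefined] that unfolding hn by (simp add: order_trans[OF zero_le_power2])
    moreover have "h holomorphic_on ball 0 1"
      unfolding h_def [abs_def] by (intro holomorphic_intros herg_holomorphic gi)
    ultimately show "bdd_hol h"
      unfolding bdd_hol_def by blast
    fix z :: complex assume z: "cmod z < 1"
    show "cmod (h z * F z $ i $ j) \<le> 2" for i j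
    proof -
      have "cmod (F z $ i $ j) \<le> 1 + cmod (D i j z)"
        using norm_triangle_ineq[of "mat 1 $ i $ j :: complex" "D i j z"] by (auto simp: D_def mat_def split: if_splits)
      moreover have "cmod (h z) \<le> exp (- ((cmod (D i j z))\<^sup>2))"
        unfolding hn using DRe[OF z] by simp
      ultimately have "cmod (h z * F z $ i $ j) \<le> exp (- ((cmod (D i j z))\<^sup>2)) * (1 + cmod (D i j z))"
        unfolding norm_mult by (intro mult_mono) auto
      also have "\<dots> \<le> 2"
        using one_plus_exp_bound[of "cmod (D i j z)"] by (simp add: mult.commute)
      finally show ?thesis .
    qed
    show "\<exists>u. h z = exp (- u) \<and> cmod u \<le> ?K z"
      using hK[OF z] h_def by blast
    show "(cmod (F z $ i $ j - mat 1 $ i $ j))\<^sup>2 \<le> ?K z" for i j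
      using DRe[OF z, of i j] hK[OF z] complex_Re_le_cmod[of "herg g z"] by (simp add: D_def)
  qed
qed

section \<open>Multipliers and division for outer matrix functions\<close>

lemma outer_mat_bdd_hol:
  assumes "outer_mat A"
  shows "bdd_hol (\<lambda>z. A z $ i $ j)"
proof -
  obtain M where M: "\<And>z. z \<in> ball 0 1 \<Longrightarrow> norm (A z) \<le> M"
    using assms unfolding outer_mat_def by blast
  have "cmod (A z $ i $ j) \<le> M" if "z \<in> ball 0 1" for z
    using Finite_Cartesian_Product.norm_nth_le[of "A z $ i" j]
      Finite_Cartesian_Product.norm_nth_le[of "A z" i] M[OF that] by linarith
  then show ?thesis
    using assms unfolding bdd_hol_def outer_mat_def by blast
qed

lemma mat_mult_H2v:
  fixes A :: "complex \<Rightarrow> complex^'n^'m"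
  assumes "\<And>i j. bdd_hol (\<lambda>z. A z $ i $ j)" "f \<in> H2v"
  shows "(\<lambda>z. A z *v f z) \<in> H2v"
  by (rule H2vI) (simp add: matrix_vector_mult_def H2_sum H2_mult assms H2vD)

lemma poly_bdd_hol: "bdd_hol (\<lambda>z. (\<Sum>k\<le>N. z ^ k *s c k) $ i)"
  by (simp add: sum_component) (intro bdd_hol_sum bdd_hol_mult bdd_hol_const bdd_hol_power bdd_hol_ident)

text \<open>\<open>Q k\<close> has polynomial columns that \<open>A\<close> maps near the unit
  vectors in H^2, and \<open>h k\<close> makes the entries of \<open>h A Q\<close> at most 2. The
  determinant is multiplicative, so that of \<open>h A Q\<close> is \<open>det A\<close> times a
  bounded holomorphic \<open>q k\<close>; Leibniz's formula bounds it by the stated constant. At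
  each point \<open>A Q\<close> tends to the identity and \<open>h\<close> to 1.\<close>

lemma outer_mat_multipliers:
  fixes A :: "complex \<Rightarrow> complex^'n^'n"
  assumes A: "outer_mat A"
  obtains q :: "nat \<Rightarrow> complex \<Rightarrow> complex" where "\<And>k. bdd_hol (q k)"
    "\<And>k z. cmod z < 1 \<Longrightarrow> cmod (q k z * det (A z)) \<le> fact CARD('n) * 2 ^ CARD('n)"
    "\<And>z. cmod z < 1 \<Longrightarrow> (\<lambda>k. q k z * det (A z)) \<longlonglongrightarrow> 1"
proof -
  define e where "e k = 1 / (real k + 1)" for k :: nat
  have e0: "0 < e k" for k by (simp add: e_def)
  have ab: "bdd_hol (\<lambda>z. A z $ i $ j)" for i j
    by (rule outer_mat_bdd_hol[OF A])
  have ex: "\<exists>Q::complex \<Rightarrow> complex^'n^'n. (\<forall>i j. bdd_hol (\<lambda>z. Q z $ i $ j)) \<and>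
      (\<forall>i j. H2_norm (\<lambda>z. (A z ** Q z) $ i $ j - mat 1 $ i $ j) \<le> e k)" for k
  proof -
    have "\<exists>p. (\<forall>i. bdd_hol (\<lambda>z. p z $ i)) \<and> H2v_norm (\<lambda>z. A z *v p z - axis j 1) < e k" for j :: 'n
    proof -
      have "(\<lambda>z. axis j 1 :: complex^'n) \<in> H2v"
        by (intro H2vI H2_const)
      then obtain f where "f \<in> {(\<lambda>z. A z *v (\<Sum>k\<le>N. (z ^ k) *s c k)) | N c. True}"
        and f: "H2v_norm (\<lambda>z. f z - axis j 1) < e k"
        using A e0[of k] unfolding outer_mat_def dense_in_H2v_def by meson
      then obtain N c where "f = (\<lambda>z. A z *v (\<Sum>k\<le>N. (z ^ k) *s c k))"
        by blast
      with f show ?thesis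
        by (intro exI[of _ "\<lambda>z. \<Sum>k\<le>N. (z ^ k) *s c k"]) (simp only: poly_bdd_hol simp_thms)
    qed
    then have "\<exists>p. \<forall>j. (\<forall>i. bdd_hol (\<lambda>z. p j z $ i)) \<and> H2v_norm (\<lambda>z. A z *v p j z - axis j 1) < e k"
      by (rule choice[OF allI])
    then obtain p where p: "bdd_hol (\<lambda>z. p j z $ i)"
      "H2v_norm (\<lambda>z. A z *v p j z - axis j 1) < e k" for j i
      by blast
    define Q where "Q z = (\<chi> i j. p j z $ i)" for z
    have eq: "(A z ** Q z) $ i $ j - mat 1 $ i $ j = (A z *v p j z - axis j 1) $ i" for z i j
      by (simp add: Q_def matrix_matrix_mult_def matrix_vector_mult_def mat_def axis_def)
    have "H2_norm (\<lambda>z. (A z ** Q z) $ i $ j - mat 1 $ i $ j) \<le> e k" for i j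
      unfolding eq using H2_comp_norm_le[where f = "\<lambda>z. A z *v p j z - axis j 1" and i = i] p(2)[of j] by linarith
    moreover have "bdd_hol (\<lambda>z. Q z $ i $ j)" for i j
      by (simp add: Q_def p(1))
    ultimately show ?thesis by blast
  qed
  have "\<exists>Q::nat \<Rightarrow> complex \<Rightarrow> complex^'n^'n. \<forall>k. (\<forall>i j. bdd_hol (\<lambda>z. Q k z $ i $ j)) \<and>
      (\<forall>i j. H2_norm (\<lambda>z. (A z ** Q k z) $ i $ j - mat 1 $ i $ j) \<le> e k)"
    by (rule choice[OF allI[OF ex]])
  then obtain Q :: "nat \<Rightarrow> complex \<Rightarrow> complex^'n^'n" where Q: "bdd_hol (\<lambda>z. Q k z $ i $ j)"
    "H2_norm (\<lambda>z. (A z ** Q k z) $ i $ j - mat 1 $ i $ j) \<le> e k" for k i j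
    by blast
  have FH: "(\<lambda>z. (A z ** Q k z) $ i $ j - mat 1 $ i $ j) \<in> H2" for k i j
    by (intro H2_diff H2_const bdd_hol_H2)
      (simp add: matrix_matrix_mult_def, intro bdd_hol_sum bdd_hol_mult ab Q(1))
  let ?K = "\<lambda>k z. (2 / (1 - cmod z) + 1) * (real (CARD('n) * CARD('n)) * (e k)\<^sup>2)"
  have "\<exists>h. bdd_hol h \<and> (\<forall>z i j. cmod z < 1 \<longrightarrow> cmod (h z * (A z ** Q k z) $ i $ j) \<le> 2) \<and>
      (\<forall>z. cmod z < 1 \<longrightarrow> (\<exists>u. h z = exp (- u) \<and> cmod u \<le> ?K k z)) \<and>
      (\<forall>z i j. cmod z < 1 \<longrightarrow> (cmod ((A z ** Q k z) $ i $ j - mat 1 $ i $ j))\<^sup>2 \<le> ?K k z)" for k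
    by (rule bounding_multiplier[OF FH Q(2), of k]) blast
  then have "\<exists>h. \<forall>k. bdd_hol (h k) \<and> (\<forall>z i j. cmod z < 1 \<longrightarrow> cmod (h k z * (A z ** Q k z) $ i $ j) \<le> 2) \<and>
      (\<forall>z. cmod z < 1 \<longrightarrow> (\<exists>u. h k z = exp (- u) \<and> cmod u \<le> ?K k z)) \<and>
      (\<forall>z i j. cmod z < 1 \<longrightarrow> (cmod ((A z ** Q k z) $ i $ j - mat 1 $ i $ j))\<^sup>2 \<le> ?K k z)"
    by (rule choice[OF allI])
  then obtain h where h: "\<And>k. bdd_hol (h k)"
    "\<And>k z i j. cmod z < 1 \<Longrightarrow> cmod (h k z * (A z ** Q k z) $ i $ j) \<le> 2"
    "\<And>k z. cmod z < 1 \<Longrightarrow> \<exists>u. h k z = exp (- u) \<and> cmod u \<le> ?K k z"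
    "\<And>k z i j. cmod z < 1 \<Longrightarrow> (cmod ((A z ** Q k z) $ i $ j - mat 1 $ i $ j))\<^sup>2 \<le> ?K k z"
    by blast
  have K0: "(\<lambda>k. ?K k z) \<longlonglongrightarrow> 0" for z
  proof -
    have "e \<longlonglongrightarrow> 0"
      unfolding e_def by real_asymp
    then have "(\<lambda>k. ?K k z) \<longlonglongrightarrow> (2 / (1 - cmod z) + 1) * (real (CARD('n) * CARD('n)) * 0\<^sup>2)"
      by (intro tendsto_mult tendsto_const tendsto_power)
    then show ?thesis by simp
  qed
  define q where "q k z = h k z ^ CARD('n) * det (Q k z)" for k z
  have qd: "q k z * det (A z) = det (\<chi> i j. h k z * (A z ** Q k z) $ i $ j)" for k z
    unfolding det_scale det_mul by (simp add: q_def)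
  show thesis
  proof (rule that[of q])
    show "bdd_hol (q k)" for k
      unfolding q_def [abs_def] by (intro bdd_hol_mult bdd_hol_power h(1) bdd_hol_det Q(1))
    show "cmod (q k z * det (A z)) \<le> fact CARD('n) * 2 ^ CARD('n)" if "cmod z < 1" for k z
      unfolding qd by (rule det_bound) (use h(2)[OF that] in simp)
    show "(\<lambda>k. q k z * det (A z)) \<longlonglongrightarrow> 1" if z: "cmod z < 1" for z
    proof -
      \<comment> \<open>The multiplier is known only as the exponential of a small number; a choice
        of these exponents for all \<open>k\<close> shows that it tends to 1.\<close>
      have "\<exists>u. \<forall>k. h k z = exp (- u k) \<and> cmod (u k) \<le> ?K k z"
        by (rule choice[OF allI[OF h(3)[OF z]]])
      then obtain u where u: "\<And>k. h k z = exp (- u k)" "\<And>k. cmod (u k) \<le> ?K k z"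
        by blast
      have "u \<longlonglongrightarrow> 0"
      proof (rule Lim_null_comparison[OF _ K0[of z]])
        show "\<forall>\<^sub>F k in sequentially. cmod (u k) \<le> ?K k z"
          by (intro always_eventually allI u(2))
      qed
      then have "(\<lambda>k. exp (- u k)) \<longlonglongrightarrow> exp (- 0)"
        by (intro tendsto_intros)
      then have hl: "(\<lambda>k. h k z) \<longlonglongrightarrow> 1"
        by (simp add: u(1))
      have Fl: "(\<lambda>k. (A z ** Q k z) $ i $ j) \<longlonglongrightarrow> mat 1 $ i $ j" for i j
      proof -
        have "cmod ((A z ** Q k z) $ i $ j - mat 1 $ i $ j) \<le> sqrt (?K k z)" for k
          using h(4)[OF z, of k i j] by (rule real_le_rsqrt)
        then have ev: "\<forall>\<^sub>F k in sequentially. cmod ((A z ** Q k z) $ i $ j - mat 1 $ i $ j) \<le> sqrt (?K k z)"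
          by (intro always_eventually allI)
        have "(\<lambda>k. sqrt (?K k z)) \<longlonglongrightarrow> sqrt 0"
          by (rule tendsto_real_sqrt[OF K0[of z]])
        then have "(\<lambda>k. sqrt (?K k z)) \<longlonglongrightarrow> 0"
          by (simp only: real_sqrt_zero)
        with ev have "(\<lambda>k. (A z ** Q k z) $ i $ j - mat 1 $ i $ j) \<longlonglongrightarrow> 0"
          by (rule Lim_null_comparison)
        then show ?thesis
          by (rule LIM_zero_cancel)
      qed
      have "(\<lambda>k. det (\<chi> i j. h k z * (A z ** Q k z) $ i $ j)) \<longlonglongrightarrow> det (mat 1 :: complex^'n^'n)"
      proof (rule det_tendsto)
        fix i j :: 'n
        show "(\<lambda>k. (\<chi> i j. h k z * (A z ** Q k z) $ i $ j) $ i $ j) \<longlonglongrightarrow> (mat 1 :: complex^'n^'n) $ i $ j"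
          using tendsto_mult[OF hl Fl[of i j]] by simp
      qed
      then show ?thesis
        by (simp add: qd)
    qed
  qed
qed

text \<open>At a zero of the determinant the products \<open>q k z * det (A z)\<close> would all
  vanish, although they tend to 1.\<close>

lemma outer_mat_det_nz:
  assumes "outer_mat A" "cmod z < 1"
  shows "det (A z) \<noteq> 0"
proof
  assume z: "det (A z) = 0"
  obtain q where "(\<lambda>k. q k z * det (A z)) \<longlonglongrightarrow> 1"
    using outer_mat_multipliers[OF assms(1)] assms(2) by metis
  then show False
    by (simp add: z LIMSEQ_const_iff)
qed

text \<open>Fatou's lemma on each circle of radius \<open>r < 1\<close>, where the mean squares of
  \<open>V k\<close> are at most the squared H^2 norm by comparison of coefficients. Boundary values
  of the limit do not enter.\<close>

lemma H2_from_bounded_limit: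
  assumes V: "\<And>k. V k \<in> H2" and lim: "\<And>z. cmod z < 1 \<Longrightarrow> (\<lambda>k. V k z) \<longlonglongrightarrow> W z"
    and bd: "\<And>k. (H2_norm (V k))\<^sup>2 \<le> C" and W: "W holomorphic_on ball 0 1"
  shows "W \<in> H2"
proof -
  have "(LINT t|circ. (cmod (W (complex_of_real r * cis t)))\<^sup>2) \<le> 2 * pi * C" if r: "0 \<le> r" "r < 1" for r
  proof (rule L2_fatou(2))
    show "sq_int circ (\<lambda>t. V k (complex_of_real r * cis t))" for k
      by (rule circle_series(1)[OF H2_tc_sums[OF V] r])
    show "(\<lambda>t. W (complex_of_real r * cis t)) \<in> borel_measurable circ"
      by (rule sq_int_measurable[OF circle_series(1)[OF tc_sums[OF W] r]])
    show "AE t in circ. (\<lambda>k. V k (complex_of_real r * cis t)) \<longlonglongrightarrow> W (complex_of_real r * cis t)"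
      using r by (intro AE_I2 lim) simp
    show "(LINT t|circ. (cmod (V k (complex_of_real r * cis t)))\<^sup>2) \<le> 2 * pi * C" for k
    proof -
      have "(cmod (tc (V k) n))\<^sup>2 * r ^ (2 * n) \<le> (cmod (tc (V k) n))\<^sup>2" for n
        using r by (simp add: mult_left_le power_le_one)
      from sums_le[OF this circle_series(3)[OF H2_tc_sums[OF V] r] H2_norm_sums[OF V]]
      have "(LINT t|circ. (cmod (V k (complex_of_real r * cis t)))\<^sup>2) / (2 * pi) \<le> C"
        using bd[of k] by linarith
      then show ?thesis
        by (simp add: field_simps)
    qed
  qed (rule tendsto_const)
  then show ?thesis
    unfolding H2_def set_LINT_circ using W by blast
qed

lemma det_has_bv:
  fixes A :: "complex \<Rightarrow> complex^'n^'n"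
  assumes "has_bv A t"
  shows "has_bv (\<lambda>z. det (A z)) t" "bv (\<lambda>z. det (A z)) t = det (bv A t)"
proof -
  have "((\<lambda>r. A (complex_of_real r * cis t) $ i $ j) \<longlongrightarrow> bv A t $ i $ j) (at_left 1)" for i j
    by (intro tendsto_vec_nth) (use assms in \<open>simp add: has_bv_def\<close>)
  then have "((\<lambda>r. det (A (complex_of_real r * cis t))) \<longlongrightarrow> det (bv A t)) (at_left 1)"
    unfolding det_def by (intro tendsto_sum tendsto_mult tendsto_prod tendsto_const)
  from has_bvI[of "\<lambda>z. det (A z)", OF this]
  show "has_bv (\<lambda>z. det (A z)) t" "bv (\<lambda>z. det (A z)) t = det (bv A t)"
    by auto
qed

lemma mat_bdd_hol_has_bv:
  fixes A :: "complex \<Rightarrow> complex^'n^'m"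
  assumes "\<And>i j. bdd_hol (\<lambda>z. A z $ i $ j)"
  shows "AE t in circ. has_bv A t"
proof -
  have "AE t in circ. \<forall>i\<in>(UNIV::'m set). \<forall>j\<in>(UNIV::'n set). has_bv (\<lambda>z. A z $ i $ j) t"
    by (intro AE_finite_allI) (use bdd_hol_has_bv[OF assms] in auto)
  then show ?thesis
    by eventually_elim (simp add: has_bv_vec_iff)
qed

lemma mat_vec_has_bv:
  fixes A :: "complex \<Rightarrow> complex^'n^'m"
  assumes "has_bv A t" "has_bv f t"
  shows "has_bv (\<lambda>z. A z *v f z) t" "bv (\<lambda>z. A z *v f z) t = bv A t *v bv f t"
proof -
  have a: "((\<lambda>r. A (complex_of_real r * cis t) $ i $ j) \<longlongrightarrow> bv A t $ i $ j) (at_left 1)" for i j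
    by (intro tendsto_vec_nth) (use assms in \<open>simp add: has_bv_def\<close>)
  have f: "((\<lambda>r. f (complex_of_real r * cis t) $ j) \<longlongrightarrow> bv f t $ j) (at_left 1)" for j
    by (intro tendsto_vec_nth) (use assms in \<open>simp add: has_bv_def\<close>)
  have "((\<lambda>r. A (complex_of_real r * cis t) *v f (complex_of_real r * cis t)) \<longlongrightarrow> bv A t *v bv f t) (at_left 1)"
    unfolding matrix_vector_mult_def by (intro tendsto_vec_lambda tendsto_sum tendsto_mult a f)
  from has_bvI[of "\<lambda>z. A z *v f z", OF this]
  show "has_bv (\<lambda>z. A z *v f z) t" "bv (\<lambda>z. A z *v f z) t = bv A t *v bv f t"
    by auto
qed

lemma bv_divide:
  fixes f g :: "complex \<Rightarrow> complex"
  assumes "has_bv f t" "has_bv g t" "bv g t \<noteq> 0"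
  shows "has_bv (\<lambda>z. f z / g z) t"
  using has_bvI[OF tendsto_divide[OF assms(1,2)[unfolded has_bv_def] assms(3)]] by auto

text \<open>Smirnov's maximum principle: with the multipliers \<open>q\<^sub>k\<close>, the functions \<open>q\<^sub>k det A W\<close> are in \<open>H\<^sup>2\<close>,
  tend to \<open>W\<close>, and have norms controlled by the boundary values of \<open>W\<close>.\<close>

lemma outer_division:
  fixes A :: "complex \<Rightarrow> complex^'n^'n"
  assumes A: "outer_mat A" and f: "f \<in> H2v"
    and inv: "AE t in circ. det (bv A t) \<noteq> 0"
  defines "W \<equiv> \<lambda>z. matrix_inv (A z) *v f z"
  shows "(\<lambda>z. W z $ i) holomorphic_on ball 0 1" "AE t in circ. has_bv W t"
    and "(\<And>i. sq_int circ (bv (\<lambda>z. W z $ i))) \<Longrightarrow> W \<in> H2v"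
proof -
  have ab: "bdd_hol (\<lambda>z. A z $ i $ j)" for i j
    by (rule outer_mat_bdd_hol[OF A])
  \<comment> \<open>Cramer numerators of \<open>W\<close>: combinations of \<open>f\<close> with
    bounded holomorphic coefficients, hence in H^2, and equal to \<open>det A\<close> times the
    components of \<open>W\<close>.\<close>
  define u where "u i z = (\<Sum>j\<in>UNIV. cof (A z) i j * f z $ j)" for i z
  have u: "u i \<in> H2" for i
    unfolding u_def [abs_def] by (intro H2_sum H2_mult bdd_hol_cof ab H2vD[OF f])
  have uW: "u i z = det (A z) * W z $ i" if "cmod z < 1" for i z
    by (simp add: u_def W_def matrix_vector_mult_def sum_distrib_left mult.commute mult.left_commute
        flip: matrix_inv_cof[OF outer_mat_det_nz[OF A that]])
  have Weq: "W z $ i = u i z / det (A z)" if "z \<in> ball 0 1" for z i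
    using uW[of z i] outer_mat_det_nz[OF A, of z] that by simp
  show hol: "(\<lambda>z. W z $ i) holomorphic_on ball 0 1" for i
  proof (rule holomorphic_transform)
    show "(\<lambda>z. u i z / det (A z)) holomorphic_on ball 0 1"
      using H2_holomorphic[OF u] bdd_hol_det[OF ab] outer_mat_det_nz[OF A]
      by (intro holomorphic_on_divide) (auto simp: bdd_hol_def)
  qed (rule Weq [symmetric])
  have "AE t in circ. \<forall>i\<in>UNIV. has_bv (u i) t"
    by (rule AE_finite_allI) (use H2_has_bv[OF u] in auto)
  then show Wb: "AE t in circ. has_bv W t"
    using inv mat_bdd_hol_has_bv[OF ab]
  proof eventually_elim
    case (elim t)
    have "has_bv (\<lambda>z. W z $ i) t" for i
      using bv_divide[of "u i" t "\<lambda>z. det (A z)"] elim det_has_bv[OF elim(3)] has_bv_cong(1)[OF Weq] by simp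
    then show ?case
      by (simp add: has_bv_vec_iff)
  qed
  assume w: "\<And>i. sq_int circ (bv (\<lambda>z. W z $ i))"
  obtain q :: "nat \<Rightarrow> complex \<Rightarrow> complex" where q: "\<And>k. bdd_hol (q k)"
    "\<And>k z. cmod z < 1 \<Longrightarrow> cmod (q k z * det (A z)) \<le> fact CARD('n) * 2 ^ CARD('n)"
    "\<And>z. cmod z < 1 \<Longrightarrow> (\<lambda>k. q k z * det (A z)) \<longlonglongrightarrow> 1"
    using outer_mat_multipliers[OF A] by metis
  define C :: real where "C = fact CARD('n) * 2 ^ CARD('n)"
  show "W \<in> H2v"
  proof (rule H2vI)
    fix i
    define V where "V k z = q k z * u i z" for k z
    have V: "V k \<in> H2" for k
      unfolding V_def [abs_def] by (intro H2_mult q(1) u)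
    have VW: "V k z = (q k z * det (A z)) * W z $ i" if "z \<in> ball 0 1" for k z
      using uW[of z i] that by (simp add: V_def mult.assoc)
    have Vb: "(H2_norm (V k))\<^sup>2 \<le> C\<^sup>2 * (LINT t|circ. (cmod (bv (\<lambda>z. W z $ i) t))\<^sup>2) / (2 * pi)" for k
    proof -
      have "AE t in circ. (cmod (bv (V k) t))\<^sup>2 \<le> C\<^sup>2 * (cmod (bv (\<lambda>z. W z $ i) t))\<^sup>2"
        using Wb bdd_hol_has_bv[OF bdd_hol_mult[OF q(1)[of k] bdd_hol_det[OF ab]]]
      proof eventually_elim
        case (elim t)
        have "has_bv (\<lambda>z. W z $ i) t"
          using elim(1) by (simp add: has_bv_vec_iff)
        then have "bv (V k) t = bv (\<lambda>z. q k z * det (A z)) t * bv (\<lambda>z. W z $ i) t"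
          using bv_mult(2)[OF elim(2)] has_bv_cong(2)[OF VW] by simp
        moreover have "cmod (bv (\<lambda>z. q k z * det (A z)) t) \<le> C"
          by (rule bdd_hol_bv_le[OF _ elim(2)]) (use q(2) in \<open>simp add: C_def\<close>)
        ultimately have "cmod (bv (V k) t) \<le> C * cmod (bv (\<lambda>z. W z $ i) t)"
          by (simp add: norm_mult mult_right_mono)
        then show ?case
          using power_mono[of "cmod (bv (V k) t)" "C * cmod (bv (\<lambda>z. W z $ i) t)" 2] by (simp add: power_mult_distrib)
      qed
      then have "(LINT t|circ. (cmod (bv (V k) t))\<^sup>2) \<le> (LINT t|circ. C\<^sup>2 * (cmod (bv (\<lambda>z. W z $ i) t))\<^sup>2)"
        by (intro integral_mono_AE sq_int_integrable_sq H2_bv_approx(1) V integrable_mult_right w)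
      then show ?thesis
        by (simp add: H2_norm_sq_circ field_simps)
    qed
    show "(\<lambda>z. W z $ i) \<in> H2"
    proof (rule H2_from_bounded_limit[OF V _ Vb hol])
      fix z :: complex assume z: "cmod z < 1"
      have "(\<lambda>k. q k z * det (A z) * W z $ i) \<longlonglongrightarrow> 1 * W z $ i"
        by (intro tendsto_mult tendsto_const q(3) z)
      then show "(\<lambda>k. V k z) \<longlonglongrightarrow> W z $ i"
        using z by (simp add: VW)
    qed
  qed
qed

section \<open>The adjoint and the de Branges--Rovnyak space\<close>

lemma H2v_inner_cong:
  fixes f g f' g' :: "complex \<Rightarrow> complex^'n"
  assumes "\<And>z. cmod z < 1 \<Longrightarrow> f z = f' z" "\<And>z. cmod z < 1 \<Longrightarrow> g z = g' z"
  shows "H2v_inner f g = H2v_inner f' g'"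
  unfolding H2v_inner_def using assms by (intro sum.cong refl H2_inner_cong) simp_all

lemma dense_in_H2vD:
  "dense_in_H2v D \<Longrightarrow> g \<in> H2v \<Longrightarrow> 0 < e \<Longrightarrow> \<exists>f\<in>D. H2v_norm (\<lambda>z. f z - g z) < e"
  by (simp add: dense_in_H2v_def)

text \<open>Toeplitz operators project pointwise products of boundary values. Where such a product
  agrees almost everywhere with the boundary values of an analytic function, that function may
  replace the projection in inner products. Measurability of \<open>u\<close> is a separate premise
  because agreement almost everywhere does not provide it.\<close>

lemma szego_of_H2:
  assumes f: "f \<in> H2" and u: "u \<in> borel_measurable circ" "AE t in circ. bv f t = u t"
  shows "sq_int circ u" "g \<in> H2 \<Longrightarrow> H2_inner (szego u) g = H2_inner f g"
proof -
  show s: "sq_int circ u"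
    by (rule sq_int_cong_AE[OF H2_bv_approx(1)[OF f] u])
  assume g: "g \<in> H2"
  note b = H2_bv_approx(1)[OF g]
  have "(LINT t|circ. u t * cnj (bv g t)) = (LINT t|circ. bv f t * cnj (bv g t))"
  proof (rule integral_cong_AE)
    show "(\<lambda>t. u t * cnj (bv g t)) \<in> borel_measurable circ" "(\<lambda>t. bv f t * cnj (bv g t)) \<in> borel_measurable circ"
      by (intro borel_measurable_integrable sq_int_cnj_mult_integrable s b H2_bv_approx(1)[OF f])+
    show "AE t in circ. u t * cnj (bv g t) = bv f t * cnj (bv g t)"
      using u(2) by eventually_elim simp
  qed
  then show "H2_inner (szego u) g = H2_inner f g"
    using H2_inner_szego[OF s g] H2_inner_circ[of f g] by simp
qed

text \<open>Codes the orthogonal sum of H^2 and its vector-valued version as one space over the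
  index type \<open>'n option\<close>, so that the Riesz representation for \<open>H2v\<close>
  applies to it unchanged.\<close>

definition pair_fun :: "(complex \<Rightarrow> complex) \<Rightarrow> (complex \<Rightarrow> complex^'n) \<Rightarrow> complex \<Rightarrow> complex^('n option)" where
  "pair_fun g h z = (\<chi> i. case i of None \<Rightarrow> g z | Some j \<Rightarrow> h z $ j)"

lemma pair_fun_nth [simp]: "pair_fun g h z $ None = g z" "pair_fun g h z $ Some j = h z $ j"
  by (simp_all add: pair_fun_def)

lemma sum_option: "(\<Sum>i\<in>UNIV. F i) = F None + (\<Sum>j\<in>UNIV. F (Some j))"
  for F :: "'k::finite option \<Rightarrow> 'a::comm_monoid_add"
  by (simp add: UNIV_option_conv sum.reindex)

lemma pair_fun_H2v: "pair_fun g h \<in> H2v \<longleftrightarrow> g \<in> H2 \<and> h \<in> H2v"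
proof
  assume "pair_fun g h \<in> H2v"
  from H2vD[OF this, of None] H2vD[OF this, of "Some _"] show "g \<in> H2 \<and> h \<in> H2v"
    by (simp add: H2v_def)
next
  assume "g \<in> H2 \<and> h \<in> H2v"
  then have "(\<lambda>z. pair_fun g h z $ i) \<in> H2" for i
    by (cases i) (auto simp: H2v_def)
  then show "pair_fun g h \<in> H2v"
    by (rule H2vI)
qed

lemma pair_fun_inner: "H2v_inner (pair_fun g h) (pair_fun g' h') = H2_inner g g' + H2v_inner h h'"
  by (simp add: H2v_inner_def sum_option)

lemma pair_fun_norm: "(H2v_norm (pair_fun g h))\<^sup>2 = (H2_norm g)\<^sup>2 + (H2v_norm h)\<^sup>2"
  by (simp add: H2v_norm_sq sum_option)

lemma pair_fun_eta: "y = pair_fun (\<lambda>z. y z $ None) (\<lambda>z. \<chi> j. y z $ Some j)"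
proof
  show "y z = pair_fun (\<lambda>z. y z $ None) (\<lambda>z. \<chi> j. y z $ Some j) z" for z
    unfolding vec_eq_iff
  proof
    fix i show "y z $ i = pair_fun (\<lambda>z. y z $ None) (\<lambda>z. \<chi> j. y z $ Some j) z $ i"
      by (cases i) auto
  qed
qed

lemma norm_vec_sq: "(norm x)\<^sup>2 = (\<Sum>i\<in>UNIV. (cmod (x $ i))\<^sup>2)" for x :: "complex^'n"
  by (simp add: norm_vec_def L2_set_def sum_nonneg)

lemma cmod_row_le: "cmod (\<Sum>i\<in>UNIV. b $ i * x $ i) \<le> norm b * norm x" for b x :: "complex^'n"
proof -
  have "cmod (\<Sum>i\<in>UNIV. b $ i * x $ i) \<le> (\<Sum>i\<in>UNIV. \<bar>cmod (b $ i)\<bar> * \<bar>cmod (x $ i)\<bar>)"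
    by (rule order_trans[OF norm_sum]) (simp add: norm_mult)
  also have "\<dots> \<le> norm b * norm x"
    unfolding norm_vec_def by (rule L2_set_mult_ineq)
  finally show ?thesis .
qed

section \<open>The Toeplitz operator with symbol \<phi> and its adjoint\<close>

locale outer_pair =
  fixes B :: "complex \<Rightarrow> complex^'n" and A :: "complex \<Rightarrow> complex^'n^'n" and \<phi> :: "complex \<Rightarrow> complex^'n"
  assumes schur: "schur_row B"
    and strict: "AE t in lborel. t \<in> {0..2*pi} \<longrightarrow> norm (bv B t) < 1"
    and outer: "outer_mat A"
    and isom: "AE t in lborel. t \<in> {0..2*pi} \<longrightarrow>
           (\<forall>i j. cnj (bv B t $ i) * bv B t $ j + (\<Sum>k\<in>UNIV. cnj (bv A t $ k $ i) * bv A t $ k $ j)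
                   = (if i = j then 1 else 0))"
    and quot: "\<forall>z\<in>ball 0 1. \<phi> z = B z v* matrix_inv (A z)"
begin

lemma B_bdd: "bdd_hol (\<lambda>z. B z $ i)"
proof -
  have "cmod (B z $ i) \<le> 1" if "z \<in> ball 0 1" for z
    using schur that order_trans[OF Finite_Cartesian_Product.norm_nth_le] unfolding schur_row_def by blast
  then show ?thesis
    using schur unfolding bdd_hol_def schur_row_def by blast
qed

lemma A_bdd: "bdd_hol (\<lambda>z. A z $ i $ j)"
  by (rule outer_mat_bdd_hol[OF outer])

definition mB :: "(complex \<Rightarrow> complex^'n) \<Rightarrow> complex \<Rightarrow> complex" where
  "mB w z = (\<Sum>i\<in>UNIV. B z $ i * w z $ i)"

definition mA :: "(complex \<Rightarrow> complex^'n) \<Rightarrow> complex \<Rightarrow> complex^'n" where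
  "mA w z = A z *v w z"

lemma mB_H2: "w \<in> H2v \<Longrightarrow> mB w \<in> H2"
  unfolding mB_def [abs_def] by (intro H2_sum H2_mult B_bdd H2vD)

lemma mA_H2v: "w \<in> H2v \<Longrightarrow> mA w \<in> H2v"
  unfolding mA_def [abs_def] by (intro mat_mult_H2v A_bdd)

lemma B_has_bv: "AE t in circ. has_bv B t"
proof -
  have "AE t in circ. \<forall>i\<in>UNIV. has_bv (\<lambda>z. B z $ i) t"
    by (rule AE_finite_allI) (use bdd_hol_has_bv[OF B_bdd] in auto)
  then show ?thesis
    by eventually_elim (simp add: has_bv_vec_iff)
qed

lemma row_has_bv:
  fixes F w :: "complex \<Rightarrow> complex^'n"
  assumes "has_bv F t" "has_bv w t"
  shows "bv (\<lambda>z. \<Sum>i\<in>UNIV. F z $ i * w z $ i) t = (\<Sum>i\<in>UNIV. bv F t $ i * bv w t $ i)"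
proof -
  have *: "has_bv (\<lambda>z. F z $ i) t" "has_bv (\<lambda>z. w z $ i) t" for i
    using assms by (auto simp: has_bv_vec_iff)
  show ?thesis
    using bv_sum[of UNIV "\<lambda>i z. F z $ i * w z $ i" t] bv_mult[OF *] bv_nth[OF assms(1)] bv_nth[OF assms(2)] by simp
qed

text \<open>Polarised, because \<open>E_isometry\<close> pairs two different functions.\<close>

lemma isometry_pointwise:
  fixes a :: "complex^'n^'n" and b x y :: "complex^'n"
  assumes "\<forall>i j. cnj (b $ i) * b $ j + (\<Sum>k\<in>UNIV. cnj (a $ k $ i) * a $ k $ j) = (if i = j then 1 else 0)"
  shows "(\<Sum>i\<in>UNIV. b $ i * x $ i) * cnj (\<Sum>i\<in>UNIV. b $ i * y $ i) + (\<Sum>k\<in>UNIV. (a *v x) $ k * cnj ((a *v y) $ k))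
      = (\<Sum>i\<in>UNIV. x $ i * cnj (y $ i))"
proof -
  have 1: "(\<Sum>i\<in>UNIV. b $ i * x $ i) * cnj (\<Sum>i\<in>UNIV. b $ i * y $ i) =
      (\<Sum>i\<in>UNIV. \<Sum>j\<in>UNIV. (cnj (b $ i) * b $ j) * (x $ j * cnj (y $ i)))"
    by (simp add: sum_product mult_ac) (rule sum.swap)
  have "(\<Sum>k\<in>UNIV. (a *v x) $ k * cnj ((a *v y) $ k)) =
      (\<Sum>k\<in>UNIV. \<Sum>i\<in>UNIV. \<Sum>j\<in>UNIV. (cnj (a $ k $ i) * a $ k $ j) * (x $ j * cnj (y $ i)))"
    by (intro sum.cong refl) (simp add: matrix_vector_mult_def sum_product mult_ac, rule sum.swap)
  also have "\<dots> = (\<Sum>i\<in>UNIV. \<Sum>k\<in>UNIV. \<Sum>j\<in>UNIV. (cnj (a $ k $ i) * a $ k $ j) * (x $ j * cnj (y $ i)))"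
    by (rule sum.swap)
  also have "\<dots> = (\<Sum>i\<in>UNIV. \<Sum>j\<in>UNIV. (\<Sum>k\<in>UNIV. cnj (a $ k $ i) * a $ k $ j) * (x $ j * cnj (y $ i)))"
    unfolding sum_distrib_right by (intro sum.cong refl sum.swap)
  finally have "(\<Sum>i\<in>UNIV. b $ i * x $ i) * cnj (\<Sum>i\<in>UNIV. b $ i * y $ i) + (\<Sum>k\<in>UNIV. (a *v x) $ k * cnj ((a *v y) $ k)) =
      (\<Sum>i\<in>UNIV. \<Sum>j\<in>UNIV. (cnj (b $ i) * b $ j + (\<Sum>k\<in>UNIV. cnj (a $ k $ i) * a $ k $ j)) * (x $ j * cnj (y $ i)))"
    unfolding 1 by (simp add: sum.distrib distrib_right)
  also have "\<dots> = (\<Sum>i\<in>UNIV. \<Sum>j\<in>UNIV. if i = j then x $ j * cnj (y $ i) else 0)"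
    using assms by (intro sum.cong refl) simp
  also have "\<dots> = (\<Sum>i\<in>UNIV. x $ i * cnj (y $ i))"
    by simp
  finally show ?thesis .
qed

text \<open>Invertibility of the boundary matrix: on a kernel vector \<open>x\<close> of
  \<open>bv A t\<close> the isometry would give |bv B t x| = |x|, against
  \<open>norm (bv B t) < 1\<close>.\<close>

lemma boundary:
  "AE t in circ. has_bv B t \<and> has_bv A t \<and> det (bv A t) \<noteq> 0 \<and>
    (\<forall>x y. (\<Sum>i\<in>UNIV. bv B t $ i * x $ i) * cnj (\<Sum>i\<in>UNIV. bv B t $ i * y $ i) +
      (\<Sum>k\<in>UNIV. (bv A t *v x) $ k * cnj ((bv A t *v y) $ k)) = (\<Sum>i\<in>UNIV. x $ i * cnj (y $ i)))"
  using B_has_bv mat_bdd_hol_has_bv[OF A_bdd] strict[folded AE_circ_iff] isom[folded AE_circ_iff]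
proof eventually_elim
  case (elim t)
  note I = isometry_pointwise[OF elim(4)]
  have "x = 0" if x: "bv A t *v x = 0" for x
  proof (rule ccontr)
    assume "x \<noteq> 0"
    have "complex_of_real ((cmod (\<Sum>i\<in>UNIV. bv B t $ i * x $ i))\<^sup>2) = complex_of_real ((norm x)\<^sup>2)"
      using I[of x x] by (simp only: x zero_index mult_zero_left sum.neutral_const add_0_right
          complex_norm_square norm_vec_sq of_real_sum)
    then have "(cmod (\<Sum>i\<in>UNIV. bv B t $ i * x $ i))\<^sup>2 = (norm x)\<^sup>2"
      by (simp only: of_real_eq_iff)
    then have "cmod (\<Sum>i\<in>UNIV. bv B t $ i * x $ i) = norm x"
      by (simp add: power2_eq_iff_nonneg)
    then have "1 * norm x \<le> norm (bv B t) * norm x"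
      using cmod_row_le[of "bv B t" x] by simp
    then show False
      using elim(3) \<open>x \<noteq> 0\<close> by (simp add: mult_le_cancel_right)
  qed
  then have "\<exists>M. M ** bv A t = mat 1"
    by (simp add: matrix_left_invertible_ker)
  then have "det (bv A t) \<noteq> 0"
    by (simp add: invertible_det_nz [symmetric] invertible_left_inverse)
  then show ?case
    using elim(1,2) I by blast
qed

lemma det_boundary: "AE t in circ. det (bv A t) \<noteq> 0"
  using boundary by eventually_elim blast

lemma mB_bv:
  assumes "w \<in> H2v"
  shows "AE t in circ. bv (mB w) t = (\<Sum>i\<in>UNIV. bv B t $ i * bv w t $ i)"
  using B_has_bv H2v_has_bv[OF assms] by eventually_elim (simp add: mB_def [abs_def] row_has_bv)

lemma mA_bv:
  assumes "w \<in> H2v"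
  shows "AE t in circ. has_bv (mA w) t \<and> bv (mA w) t = bv A t *v bv w t"
  using mat_bdd_hol_has_bv[OF A_bdd] H2v_has_bv[OF assms]
  by eventually_elim (simp add: mA_def [abs_def] mat_vec_has_bv)

text \<open>Cramer's rule exhibits each entry of \<phi> as a quotient of bounded holomorphic
  functions, the form from which its holomorphy and its radial limits are read off.\<close>

lemma \<phi>_nth: "\<phi> z $ j = (\<Sum>i\<in>UNIV. cof (A z) i j * B z $ i) / det (A z)" if "z \<in> ball 0 1" for z j
proof -
  have nz: "det (A z) \<noteq> 0"
    using outer_mat_det_nz[OF outer] that by simp
  have "matrix_inv (A z) $ i $ j = cof (A z) i j / det (A z)" for i
    using matrix_inv_cof[OF nz, of i j] nz by (simp add: field_simps)
  then show ?thesis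
    using quot that by (simp add: vector_matrix_mult_def sum_divide_distrib mult.commute)
qed

lemma \<phi>_numerator: "bdd_hol (\<lambda>z. \<Sum>i\<in>UNIV. cof (A z) i j * B z $ i)"
  by (intro bdd_hol_sum bdd_hol_mult bdd_hol_cof A_bdd B_bdd)

lemma \<phi>_holomorphic: "(\<lambda>z. \<phi> z $ j) holomorphic_on ball 0 1"
proof (rule holomorphic_transform)
  show "(\<lambda>z. (\<Sum>i\<in>UNIV. cof (A z) i j * B z $ i) / det (A z)) holomorphic_on ball 0 1"
    using \<phi>_numerator[of j] bdd_hol_det[OF A_bdd] outer_mat_det_nz[OF outer]
    by (intro holomorphic_on_divide) (auto simp: bdd_hol_def)
qed (rule \<phi>_nth [symmetric])

lemma \<phi>_has_bv: "AE t in circ. has_bv \<phi> t"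
proof -
  have "AE t in circ. \<forall>j\<in>UNIV. has_bv (\<lambda>z. \<Sum>i\<in>UNIV. cof (A z) i j * B z $ i) t"
    by (rule AE_finite_allI) (use bdd_hol_has_bv[OF \<phi>_numerator] in auto)
  then show ?thesis
    using boundary
  proof eventually_elim
    case (elim t)
    have "has_bv (\<lambda>z. \<phi> z $ j) t" for j
      using bv_divide[of "\<lambda>z. \<Sum>i\<in>UNIV. cof (A z) i j * B z $ i" t "\<lambda>z. det (A z)"] elim
        det_has_bv[of A t] has_bv_cong(1)[OF \<phi>_nth] by simp
    then show ?case
      by (simp add: has_bv_vec_iff)
  qed
qed

lemma \<phi>_mA: "(\<Sum>j\<in>UNIV. \<phi> z $ j * (A z *v x) $ j) = (\<Sum>i\<in>UNIV. B z $ i * x $ i)" if "z \<in> ball 0 1"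
proof -
  have nz: "det (A z) \<noteq> 0"
    using outer_mat_det_nz[OF outer] that by simp
  have "(\<Sum>j\<in>UNIV. \<phi> z $ j * (A z *v x) $ j) = (\<Sum>i\<in>UNIV. B z $ i * (matrix_inv (A z) *v (A z *v x)) $ i)"
    using quot that
    by (simp add: vector_matrix_mult_def matrix_vector_mult_def [of "matrix_inv (A z)"] sum_distrib_left sum_distrib_right mult_ac)
      (rule sum.swap)
  also have "matrix_inv (A z) *v (A z *v x) = x"
    by (simp add: matrix_vector_mul_assoc matrix_inv_mult[OF nz])
  finally show ?thesis .
qed

lemma \<phi>_measurable:
  fixes f :: "complex \<Rightarrow> complex^'n"
  assumes "f \<in> H2v"
  shows "(\<lambda>t. \<Sum>i\<in>UNIV. bv \<phi> t $ i * bv f t $ i) \<in> borel_measurable circ"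
  by (intro borel_measurable_sum borel_measurable_times bv_nth_measurable \<phi>_holomorphic H2_holomorphic H2vD[OF assms])

text \<open>The identity \<phi> A = B is carried to the circle by comparing radial limits of the two
  scalar products, so no inverse of the boundary matrix appears.\<close>

lemma \<phi>_boundary:
  assumes "has_bv \<phi> t" "has_bv f t" "has_bv B t" "has_bv w t" "\<And>z. z \<in> ball 0 1 \<Longrightarrow> f z = A z *v w z"
  shows "(\<Sum>i\<in>UNIV. bv \<phi> t $ i * bv f t $ i) = (\<Sum>i\<in>UNIV. bv B t $ i * bv w t $ i)"
proof -
  have "bv (\<lambda>z. \<Sum>i\<in>UNIV. \<phi> z $ i * f z $ i) t = bv (\<lambda>z. \<Sum>i\<in>UNIV. B z $ i * w z $ i) t"
    by (rule has_bv_cong(2)) (simp add: assms(5) \<phi>_mA)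
  then show ?thesis
    by (simp add: row_has_bv[OF assms(1,2)] row_has_bv[OF assms(3,4)])
qed

lemma \<phi>_mA_bv:
  assumes "f \<in> H2v" "w \<in> H2v" "\<And>z. z \<in> ball 0 1 \<Longrightarrow> f z = A z *v w z"
  shows "AE t in circ. (\<Sum>i\<in>UNIV. bv \<phi> t $ i * bv f t $ i) = bv (mB w) t"
  using \<phi>_has_bv H2v_has_bv[OF assms(1)] B_has_bv H2v_has_bv[OF assms(2)] mB_bv[OF assms(2)]
proof eventually_elim
  case (elim t)
  then show ?case
    using \<phi>_boundary[OF elim(1-4) assms(3)] by simp
qed

lemma mA_in_dom:
  assumes "w \<in> H2v"
  shows "mA w \<in> toep_row_dom (bv \<phi>)"
proof -
  have "AE t in circ. bv (mB w) t = (\<Sum>i\<in>UNIV. bv \<phi> t $ i * bv (mA w) t $ i)"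
    using \<phi>_mA_bv[OF mA_H2v[OF assms] assms] by (simp add: mA_def eq_commute)
  from szego_of_H2(1)[OF mB_H2[OF assms] \<phi>_measurable[OF mA_H2v[OF assms]] this] show ?thesis
    by (simp add: toep_row_dom_def L2T_iff mA_H2v[OF assms])
qed

text \<open>Since \<open>(B; A)\<close> is isometric on the circle, \<open>|w|\<^sup>2 = |\<phi> f|\<^sup>2 + |f|\<^sup>2\<close> for \<open>w = A\<^sup>-\<^sup>1 f\<close>, so \<open>f\<close> in the
  domain forces \<open>w\<close> to be square integrable.\<close>

lemma dom_subset_mA:
  assumes "f \<in> toep_row_dom (bv \<phi>)"
  obtains w where "w \<in> H2v" "\<And>z. z \<in> ball 0 1 \<Longrightarrow> f z = A z *v w z"
proof -
  have f: "f \<in> H2v" and \<phi>f: "sq_int circ (\<lambda>t. \<Sum>i\<in>UNIV. bv \<phi> t $ i * bv f t $ i)"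
    using assms by (auto simp: toep_row_dom_def L2T_iff)
  define W where "W z = matrix_inv (A z) *v f z" for z
  have Whol: "(\<lambda>z. W z $ i) holomorphic_on ball 0 1" and Wbv: "AE t in circ. has_bv W t" for i
    unfolding W_def [abs_def] by (rule outer_division[OF outer f det_boundary])+
  have fW: "f z = A z *v W z" if "z \<in> ball 0 1" for z
    using matrix_inv_mult(1)[OF outer_mat_det_nz[OF outer, of z]] that by (simp add: W_def matrix_vector_mul_assoc)
  have "sq_int circ (bv (\<lambda>z. W z $ i))" for i
  proof -
    let ?s = "\<lambda>t. (cmod (\<Sum>i\<in>UNIV. bv \<phi> t $ i * bv f t $ i))\<^sup>2 + (\<Sum>k\<in>UNIV. (cmod (bv (\<lambda>z. f z $ k) t))\<^sup>2)"
    have m: "bv (\<lambda>z. W z $ i) \<in> borel_measurable circ"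
      by (intro borel_imp_circ bv_measurable holomorphic_on_imp_continuous_on Whol)
    have "integrable circ (\<lambda>t. (cmod (bv (\<lambda>z. W z $ i) t))\<^sup>2)"
    proof (rule Bochner_Integration.integrable_bound)
      show "integrable circ ?s"
        by (intro Bochner_Integration.integrable_add Bochner_Integration.integrable_sum sq_int_integrable_sq \<phi>f H2_bv_approx(1) H2vD[OF f])
      show "(\<lambda>t. (cmod (bv (\<lambda>z. W z $ i) t))\<^sup>2) \<in> borel_measurable circ"
        using m by measurable
      show "AE t in circ. norm ((cmod (bv (\<lambda>z. W z $ i) t))\<^sup>2) \<le> norm (?s t)"
        using boundary Wbv H2v_has_bv[OF f] \<phi>_has_bv
      proof eventually_elim
        case (elim t)
        let ?w = "bv W t"
        have b: "(\<Sum>i\<in>UNIV. bv \<phi> t $ i * bv f t $ i) = (\<Sum>i\<in>UNIV. bv B t $ i * ?w $ i)"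
          using elim by (intro \<phi>_boundary fW) auto
        have a: "bv f t = bv A t *v ?w"
          using mat_vec_has_bv(2)[of A t W] has_bv_cong(2)[OF fW, where t = t] elim by simp
        have "complex_of_real (?s t) = (\<Sum>i\<in>UNIV. bv B t $ i * ?w $ i) * cnj (\<Sum>i\<in>UNIV. bv B t $ i * ?w $ i) +
            (\<Sum>k\<in>UNIV. (bv A t *v ?w) $ k * cnj ((bv A t *v ?w) $ k))"
          unfolding b a [symmetric] by (simp only: of_real_add of_real_sum complex_norm_square bv_nth[OF elim(3)])
        also have "\<dots> = complex_of_real (\<Sum>i\<in>UNIV. (cmod (?w $ i))\<^sup>2)"
          using elim(1) by (simp only: complex_norm_square of_real_sum)
        finally have "?s t = (\<Sum>i\<in>UNIV. (cmod (?w $ i))\<^sup>2)"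
          by (simp only: of_real_eq_iff)
        moreover have "(cmod (?w $ i))\<^sup>2 \<le> (\<Sum>i\<in>UNIV. (cmod (?w $ i))\<^sup>2)"
          by (rule member_le_sum) auto
        ultimately show ?case
          by (simp add: bv_nth[OF elim(2)])
      qed
    qed
    with m show ?thesis
      by (simp add: sq_int_def)
  qed
  then have "W \<in> H2v"
    unfolding W_def [abs_def] by (rule outer_division(3)[OF outer f det_boundary])
  with fW that show thesis
    by blast
qed

lemma toep_row_inner:
  assumes "w \<in> H2v" "f \<in> toep_row_dom (bv \<phi>)" "g \<in> H2" "\<And>z. z \<in> ball 0 1 \<Longrightarrow> f z = A z *v w z"
  shows "H2_inner (toep_row (bv \<phi>) f) g = H2_inner (mB w) g"
proof -
  have f: "f \<in> H2v"
    using assms(2) by (simp add: toep_row_dom_def)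
  have "AE t in circ. bv (mB w) t = (\<Sum>i\<in>UNIV. bv \<phi> t $ i * bv f t $ i)"
    using \<phi>_mA_bv[OF f assms(1,4)] by (simp add: eq_commute)
  from szego_of_H2(2)[OF mB_H2[OF assms(1)] \<phi>_measurable[OF f] this assms(3)] show ?thesis
    by (simp add: toep_row_def)
qed

text \<open>The adjoint relation with the domain parametrised as \<open>A w\<close>. It mentions
  only \<open>B\<close> and \<open>A\<close>, and \<open>adj_row_iff\<close> identifies it with the
  relation for \<phi>.\<close>

definition Tadj :: "(complex \<Rightarrow> complex) \<Rightarrow> (complex \<Rightarrow> complex^'n) \<Rightarrow> bool" where
  "Tadj g h \<longleftrightarrow> g \<in> H2 \<and> h \<in> H2v \<and> (\<forall>w\<in>H2v. H2_inner (mB w) g = H2v_inner (mA w) h)"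

lemma adj_row_iff: "adj_row (toep_row_dom (bv \<phi>)) (toep_row (bv \<phi>)) g h \<longleftrightarrow> Tadj g h"
proof
  assume a: "adj_row (toep_row_dom (bv \<phi>)) (toep_row (bv \<phi>)) g h"
  then have gh: "g \<in> H2" "h \<in> H2v"
    by (auto simp: adj_row_def)
  have "H2_inner (mB w) g = H2v_inner (mA w) h" if w: "w \<in> H2v" for w
    using toep_row_inner[OF w mA_in_dom[OF w] gh(1)] mA_in_dom[OF w] a by (auto simp: adj_row_def mA_def)
  with gh show "Tadj g h"
    by (simp add: Tadj_def)
next
  assume T: "Tadj g h"
  then have gh: "g \<in> H2" "h \<in> H2v"
    by (auto simp: Tadj_def)
  have "H2_inner (toep_row (bv \<phi>) f) g = H2v_inner f h" if f: "f \<in> toep_row_dom (bv \<phi>)" for f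
  proof -
    obtain w where w: "w \<in> H2v" "\<And>z. z \<in> ball 0 1 \<Longrightarrow> f z = A z *v w z"
      by (rule dom_subset_mA[OF f]) blast
    have "H2v_inner f h = H2v_inner (mA w) h"
      by (rule H2v_inner_cong) (simp_all add: w(2) mA_def)
    then show ?thesis
      using toep_row_inner[OF w(1) f gh(1) w(2)] T w(1) by (simp add: Tadj_def)
  qed
  with gh show "adj_row (toep_row_dom (bv \<phi>)) (toep_row (bv \<phi>)) g h"
    by (simp add: adj_row_def)
qed

text \<open>The domain contains \<open>A\<close> times every polynomial, and outerness says that
  these are dense.\<close>

lemma dom_dense: "dense_in_H2v (toep_row_dom (bv \<phi>))"
  unfolding dense_in_H2v_def
proof (intro conjI ballI allI impI)
  show "toep_row_dom (bv \<phi>) \<subseteq> H2v"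
    by (auto simp: toep_row_dom_def)
  fix g :: "complex \<Rightarrow> complex^'n" and e :: real
  assume "g \<in> H2v" "0 < e"
  then obtain f where "f \<in> {(\<lambda>z. A z *v (\<Sum>k\<le>N. (z ^ k) *s c k)) | N c. True}"
    and f: "H2v_norm (\<lambda>z. f z - g z) < e"
    using outer[unfolded outer_mat_def, THEN conjunct2, THEN conjunct2, THEN dense_in_H2vD] by blast
  then obtain N c where "f = mA (\<lambda>z. \<Sum>k\<le>N. (z ^ k) *s c k)"
    unfolding mA_def by blast
  then have "f \<in> toep_row_dom (bv \<phi>)"
    using mA_in_dom[OF H2vI[OF bdd_hol_H2[OF poly_bdd_hol]]] by simp
  with f show "\<exists>f\<in>toep_row_dom (bv \<phi>). H2v_norm (\<lambda>z. f z - g z) < e"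
    by blast
qed

text \<open>The difference \<open>d\<close> is orthogonal to every \<open>A w\<close>, hence to the
  dense domain; an element of the domain within \<open>e\<close> of \<open>d\<close> then forces
  \<open>d\<close> to have norm at most \<open>e\<close>. Only norms are equated, because
  \<open>h\<close> and \<open>h'\<close> may differ outside the disc.\<close>

lemma Tadj_unique:
  assumes "Tadj g h" "Tadj g h'"
  shows "H2v_norm h = H2v_norm h'"
proof -
  have hH: "h \<in> H2v" "h' \<in> H2v"
    using assms by (auto simp: Tadj_def)
  define d where "d z = h z - h' z" for z
  have d: "d \<in> H2v"
    unfolding d_def [abs_def] by (rule H2v_diff[OF hH])
  have orth: "H2v_inner (mA w) d = 0" if "w \<in> H2v" for w
    using assms that by (simp add: d_def [abs_def] H2v_inner_diff_right[OF hH mA_H2v[OF that]] Tadj_def)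
  have "H2v_norm d \<le> e" if "0 < e" for e
  proof -
    obtain f where f: "f \<in> toep_row_dom (bv \<phi>)" "H2v_norm (\<lambda>z. f z - d z) < e"
      using dense_in_H2vD[OF dom_dense d \<open>0 < e\<close>] by blast
    obtain w where w: "w \<in> H2v" "\<And>z. z \<in> ball 0 1 \<Longrightarrow> f z = A z *v w z"
      by (rule dom_subset_mA[OF f(1)]) blast
    have fH: "f \<in> H2v"
      using f(1) by (simp add: toep_row_dom_def)
    have "H2v_inner f d = H2v_inner (mA w) d"
      by (rule H2v_inner_cong) (simp_all add: w(2) mA_def)
    then have "H2v_inner (\<lambda>z. f z - d z) d = - complex_of_real ((H2v_norm d)\<^sup>2)"
      by (simp only: H2v_inner_diff_left[OF fH d d] H2v_inner_self[OF d] orth[OF w(1)] diff_0)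
    then have "(H2v_norm d)\<^sup>2 = cmod (H2v_inner (\<lambda>z. f z - d z) d)"
      by (simp only: norm_minus_cancel norm_of_real abs_power2)
    also have "\<dots> \<le> H2v_norm (\<lambda>z. f z - d z) * H2v_norm d"
      by (rule H2v_Cauchy_Schwarz[OF H2v_diff[OF fH d] d])
    also have "\<dots> \<le> e * H2v_norm d"
      using f(2) by (intro mult_right_mono H2v_norm_nonneg) simp
    finally show ?thesis
      using H2v_norm_nonneg[of d] \<open>0 < e\<close> by (cases "H2v_norm d = 0") (auto simp: power2_eq_square)
  qed
  then have "H2v_norm d \<le> 0"
    by (rule field_le_epsilon) simp
  then have "H2v_norm d = 0"
    using H2v_norm_nonneg[of d] by simp
  moreover have "(H2v_norm (\<lambda>z. h z - d z))\<^sup>2 = (H2v_norm h)\<^sup>2 - 2 * Re (H2v_inner h d) + (H2v_norm d)\<^sup>2"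
    by (rule H2v_norm_diff_sq[OF hH(1) d])
  moreover have "H2v_inner h d = 0"
    using H2v_Cauchy_Schwarz[OF hH(1) d] \<open>H2v_norm d = 0\<close> by simp
  ultimately have "(H2v_norm h')\<^sup>2 = (H2v_norm h)\<^sup>2"
    by (simp add: d_def)
  then show ?thesis
    by (simp add: power2_eq_iff_nonneg H2v_norm_nonneg)
qed

text \<open>The symbols \<open>B\<close> and \<open>A\<close> are bounded, so their Toeplitz
  operators are defined on all of \<open>H2v\<close> and act as the multiplications
  \<open>mB\<close> and \<open>mA\<close>. Testing the equation for \<open>fp\<close> against
  \<open>w\<close> is then the relation \<open>Tadj\<close>.\<close>

lemma is_fplus_Tadj:
  assumes "is_fplus B A f fp"
  shows "Tadj f (\<lambda>z. - fp z)"
proof -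
  obtain u v where fp: "fp \<in> H2v"
    and u: "adj_row (toep_row_dom (bv B)) (toep_row (bv B)) f u"
    and v: "adj_mat (toep_mat_dom (bv A)) (toep_mat (bv A)) fp v"
    and uv: "\<And>z. z \<in> ball 0 1 \<Longrightarrow> u z + v z = 0"
    using assms unfolding is_fplus_def by blast
  have H: "f \<in> H2" "u \<in> H2v" "v \<in> H2v"
    using u v by (auto simp: adj_row_def adj_mat_def)
  have "H2_inner (mB w) f = H2v_inner (mA w) (\<lambda>z. - fp z)" if w: "w \<in> H2v" for w
  proof -
    have Bm: "(\<lambda>t. \<Sum>i\<in>UNIV. bv B t $ i * bv w t $ i) \<in> borel_measurable circ"
      by (intro borel_measurable_sum borel_measurable_times bv_nth_measurable H2_holomorphic H2vD[OF w] bdd_hol_H2 B_bdd)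
    have Bae: "AE t in circ. bv (mB w) t = (\<Sum>i\<in>UNIV. bv B t $ i * bv w t $ i)"
      by (rule mB_bv[OF w])
    note Bs = szego_of_H2[OF mB_H2[OF w] Bm Bae]
    have "w \<in> toep_row_dom (bv B)"
      using w Bs(1) by (simp add: toep_row_dom_def L2T_iff)
    then have "H2v_inner w u = H2_inner (toep_row (bv B) w) f"
      using u by (simp add: adj_row_def)
    also have "\<dots> = H2_inner (mB w) f"
      unfolding toep_row_def by (rule Bs(2)[OF H(1)])
    finally have 1: "H2_inner (mB w) f = H2v_inner w u"
      by simp
    have mAj: "(\<lambda>z. mA w z $ j) \<in> H2" for j
      by (rule H2vD[OF mA_H2v[OF w]])
    have Aae: "AE t in circ. bv (\<lambda>z. mA w z $ j) t = (bv A t *v bv w t) $ j" for j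
      using mA_bv[OF w] by eventually_elim (simp add: bv_nth)
    have Am: "(\<lambda>t. (bv A t *v bv w t) $ j) \<in> borel_measurable circ" for j
    proof -
      have "(\<lambda>t. bv A t $ j $ i) \<in> borel_measurable circ" for i
      proof -
        have "continuous_on (ball 0 1) (\<lambda>z. \<chi> i j. A z $ i $ j)"
          by (intro continuous_on_vec_lambda holomorphic_on_imp_continuous_on H2_holomorphic bdd_hol_H2 A_bdd)
        then have "bv A \<in> borel_measurable circ"
          by (intro borel_imp_circ bv_measurable) simp
        then show ?thesis
          by (rule measurable_compose[OF _ borel_measurable_continuous_onI]) (intro continuous_intros)
      qed
      then show ?thesis
        unfolding matrix_vector_mult_def
        by (simp, intro borel_measurable_sum borel_measurable_times bv_nth_measurable H2_holomorphic H2vD[OF w])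
    qed
    note As = szego_of_H2[OF mAj Am Aae]
    have "w \<in> toep_mat_dom (bv A)"
      using w As(1) by (simp add: toep_mat_dom_def L2T_iff)
    then have "H2v_inner w v = H2v_inner (toep_mat (bv A) w) fp"
      using v by (simp add: adj_mat_def)
    also have "\<dots> = H2v_inner (mA w) fp"
      unfolding H2v_inner_def toep_mat_def by (intro sum.cong refl) (simp add: As(2)[OF H2vD[OF fp]])
    finally have 2: "H2v_inner (mA w) fp = H2v_inner w v"
      by simp
    have "H2v_inner w u + H2v_inner w v = H2v_inner w (\<lambda>z. u z + v z)"
      by (rule H2v_inner_add_right[OF H(2,3) w, symmetric])
    \<comment> \<open>The sum of \<open>u\<close> and \<open>v\<close> is known to vanish only
      inside the disc, which is all that the inner product sees.\<close>
    also have "\<dots> = H2v_inner w (\<lambda>z. 0 *s u z)"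
      by (rule H2v_inner_cong) (simp_all add: uv)
    also have "\<dots> = 0"
      by (simp only: H2v_inner_scale_right[OF H(2) w] complex_cnj_zero mult_zero_left)
    finally show ?thesis
      unfolding H2v_inner_uminus_right[OF fp mA_H2v[OF w]] 1 2 by (simp add: eq_neg_iff_add_eq_0)
  qed
  then show ?thesis
    unfolding Tadj_def using H(1) H2v_uminus[OF fp] by blast
qed

text \<open>The graph of the adjoint, reflected in the second component, is the orthogonal complement of the
  range of the isometry \<open>w \<mapsto> (B w, A w)\<close>; projecting the Szego kernel onto it gives its kernels.\<close>

definition E :: "(complex \<Rightarrow> complex^'n) \<Rightarrow> complex \<Rightarrow> complex^('n option)" where
  "E w = pair_fun (mB w) (mA w)"

text \<open>The adjoint of \<open>E\<close> applied to the pair of \<open>szk l\<close> and 0, as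
  \<open>H2v_inner_cB\<close> shows. Since \<open>E\<close> is isometric, \<open>E (cB l)\<close> is
  the projection of that pair onto the range of \<open>E\<close>.\<close>

definition cB :: "complex \<Rightarrow> complex \<Rightarrow> complex^'n" where
  "cB l z = (\<chi> i. cnj (B l $ i) * szk l z)"

definition kv :: "complex \<Rightarrow> complex \<Rightarrow> complex^('n option)" where
  "kv l z = pair_fun (szk l) (\<lambda>z. 0) z - E (cB l) z"

lemma E_H2v: "w \<in> H2v \<Longrightarrow> E w \<in> H2v"
  by (simp add: E_def pair_fun_H2v mB_H2 mA_H2v)

lemma E_isometry:
  assumes w: "w \<in> H2v" and p: "p \<in> H2v"
  shows "H2v_inner (E w) (E p) = H2v_inner w p"
proof -
  have mAj: "(\<lambda>z. mA w z $ j) \<in> H2" "(\<lambda>z. mA p z $ j) \<in> H2" for j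
    using mA_H2v w p by (auto intro: H2vD)
  have i: "integrable circ (\<lambda>t. bv f t * cnj (bv g t))" if "f \<in> H2" "g \<in> H2" for f g
    by (intro sq_int_cnj_mult_integrable H2_bv_approx(1) that)
  have "H2v_inner (E w) (E p) = (LINT t|circ. bv (mB w) t * cnj (bv (mB p) t) +
      (\<Sum>j\<in>UNIV. bv (\<lambda>z. mA w z $ j) t * cnj (bv (\<lambda>z. mA p z $ j) t))) / (2 * pi)"
    unfolding E_def pair_fun_inner unfolding H2v_inner_def H2_inner_circ
    by (subst Bochner_Integration.integral_add, intro i mB_H2 w p, intro Bochner_Integration.integrable_sum i mAj,
        subst Bochner_Integration.integral_sum, intro i mAj)
      (simp add: add_divide_distrib sum_divide_distrib)
  also have "(LINT t|circ. bv (mB w) t * cnj (bv (mB p) t) +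
      (\<Sum>j\<in>UNIV. bv (\<lambda>z. mA w z $ j) t * cnj (bv (\<lambda>z. mA p z $ j) t))) =
      (LINT t|circ. (\<Sum>i\<in>UNIV. bv (\<lambda>z. w z $ i) t * cnj (bv (\<lambda>z. p z $ i) t)))"
  proof (rule integral_cong_AE)
    show "(\<lambda>t. bv (mB w) t * cnj (bv (mB p) t) +
      (\<Sum>j\<in>UNIV. bv (\<lambda>z. mA w z $ j) t * cnj (bv (\<lambda>z. mA p z $ j) t))) \<in> borel_measurable circ"
      by (intro borel_measurable_integrable Bochner_Integration.integrable_add Bochner_Integration.integrable_sum i mAj mB_H2 w p)
    show "(\<lambda>t. \<Sum>i\<in>UNIV. bv (\<lambda>z. w z $ i) t * cnj (bv (\<lambda>z. p z $ i) t)) \<in> borel_measurable circ"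
      by (intro borel_measurable_integrable Bochner_Integration.integrable_sum i H2vD w p)
    show "AE t in circ. bv (mB w) t * cnj (bv (mB p) t) +
      (\<Sum>j\<in>UNIV. bv (\<lambda>z. mA w z $ j) t * cnj (bv (\<lambda>z. mA p z $ j) t)) =
      (\<Sum>i\<in>UNIV. bv (\<lambda>z. w z $ i) t * cnj (bv (\<lambda>z. p z $ i) t))"
      using boundary mB_bv[OF w] mB_bv[OF p] mA_bv[OF w] mA_bv[OF p] H2v_has_bv[OF w] H2v_has_bv[OF p]
      by eventually_elim (simp add: bv_nth)
  qed
  also have "\<dots> / (2 * pi) = H2v_inner w p"
    unfolding H2v_inner_def H2_inner_circ
    by (subst Bochner_Integration.integral_sum, intro i H2vD w p) (simp add: sum_divide_distrib)
  finally show ?thesis .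
qed

lemma cB_H2v: "cmod l < 1 \<Longrightarrow> cB l \<in> H2v"
  by (rule H2vI) (simp add: cB_def H2_scale szk_H2)

lemma H2v_inner_cB:
  assumes p: "p \<in> H2v" and l: "cmod l < 1"
  shows "H2v_inner p (cB l) = mB p l"
proof -
  have "H2_inner (\<lambda>z. p z $ i) (\<lambda>z. cB l z $ i) = B l $ i * p l $ i" for i
  proof -
    have "H2_inner (\<lambda>z. p z $ i) (\<lambda>z. cB l z $ i) = cnj (H2_inner (\<lambda>z. cnj (B l $ i) * szk l z) (\<lambda>z. p z $ i))"
      using H2_inner_commute[OF H2_scale(1)[OF szk_H2(1)[OF l]] H2vD[OF p]] by (simp add: cB_def)
    also have "\<dots> = B l $ i * cnj (H2_inner (szk l) (\<lambda>z. p z $ i))"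
      by (simp add: H2_inner_scale_left[OF szk_H2(1)[OF l] H2vD[OF p]])
    also have "cnj (H2_inner (szk l) (\<lambda>z. p z $ i)) = p l $ i"
      using H2_inner_commute[OF szk_H2(1)[OF l] H2vD[OF p]] H2_inner_szk[OF H2vD[OF p] l] by simp
    finally show ?thesis .
  qed
  then show ?thesis
    by (simp add: H2v_inner_def mB_def)
qed

lemma S_H2v: "cmod l < 1 \<Longrightarrow> pair_fun (szk l) (\<lambda>z. 0) \<in> H2v"
  by (simp add: pair_fun_H2v szk_H2 H2v_zero)

lemma kv_H2v: "cmod l < 1 \<Longrightarrow> kv l \<in> H2v"
  unfolding kv_def [abs_def] by (intro H2v_diff S_H2v E_H2v cB_H2v)

lemma inner_S:
  assumes y: "y \<in> H2v" and l: "cmod l < 1"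
  shows "H2v_inner y (pair_fun (szk l) (\<lambda>z. 0)) = y l $ None"
proof -
  let ?g = "\<lambda>z. y z $ None" and ?h = "\<lambda>z. \<chi> j. y z $ Some j"
  have g: "?g \<in> H2" and h: "?h \<in> H2v"
    using y by (auto simp: H2v_def)
  have "H2v_inner ?h (\<lambda>z. 0) = 0"
    using H2v_inner_commute[OF H2v_zero h] H2v_inner_zero_left[OF h] by simp
  then have "H2v_inner (pair_fun ?g ?h) (pair_fun (szk l) (\<lambda>z. 0)) = y l $ None"
    unfolding pair_fun_inner using H2_inner_szk[OF g l] by simp
  then show ?thesis
    using pair_fun_eta[of y] by simp
qed

lemma E_kv:
  assumes p: "p \<in> H2v" and l: "cmod l < 1"
  shows "H2v_inner (E p) (kv l) = 0"
  unfolding kv_def H2v_inner_diff_right[OF S_H2v[OF l] E_H2v[OF cB_H2v[OF l]] E_H2v[OF p]]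
    inner_S[OF E_H2v[OF p] l] E_isometry[OF p cB_H2v[OF l]] H2v_inner_cB[OF p l]
  by (simp add: E_def)

text \<open>\<open>kv l\<close> differs from the pair of \<open>szk l\<close> and 0 by an element of
  the range of \<open>E\<close>, to which \<open>y\<close> is orthogonal; what remains is evaluation
  of the scalar component at \<open>l\<close>.\<close>

lemma inner_kv:
  assumes y: "y \<in> H2v" "\<And>w. w \<in> H2v \<Longrightarrow> H2v_inner y (E w) = 0" and l: "cmod l < 1"
  shows "H2v_inner y (kv l) = y l $ None"
  unfolding kv_def H2v_inner_diff_right[OF S_H2v[OF l] E_H2v[OF cB_H2v[OF l]] y(1)]
    inner_S[OF y(1) l] y(2)[OF cB_H2v[OF l]] by simp

lemma kv_E: "cmod l < 1 \<Longrightarrow> w \<in> H2v \<Longrightarrow> H2v_inner (kv l) (E w) = 0"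
  using H2v_inner_commute[OF E_H2v kv_H2v] E_kv by simp

text \<open>\<open>kv m\<close> is itself orthogonal to the range of \<open>E\<close>, so pairing it
  with \<open>kv l\<close> evaluates its scalar component. Note the order of the arguments of
  \<open>KB\<close>.\<close>

lemma kv_kv:
  assumes "cmod l < 1" "cmod m < 1"
  shows "H2v_inner (kv m) (kv l) = KB B l m"
proof -
  have "H2v_inner (kv m) (kv l) = kv m l $ None"
    by (rule inner_kv[OF kv_H2v[OF assms(2)] kv_E[OF assms(2)] assms(1)])
  also have "\<dots> = KB B l m"
    by (simp add: kv_def E_def mB_def cB_def KB_def szk_def diff_divide_distrib sum_divide_distrib mult.commute)
  finally show ?thesis .
qed

text \<open>The sign moves both terms of the adjoint relation to one side, where they form the inner
  product with \<open>E w\<close>.\<close>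

lemma Tadj_iff: "Tadj g (\<lambda>z. - h z) \<longleftrightarrow> pair_fun g h \<in> H2v \<and> (\<forall>w\<in>H2v. H2v_inner (pair_fun g h) (E w) = 0)"
proof -
  have hn: "(\<lambda>z. - h z) \<in> H2v \<longleftrightarrow> h \<in> H2v"
    using H2v_uminus[of h] H2v_uminus[of "\<lambda>z. - h z"] by auto
  have "(H2_inner (mB w) g = H2v_inner (mA w) (\<lambda>z. - h z)) \<longleftrightarrow> H2v_inner (pair_fun g h) (E w) = 0"
    if "g \<in> H2" "h \<in> H2v" "w \<in> H2v" for w
  proof -
    have gh: "pair_fun g h \<in> H2v"
      using that by (simp add: pair_fun_H2v)
    have "H2v_inner (pair_fun g h) (E w) = cnj (H2_inner (mB w) g + H2v_inner (mA w) h)"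
      using H2v_inner_commute[OF E_H2v[OF that(3)] gh] by (simp add: E_def pair_fun_inner)
    then show ?thesis
      by (simp add: H2v_inner_uminus_right[OF that(2) mA_H2v[OF that(3)]] eq_neg_iff_add_eq_0 flip: complex_cnj_add)
  qed
  then show ?thesis
    unfolding Tadj_def pair_fun_H2v hn by blast
qed

section \<open>Combinations of kernels and the domination criterion\<close>

definition comb :: "complex set \<Rightarrow> (complex \<Rightarrow> complex) \<Rightarrow> complex \<Rightarrow> complex^('n option)" where
  "comb F c = (\<lambda>z. \<Sum>w\<in>F. c w *s kv w z)"

lemma comb_H2v: "F \<subseteq> ball 0 1 \<Longrightarrow> comb F c \<in> H2v"
  unfolding comb_def by (intro H2v_sum H2v_scale kv_H2v) auto

lemma inner_comb: "F \<subseteq> ball 0 1 \<Longrightarrow> y \<in> H2v \<Longrightarrow> H2v_inner y (comb F c) = (\<Sum>w\<in>F. cnj (c w) * H2v_inner y (kv w))"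
  unfolding comb_def
  by (subst H2v_inner_sum_right) (auto intro!: H2v_scale kv_H2v sum.cong H2v_inner_scale_right)

lemma comb_inner: "F \<subseteq> ball 0 1 \<Longrightarrow> y \<in> H2v \<Longrightarrow> H2v_inner (comb F c) y = (\<Sum>w\<in>F. c w * H2v_inner (kv w) y)"
  unfolding comb_def
  by (subst H2v_inner_sum_left) (auto intro!: H2v_scale kv_H2v sum.cong H2v_inner_scale_left)

text \<open>The quadratic form is a Gram norm minus a square. The coefficients are conjugated in
  \<open>comb\<close> because \<open>kv_kv\<close> has the arguments of \<open>KB\<close> in the
  opposite order to the inner product.\<close>

lemma kernel_sum:
  assumes F: "F \<subseteq> ball 0 1"
  shows "(\<Sum>z\<in>F. \<Sum>w\<in>F. c z * cnj (c w) * (complex_of_real (C\<^sup>2) * KB B z w - f z * cnj (f w))) =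
    complex_of_real (C\<^sup>2 * (H2v_norm (comb F (\<lambda>z. cnj (c z))))\<^sup>2 - (cmod (\<Sum>z\<in>F. c z * f z))\<^sup>2)"
proof -
  let ?v = "comb F (\<lambda>z. cnj (c z))"
  have v: "?v \<in> H2v"
    by (rule comb_H2v[OF F])
  have "complex_of_real ((H2v_norm ?v)\<^sup>2) = (\<Sum>w\<in>F. c w * H2v_inner ?v (kv w))"
    unfolding H2v_inner_self[OF v, symmetric] by (subst inner_comb[OF F v]) simp
  also have "\<dots> = (\<Sum>w\<in>F. \<Sum>z\<in>F. c w * cnj (c z) * KB B w z)"
  proof (intro sum.cong refl)
    fix w assume "w \<in> F"
    then have w: "cmod w < 1" using F by auto
    have "H2v_inner ?v (kv w) = (\<Sum>z\<in>F. cnj (c z) * KB B w z)"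
      unfolding comb_inner[OF F kv_H2v[OF w]] by (intro sum.cong refl) (use F w in \<open>auto simp: kv_kv subset_iff\<close>)
    then show "c w * H2v_inner ?v (kv w) = (\<Sum>z\<in>F. c w * cnj (c z) * KB B w z)"
      by (simp add: sum_distrib_left mult.assoc)
  qed
  finally have 1: "complex_of_real ((H2v_norm ?v)\<^sup>2) = (\<Sum>z\<in>F. \<Sum>w\<in>F. c z * cnj (c w) * KB B z w)" .
  have 2: "complex_of_real ((cmod (\<Sum>z\<in>F. c z * f z))\<^sup>2) = (\<Sum>z\<in>F. \<Sum>w\<in>F. c z * cnj (c w) * (f z * cnj (f w)))"
    unfolding complex_norm_square cnj_sum sum_product by (simp add: mult_ac)
  show ?thesis
    unfolding of_real_diff of_real_mult 1 2 right_diff_distrib sum_subtractf sum_distrib_left by (simp add: mult_ac)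
qed

lemma sum_zero_extend:
  fixes g :: "complex \<Rightarrow> complex \<Rightarrow> 'x::comm_monoid_add"
  assumes "finite F" "F \<subseteq> H" "finite H" "\<And>w. g 0 w = 0"
  shows "(\<Sum>w\<in>F. g (c w) w) = (\<Sum>w\<in>H. g (if w \<in> F then c w else 0) w)"
  using assms by (intro sum.mono_neutral_cong_left) auto

text \<open>The second entry is the value of the inner product with a sought \<open>y\<close> whose
  scalar component is \<open>f\<close>, since pairing \<open>kv w\<close> with such a
  \<open>y\<close> in the complement of the range gives \<open>cnj (f w)\<close>. A relation is used
  because one function may be a combination of kernels in several ways.\<close>

definition interp_rel :: "(complex \<Rightarrow> complex) \<Rightarrow> ((complex \<Rightarrow> complex^('n option)) \<times> complex) set" where
  "interp_rel f = {(comb F c, \<Sum>w\<in>F. c w * cnj (f w)) | F c. finite F \<and> F \<subseteq> ball 0 1}"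

lemma interp_relI: "finite F \<Longrightarrow> F \<subseteq> ball 0 1 \<Longrightarrow> (comb F c, \<Sum>w\<in>F. c w * cnj (f w)) \<in> interp_rel f"
  unfolding interp_rel_def mem_Collect_eq by (intro exI[of _ F] exI[of _ c]) simp

lemma interp_relE:
  assumes "(x, a) \<in> interp_rel f"
  obtains F c where "finite F" "F \<subseteq> ball 0 1" "x = comb F c" "a = (\<Sum>w\<in>F. c w * cnj (f w))"
  using assms by (auto simp: interp_rel_def)

lemma interp_rel_diff:
  assumes x: "(x, a) \<in> interp_rel f" and y: "(y, b) \<in> interp_rel f"
  shows "((\<lambda>z. x z - s *s y z), a - s * b) \<in> interp_rel f"
proof -
  obtain F c where F: "finite F" "F \<subseteq> ball 0 1" "x = comb F c" "a = (\<Sum>w\<in>F. c w * cnj (f w))"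
    by (rule interp_relE[OF x])
  obtain G d where G: "finite G" "G \<subseteq> ball 0 1" "y = comb G d" "b = (\<Sum>w\<in>G. d w * cnj (f w))"
    by (rule interp_relE[OF y])
  let ?H = "F \<union> G"
  \<comment> \<open>Both coefficient families are extended by 0 to the common support.\<close>
  define c' where "c' w = (if w \<in> F then c w else 0)" for w
  define d' where "d' w = (if w \<in> G then d w else 0)" for w
  have H: "finite ?H" "?H \<subseteq> ball 0 1"
    using F(1,2) G(1,2) by auto
  have x': "x = comb ?H c'" and y': "y = comb ?H d'"
    unfolding F(3) G(3) comb_def c'_def d'_def
    using sum_zero_extend[OF F(1) _ H(1), of "\<lambda>k w. k *s kv w _" c]
      sum_zero_extend[OF G(1) _ H(1), of "\<lambda>k w. k *s kv w _" d] by auto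
  have a': "a = (\<Sum>w\<in>?H. c' w * cnj (f w))" and b': "b = (\<Sum>w\<in>?H. d' w * cnj (f w))"
    unfolding F(4) G(4) c'_def d'_def
    using sum_zero_extend[OF F(1) _ H(1), of "\<lambda>k w. k * cnj (f w)" c]
      sum_zero_extend[OF G(1) _ H(1), of "\<lambda>k w. k * cnj (f w)" d] by auto
  have "(\<lambda>z. x z - s *s y z) = comb ?H (\<lambda>w. c' w - s * d' w)"
    unfolding x' y' comb_def
    by (rule ext) (simp add: vec.scale_sum_right vec.scale_left_diff_distrib sum_subtractf)
  moreover have "a - s * b = (\<Sum>w\<in>?H. (c' w - s * d' w) * cnj (f w))"
    unfolding a' b' by (simp add: sum_distrib_left left_diff_distrib sum_subtractf mult.assoc)
  ultimately show ?thesis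
    using interp_relI[OF H] by simp
qed

lemma interp_rel_bound:
  assumes pos: "pos_kernel (\<lambda>z w. complex_of_real (C\<^sup>2) * KB B z w - f z * cnj (f w))"
    and C: "0 \<le> C" and F: "finite F" "F \<subseteq> ball 0 1"
  shows "cmod (\<Sum>w\<in>F. c w * cnj (f w)) \<le> C * H2v_norm (comb F c)"
proof -
  let ?s = "\<Sum>z\<in>F. \<Sum>w\<in>F. cnj (c z) * cnj (cnj (c w)) * (complex_of_real (C\<^sup>2) * KB B z w - f z * cnj (f w))"
  have "0 \<le> Re ?s"
    using pos[unfolded pos_kernel_def Let_def, rule_format, of F "\<lambda>z. cnj (c z)"] F by blast
  also have "?s = complex_of_real (C\<^sup>2 * (H2v_norm (comb F (\<lambda>z. cnj (cnj (c z)))))\<^sup>2 - (cmod (\<Sum>z\<in>F. cnj (c z) * f z))\<^sup>2)"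
    by (rule kernel_sum[OF F(2)])
  finally have "(cmod (\<Sum>z\<in>F. cnj (c z) * f z))\<^sup>2 \<le> C\<^sup>2 * (H2v_norm (comb F c))\<^sup>2"
    by (simp only: Re_complex_of_real complex_cnj_cnj diff_ge_0_iff_ge)
  moreover have "(\<Sum>w\<in>F. c w * cnj (f w)) = cnj (\<Sum>z\<in>F. cnj (c z) * f z)"
    by simp
  ultimately have "(cmod (\<Sum>w\<in>F. c w * cnj (f w)))\<^sup>2 \<le> (C * H2v_norm (comb F c))\<^sup>2"
    by (simp only: complex_mod_cnj power_mult_distrib)
  then show ?thesis
    by (rule power2_le_imp_le) (intro mult_nonneg_nonneg C H2v_norm_nonneg)
qed

text \<open>Positivity bounds the functional on combinations of kernels by \<open>C\<close>. The
  representing \<open>y\<close> lies in their closed span, hence is orthogonal to the range of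
  \<open>E\<close>; its scalar component agrees with \<open>f\<close> in the disc by evaluation
  against \<open>kv l\<close>, and its vector component is minus the value of the adjoint.\<close>

lemma kernel_domination_imp_Tadj:
  assumes pos: "pos_kernel (\<lambda>z w. complex_of_real (C\<^sup>2) * KB B z w - f z * cnj (f w))" and C: "0 \<le> C"
  shows "\<exists>h. Tadj f h \<and> (H2_norm f)\<^sup>2 + (H2v_norm h)\<^sup>2 \<le> C\<^sup>2"
proof -
  obtain y where y: "y \<in> H2v" "H2v_norm y \<le> C" "\<And>x a. (x, a) \<in> interp_rel f \<Longrightarrow> H2v_inner x y = a"
    "\<And>v. v \<in> H2v \<Longrightarrow> (\<And>x a. (x, a) \<in> interp_rel f \<Longrightarrow> H2v_inner x v = 0) \<Longrightarrow> H2v_inner y v = 0"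
  proof (rule H2v_Riesz[of "interp_rel f" C])
    show "x \<in> H2v" if "(x, a) \<in> interp_rel f" for x a
      by (rule interp_relE[OF that]) (simp only: comb_H2v)
    show "interp_rel f \<noteq> {}"
      using interp_relI[of "{}" "\<lambda>_. 0" f] by auto
    show "cmod a \<le> C * H2v_norm x" if "(x, a) \<in> interp_rel f" for x a
      by (rule interp_relE[OF that]) (simp only: interp_rel_bound[OF pos C])
    show "((\<lambda>z. x z - s *s y z), a - s * b) \<in> interp_rel f" if "(x, a) \<in> interp_rel f" "(y, b) \<in> interp_rel f" for x a y b s
      using that by (rule interp_rel_diff)
  next
    fix y assume "y \<in> H2v" "H2v_norm y \<le> C" "\<And>x a. (x, a) \<in> interp_rel f \<Longrightarrow> H2v_inner x y = a"
      "\<And>v. v \<in> H2v \<Longrightarrow> (\<And>x a. (x, a) \<in> interp_rel f \<Longrightarrow> H2v_inner x v = 0) \<Longrightarrow> H2v_inner y v = 0"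
    then show thesis
      by (rule that)
  qed (rule C)
  let ?g = "\<lambda>z. y z $ None" and ?h = "\<lambda>z. \<chi> j. y z $ Some j"
  have orth: "H2v_inner y (E w) = 0" if "w \<in> H2v" for w
  proof (rule y(4)[OF E_H2v[OF that]])
    fix x a assume "(x, a) \<in> interp_rel f"
    then obtain F c where F: "F \<subseteq> ball 0 1" "x = comb F c"
      by (rule interp_relE)
    have "H2v_inner (kv l) (E w) = 0" if "l \<in> F" for l
      using F(1) that \<open>w \<in> H2v\<close> by (intro kv_E) auto
    then show "H2v_inner x (E w) = 0"
      unfolding F(2) comb_inner[OF F(1) E_H2v[OF \<open>w \<in> H2v\<close>]] by simp
  qed
  have fy: "?g l = f l" if l: "cmod l < 1" for l
  proof -
    have "(comb {l} (\<lambda>_. 1), \<Sum>w\<in>{l}. 1 * cnj (f w)) \<in> interp_rel f"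
      by (rule interp_relI) (use l in auto)
    from y(3)[OF this] have "H2v_inner (kv l) y = cnj (f l)"
      by (simp add: comb_def)
    then have "H2v_inner y (kv l) = f l"
      using H2v_inner_commute[OF kv_H2v[OF l] y(1)] by simp
    then show ?thesis
      using inner_kv[OF y(1) orth l] by simp
  qed
  have gH: "?g \<in> H2" and hH: "?h \<in> H2v"
    using y(1) by (auto simp: H2v_def)
  have "Tadj ?g (\<lambda>z. - ?h z)"
    unfolding Tadj_iff pair_fun_eta[symmetric] using y(1) orth by blast
  moreover have "H2_inner (mB w) ?g = H2_inner (mB w) f" for w
    by (rule H2_inner_cong) (simp_all add: fy)
  \<comment> \<open>Membership of \<open>f\<close> in \<open>H2\<close> is a conclusion here,
    inherited from the scalar component of \<open>y\<close>.\<close>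
  ultimately have "Tadj f (\<lambda>z. - ?h z)"
    using H2_cong(1)[OF gH fy] by (simp add: Tadj_def)
  moreover have "(H2_norm f)\<^sup>2 + (H2v_norm (\<lambda>z. - ?h z))\<^sup>2 \<le> C\<^sup>2"
  proof -
    have "H2_norm f = H2_norm ?g"
      by (rule H2_norm_cong) (simp add: fy)
    moreover have "(H2v_norm (\<lambda>z. - ?h z))\<^sup>2 = (H2v_norm ?h)\<^sup>2"
      using H2v_norm_scale_sq[OF hH, of "-1"] by (simp add: vector_sneg_minus1 [symmetric])
    ultimately have "(H2_norm f)\<^sup>2 + (H2v_norm (\<lambda>z. - ?h z))\<^sup>2 = (H2v_norm y)\<^sup>2"
      using pair_fun_norm[of ?g ?h] pair_fun_eta[of y] by simp
    then show ?thesis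
      using power_mono[OF y(2) H2v_norm_nonneg, of 2] by simp
  qed
  ultimately show "\<exists>h. Tadj f h \<and> (H2_norm f)\<^sup>2 + (H2v_norm h)\<^sup>2 \<le> C\<^sup>2"
    by blast
qed

text \<open>Cauchy-Schwarz for the pair of \<open>f\<close> and \<open>-h\<close> against
  combinations of kernels, on which this pair acts by evaluating \<open>f\<close>.\<close>

lemma Tadj_imp_kernel_domination:
  assumes h: "Tadj f h" "(H2_norm f)\<^sup>2 + (H2v_norm h)\<^sup>2 \<le> C\<^sup>2"
  shows "pos_kernel (\<lambda>z w. complex_of_real (C\<^sup>2) * KB B z w - f z * cnj (f w))"
proof -
  let ?y = "pair_fun f (\<lambda>z. - h z)"
  have y: "?y \<in> H2v" "\<And>w. w \<in> H2v \<Longrightarrow> H2v_inner ?y (E w) = 0"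
    using h(1) Tadj_iff[of f "\<lambda>z. - h z"] by auto
  have hH: "h \<in> H2v"
    using h(1) by (simp add: Tadj_def)
  have ny: "(H2v_norm ?y)\<^sup>2 \<le> C\<^sup>2"
    using h(2) H2v_norm_scale_sq[OF hH, of "-1"] by (simp add: pair_fun_norm vector_sneg_minus1 [symmetric])
  show "pos_kernel (\<lambda>z w. complex_of_real (C\<^sup>2) * KB B z w - f z * cnj (f w))"
    unfolding pos_kernel_def Let_def
  proof (intro allI impI)
    fix F :: "complex set" and c assume F: "finite F \<and> F \<subseteq> ball 0 1"
    let ?v = "comb F (\<lambda>z. cnj (c z))"
    have v: "?v \<in> H2v"
      using F by (intro comb_H2v) blast
    have "H2v_inner ?y ?v = (\<Sum>z\<in>F. c z * H2v_inner ?y (kv z))"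
      using inner_comb[OF _ y(1), of F "\<lambda>z. cnj (c z)"] F by simp
    also have "\<dots> = (\<Sum>z\<in>F. c z * f z)"
      using F by (intro sum.cong refl) (auto simp: inner_kv[OF y] subset_iff)
    finally have "cmod (\<Sum>z\<in>F. c z * f z) \<le> H2v_norm ?y * H2v_norm ?v"
      using H2v_Cauchy_Schwarz[OF y(1) v] by simp
    then have "(cmod (\<Sum>z\<in>F. c z * f z))\<^sup>2 \<le> (H2v_norm ?y * H2v_norm ?v)\<^sup>2"
      by (rule power_mono) simp
    also have "\<dots> \<le> C\<^sup>2 * (H2v_norm ?v)\<^sup>2"
      unfolding power_mult_distrib using ny by (rule mult_right_mono) simp
    finally show "Im (\<Sum>z\<in>F. \<Sum>w\<in>F. c z * cnj (c w) * (complex_of_real (C\<^sup>2) * KB B z w - f z * cnj (f w))) = 0 \<and>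
        0 \<le> Re (\<Sum>z\<in>F. \<Sum>w\<in>F. c z * cnj (c w) * (complex_of_real (C\<^sup>2) * KB B z w - f z * cnj (f w)))"
      using F by (subst (1 2) kernel_sum) auto
  qed
qed

lemma kernel_domination_iff:
  assumes "0 \<le> C"
  shows "pos_kernel (\<lambda>z w. complex_of_real (C\<^sup>2) * KB B z w - f z * cnj (f w)) \<longleftrightarrow>
    (\<exists>h. Tadj f h \<and> (H2_norm f)\<^sup>2 + (H2v_norm h)\<^sup>2 \<le> C\<^sup>2)"
  using kernel_domination_imp_Tadj[OF _ assms] Tadj_imp_kernel_domination by blast

lemma HB_iff: "f \<in> HB B \<longleftrightarrow> (\<exists>h. Tadj f h)"
proof
  assume "f \<in> HB B"
  then obtain c where "pos_kernel (\<lambda>z w. complex_of_real (c\<^sup>2) * KB B z w - f z * cnj (f w))"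
    unfolding HB_def by blast
  \<comment> \<open>\<open>HB\<close> admits constants of either sign, whereas the criterion asks
    for a nonnegative one.\<close>
  then have "pos_kernel (\<lambda>z w. complex_of_real (\<bar>c\<bar>\<^sup>2) * KB B z w - f z * cnj (f w))"
    by (simp only: power2_abs)
  then show "\<exists>h. Tadj f h"
    using kernel_domination_iff[of "\<bar>c\<bar>" f] by auto
next
  assume "\<exists>h. Tadj f h"
  then obtain h where h: "Tadj f h" by blast
  let ?C = "sqrt ((H2_norm f)\<^sup>2 + (H2v_norm h)\<^sup>2)"
  have "(H2_norm f)\<^sup>2 + (H2v_norm h)\<^sup>2 \<le> ?C\<^sup>2"
    by simp
  then have "pos_kernel (\<lambda>z w. complex_of_real (?C\<^sup>2) * KB B z w - f z * cnj (f w))"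
    using kernel_domination_iff[of ?C f] h by auto
  then show "f \<in> HB B"
    unfolding HB_def by blast
qed

text \<open>Since all values of the adjoint at \<open>f\<close> have the same norm, the admissible
  constants form a closed half-line, whose left end is the infimum in
  \<open>HB_norm\<close>.\<close>

lemma HB_norm_eq:
  assumes h: "Tadj f h"
  shows "(HB_norm B f)\<^sup>2 = (H2_norm f)\<^sup>2 + (H2v_norm h)\<^sup>2"
proof -
  let ?N = "(H2_norm f)\<^sup>2 + (H2v_norm h)\<^sup>2"
  have "{c. 0 \<le> c \<and> pos_kernel (\<lambda>z w. complex_of_real (c\<^sup>2) * KB B z w - f z * cnj (f w))} = {sqrt ?N..}"
  proof (intro set_eqI iffI)
    fix c assume "c \<in> {c. 0 \<le> c \<and> pos_kernel (\<lambda>z w. complex_of_real (c\<^sup>2) * KB B z w - f z * cnj (f w))}"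
    then obtain h' where c: "0 \<le> c" and h': "Tadj f h'" "(H2_norm f)\<^sup>2 + (H2v_norm h')\<^sup>2 \<le> c\<^sup>2"
      using kernel_domination_iff[of c f] by auto
    have "?N \<le> c\<^sup>2"
      using h'(2) Tadj_unique[OF h h'(1)] by simp
    then show "c \<in> {sqrt ?N..}"
      using c by (simp add: real_le_lsqrt)
  next
    fix c assume "c \<in> {sqrt ?N..}"
    then have c: "sqrt ?N \<le> c" by simp
    moreover have "0 \<le> sqrt ?N" by simp
    ultimately have c0: "0 \<le> c" by linarith
    have "?N \<le> c\<^sup>2"
      using c by (rule sqrt_le_D)
    then show "c \<in> {c. 0 \<le> c \<and> pos_kernel (\<lambda>z w. complex_of_real (c\<^sup>2) * KB B z w - f z * cnj (f w))}"
      using kernel_domination_iff[OF c0, of f] h c0 by blast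
  qed
  then show ?thesis
    unfolding HB_norm_def by simp
qed

end

theorem theorem2p1:
  fixes B :: "complex \<Rightarrow> complex^'n" and A :: "complex \<Rightarrow> complex^'n^'n"
    and \<phi> :: "complex \<Rightarrow> complex^'n"
  assumes "schur_row B"
    and "set_integrable lborel {0..2*pi} (\<lambda>t. ln (1 - (norm (bv B t))\<^sup>2))"
    and "AE t in lborel. t \<in> {0..2*pi} \<longrightarrow> norm (bv B t) < 1"
    and "outer_mat A"
    and "AE t in lborel. t \<in> {0..2*pi} \<longrightarrow>
           (\<forall>i j. cnj (bv B t $ i) * bv B t $ j + (\<Sum>k\<in>UNIV. cnj (bv A t $ k $ i) * bv A t $ k $ j)
                   = (if i = j then 1 else 0))"
    and "\<forall>z\<in>ball 0 1. \<phi> z = B z v* matrix_inv (A z)"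
  shows "dense_in_H2v (toep_row_dom (bv \<phi>)) \<and>
         {g \<in> H2. \<exists>h. adj_row (toep_row_dom (bv \<phi>)) (toep_row (bv \<phi>)) g h} = HB B \<and>
         (\<forall>f\<in>HB B. \<forall>fp. is_fplus B A f fp \<longrightarrow>
           adj_row (toep_row_dom (bv \<phi>)) (toep_row (bv \<phi>)) f (\<lambda>z. - fp z)) \<and>
         (\<forall>f\<in>HB B. \<forall>h. adj_row (toep_row_dom (bv \<phi>)) (toep_row (bv \<phi>)) f h \<longrightarrow>
           (HB_norm B f)\<^sup>2 = (H2_norm f)\<^sup>2 + (H2v_norm h)\<^sup>2)"
proof -
  interpret outer_pair B A \<phi>
    using assms by unfold_locales
  have "{g \<in> H2. \<exists>h. Tadj g h} = HB B"
    using HB_iff by (auto simp: Tadj_def)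
  then show ?thesis
    unfolding adj_row_iff using dom_dense is_fplus_Tadj HB_norm_eq by blast
qed

end
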